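(* Let $\Phi:\mathbb{C}\to\mathbb{C}$ be a non-constant entire function of exponential type with $|\Phi(0)|=1$. Then the generic element $f=(f_n)_{n=1}^\infty$ of $H(\mathbb{C})^{\mathbb{N}}$ freely generates a dense hypercyclic algebra for $\Phi(D)$ in each of the following cases: (a) $\Phi$ is of subexponential growth and $\min\{n\in\mathbb{N}:\Phi^{(n)}(0)\neq0\}$ is odd. (b) $\Phi$ is of the form $\Phi(z)=e^{az+b}p(z)$ for some $a,b\in\mathbb{C}$ with $a\neq0$ and $\operatorname{Re}(b)=0$, and some non-constant polynomial $p(z)=1+a_1z+a_2z^2+\dots+a_rz^r$ with either $a_1a^{-1}\in\mathbb{C}\setminus\mathbb{R}$, or with both $2a_2\neq a_1^2$ and $a_1+a\neq0$. (c) $\Phi$ has Hadamard factorization $\Phi(z)=e^{az+b}\prod_{n=1}^\infty E_p\left(\frac{z}{z_n}\right)$ satisfying $$\sum_{n=1}^\infty z_n^{-2}\neq0,\qquad a\neq0,\qquad \operatorname{Re}(b)=0,\qquad\text{and}\qquad \sum_{n=1}^\infty z_n^{-1}\neq a\ \text{ if }\ \sum_{n=1}^\infty|z_n|^{-1}<\infty.$$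
   Context: $\mathbb{N}$ is the set of positive integers. $H(\mathbb{C})$ is the algebra (under pointwise multiplication) of entire functions on $\mathbb{C}$ with the compact-open topology; $H(\mathbb{C})^{\mathbb{N}}$ carries the product topology; $D:f\mapsto f'$. For a non-constant entire function $\Phi$ let $M(r)=\sup_{|z|\le r}|\Phi(z)|$; its order is $\rho=\limsup_{r\to\infty}\frac{\log\log M(r)}{\log r}$ and, if $\rho<\infty$, its type is $\tau=\limsup_{r\to\infty}r^{-\rho}\log M(r)$. $\Phi$ is of exponential type if it has order less than $1$, or order $1$ and finite type; it is of subexponential growth if it has order less than $1$, or order $1$ and type $0$. For $\Phi(z)=\sum_{n\ge0}a_nz^n$ of exponential type, $\Phi(D):H(\mathbb{C})\to H(\mathbb{C})$ is the continuous linear operator $f\mapsto\sum_{n\ge0}a_nD^nf$. A vector is hypercyclic for an operator $T$ if its orbit under $T$ is dense. A hypercyclic algebra for $T$ is a (nonzero) subalgebra all of whose non-zero elements are hypercyclic vectors for $T$. A statement holds for the generic element of an $F$-space $Y$ if it holds at each element of some dense $G_\delta$ subset of $Y$. A sequence $(f_n)$ freely generates a dense hypercyclic algebra for $T$ if the $f_n$ are free generators (i.e. $P(f_1,\dots,f_k)\ne0$ for every $k$ and every nonzero polynomial $P$ in $k$ commuting variables without constant term), and the subalgebra they generate (the set of all such $P(f_1,\dots,f_k)$, together with $0$) is dense and is a hypercyclic algebra for $T$. In (b), $a_2$ is the coefficient of $z^2$ in $p$ (so $a_2=0$ if $r=1$). In (c), $(z_n)$ is the sequence of zeros of $\Phi$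 listed with multiplicity, with $0<|z_1|\le|z_2|\le\dots$; $E_0(z)=1-z$, $E_1(z)=(1-z)e^z$; and $p=0$ if $\sum_n|z_n|^{-1}<\infty$, $p=1$ if $\sum_n|z_n|^{-1}=\infty$ (these are the only cases for $\Phi$ of exponential type). *)

theory Defs
  imports
    "HOL-Complex_Analysis.Complex_Analysis"
    "HOL-Computational_Algebra.Polynomial"
    "HOL-Library.Poly_Mapping"
begin

section \<open>Growth of entire functions\<close>

definition max_modulus :: "(complex \<Rightarrow> complex) \<Rightarrow> real \<Rightarrow> real" where
  "max_modulus \<Phi> r = (SUP z\<in>cball 0 r. norm (\<Phi> z))"

definition growth_order :: "(complex \<Rightarrow> complex) \<Rightarrow> ereal" where
  "growth_order \<Phi> = Limsup at_top (\<lambda>r. ereal (ln (ln (max_modulus \<Phi> r)) / ln r))"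

text \<open>Only meaningful for functions of finite order, since \<^const>\<open>real_of_ereal\<close> maps infinity to 0.\<close>

definition growth_type :: "(complex \<Rightarrow> complex) \<Rightarrow> ereal" where
  "growth_type \<Phi> =
     Limsup at_top (\<lambda>r. ereal (r powr (- real_of_ereal (growth_order \<Phi>)) * ln (max_modulus \<Phi> r)))"

definition exponential_type :: "(complex \<Rightarrow> complex) \<Rightarrow> bool" where
  "exponential_type \<Phi> \<longleftrightarrow>
     growth_order \<Phi> < 1 \<or> (growth_order \<Phi> = 1 \<and> growth_type \<Phi> < \<infinity>)"

definition subexponential_growth :: "(complex \<Rightarrow> complex) \<Rightarrow> bool" where
  "subexponential_growth \<Phi> \<longleftrightarrow>
     growth_order \<Phi> < 1 \<or> (growth_order \<Phi> = 1 \<and> growth_type \<Phi> = 0)"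


section \<open>The spaces of entire functions and of sequences of entire functions\<close>

definition entire :: "(complex \<Rightarrow> complex) set" where
  "entire = {f. f holomorphic_on UNIV}"

text \<open>The compact-open topology.\<close>

definition entire_topology :: "(complex \<Rightarrow> complex) topology" where
  "entire_topology =
     topology_generated_by {{f \<in> entire. f ` K \<subseteq> U} | K U. compact K \<and> open U}"

lemma topspace_entire_topology [simp]: "topspace entire_topology = entire"
proof -
  have "\<exists>K U. entire = {f \<in> entire. f ` K \<subseteq> U} \<and> compact K \<and> open U"
    by (rule exI[of _ "{}"], rule exI[of _ UNIV]) auto
  then show ?thesis
    unfolding entire_topology_def topology_generated_by_topspace by blast
qed

text \<open>Sequences are indexed from 0, so \<open>f n\<close> is the \<open>(n + 1)\<close>-st term.\<close>

definition entire_seq_topology :: "(nat \<Rightarrow> complex \<Rightarrow> complex) topology" where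
  "entire_seq_topology = product_topology (\<lambda>_. entire_topology) UNIV"

definition dense_in :: "'a topology \<Rightarrow> 'a set \<Rightarrow> bool" where
  "dense_in X S \<longleftrightarrow> S \<subseteq> topspace X \<and> X closure_of S = topspace X"

definition generic_in :: "'a topology \<Rightarrow> ('a \<Rightarrow> bool) \<Rightarrow> bool" where
  "generic_in X P \<longleftrightarrow> (\<exists>G. gdelta_in X G \<and> dense_in X G \<and> (\<forall>x\<in>G. P x))"


section \<open>The operator \<open>\<Phi>(D)\<close> and hypercyclicity\<close>

text \<open>For \<open>\<Phi>\<close> of exponential type and entire \<open>f\<close> the series converges locally uniformly,
  so that its sum in the space of entire functions is the pointwise sum.\<close>

definition diff_op :: "(complex \<Rightarrow> complex) \<Rightarrow> (complex \<Rightarrow> complex) \<Rightarrow> complex \<Rightarrow> complex" where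
  "diff_op \<Phi> f = (\<lambda>z. suminf (\<lambda>n. (deriv ^^ n) \<Phi> 0 / fact n * (deriv ^^ n) f z))"

definition hypercyclic_vector ::
    "((complex \<Rightarrow> complex) \<Rightarrow> complex \<Rightarrow> complex) \<Rightarrow> (complex \<Rightarrow> complex) \<Rightarrow> bool" where
  "hypercyclic_vector T f \<longleftrightarrow> f \<in> entire \<and> dense_in entire_topology {(T ^^ n) f | n. True}"

text \<open>Subalgebras are not required to contain the constant function 1.\<close>

definition entire_subalgebra :: "(complex \<Rightarrow> complex) set \<Rightarrow> bool" where
  "entire_subalgebra A \<longleftrightarrow>
     A \<subseteq> entire \<and> (\<lambda>_. 0) \<in> A \<and>
     (\<forall>f\<in>A. \<forall>g\<in>A. (\<lambda>z. f z + g z) \<in> A \<and> (\<lambda>z. f z * g z) \<in> A) \<and>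
     (\<forall>c. \<forall>f\<in>A. (\<lambda>z. c * f z) \<in> A)"

definition hypercyclic_algebra ::
    "((complex \<Rightarrow> complex) \<Rightarrow> complex \<Rightarrow> complex) \<Rightarrow> (complex \<Rightarrow> complex) set \<Rightarrow> bool" where
  "hypercyclic_algebra T A \<longleftrightarrow>
     entire_subalgebra A \<and> A \<noteq> {\<lambda>_. 0} \<and>
     (\<forall>f\<in>A. f \<noteq> (\<lambda>_. 0) \<longrightarrow> hypercyclic_vector T f)"


section \<open>Free generation\<close>

text \<open>A polynomial in commuting variables \<open>x\<^sub>0, x\<^sub>1, \<dots>\<close> is a finitely supported map from
  monomials to coefficients, a monomial being a finitely supported map from variable indices
  to exponents.\<close>

type_synonym cpoly = "(nat \<Rightarrow>\<^sub>0 nat) \<Rightarrow>\<^sub>0 complex"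

definition polys_without_const :: "nat \<Rightarrow> cpoly set" where
  "polys_without_const k =
     {P. Poly_Mapping.lookup P 0 = 0 \<and>
         (\<forall>m\<in>Poly_Mapping.keys P. Poly_Mapping.keys m \<subseteq> {..<k})}"

definition eval_cpoly :: "cpoly \<Rightarrow> (nat \<Rightarrow> complex \<Rightarrow> complex) \<Rightarrow> complex \<Rightarrow> complex" where
  "eval_cpoly P f = (\<lambda>z. \<Sum>m\<in>Poly_Mapping.keys P.
     Poly_Mapping.lookup P m * (\<Prod>i\<in>Poly_Mapping.keys m. f i z ^ Poly_Mapping.lookup m i))"

definition free_generators :: "(nat \<Rightarrow> complex \<Rightarrow> complex) \<Rightarrow> bool" where
  "free_generators f \<longleftrightarrow>
     (\<forall>k. \<forall>P\<in>polys_without_const k. P \<noteq> 0 \<longrightarrow> eval_cpoly P f \<noteq> (\<lambda>_. 0))"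

definition generated_algebra :: "(nat \<Rightarrow> complex \<Rightarrow> complex) \<Rightarrow> (complex \<Rightarrow> complex) set" where
  "generated_algebra f = {eval_cpoly P f | k P. P \<in> polys_without_const k}"

definition freely_generates_dense_hypercyclic_algebra ::
    "((complex \<Rightarrow> complex) \<Rightarrow> complex \<Rightarrow> complex) \<Rightarrow> (nat \<Rightarrow> complex \<Rightarrow> complex) \<Rightarrow> bool" where
  "freely_generates_dense_hypercyclic_algebra T f \<longleftrightarrow>
     free_generators f \<and>
     dense_in entire_topology (generated_algebra f) \<and>
     hypercyclic_algebra T (generated_algebra f)"


section \<open>Hadamard factorization\<close>

text \<open>The sequence \<open>z\<close> lists all zeros of \<open>\<Phi>\<close> with multiplicity, by increasing modulus;
  in particular \<open>\<Phi>\<close> has infinitely many zeros and none at the origin. A fibre of \<open>z\<close> over a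
  zero is finite since its cardinality is the (positive) order of that zero.\<close>

definition zero_sequence :: "(complex \<Rightarrow> complex) \<Rightarrow> (nat \<Rightarrow> complex) \<Rightarrow> bool" where
  "zero_sequence \<Phi> z \<longleftrightarrow>
     range z = {w. \<Phi> w = 0} \<and>
     (\<forall>w. \<Phi> w = 0 \<longrightarrow> int (card {n. z n = w}) = zorder \<Phi> w) \<and>
     (\<forall>n. 0 < norm (z n)) \<and> mono (\<lambda>n. norm (z n))"

definition hadamard_genus :: "(nat \<Rightarrow> complex) \<Rightarrow> nat" where
  "hadamard_genus z = (if summable (\<lambda>n. 1 / norm (z n)) then 0 else 1)"

text \<open>The elementary factors \<open>E\<^sub>0\<close> and \<open>E\<^sub>1\<close> are \<^term>\<open>weierstrass_factor 0\<close> and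
  \<^term>\<open>weierstrass_factor 1\<close>.\<close>

definition hadamard_factorization ::
    "(complex \<Rightarrow> complex) \<Rightarrow> complex \<Rightarrow> complex \<Rightarrow> (nat \<Rightarrow> complex) \<Rightarrow> bool" where
  "hadamard_factorization \<Phi> a b z \<longleftrightarrow>
     zero_sequence \<Phi> z \<and>
     (\<forall>w. convergent_prod (\<lambda>n. weierstrass_factor (hadamard_genus z) (w / z n)) \<and>
          \<Phi> w = exp (a * w + b) * prodinf (\<lambda>n. weierstrass_factor (hadamard_genus z) (w / z n)))"

end

theory Submission
  imports Defs
begin

text \<open>
  The exponentials \<open>e\<^sub>\<lambda>(z) = exp (\<lambda> z)\<close> are eigenvectors: \<open>\<Phi>(D) e\<^sub>\<lambda> = \<Phi>(\<lambda>) e\<^sub>\<lambda>\<close>, and a product of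
  exponentials is an exponential whose frequency is the sum of the frequencies. So the fate of a
  polynomial in exponential sums under the iterates of \<open>\<Phi>(D)\<close> is decided by the values of
  \<open>L = log |\<Phi>|\<close> at sums of frequencies. Everything takes place near the origin, where \<open>L(0) = 0\<close>.

  In each of the three cases \<open>\<Phi>\<close> is not of the form \<open>exp (a z + b)\<close>: a nonconstant such function has
  no zeros, and it has order 1 and type \<open>|a| \<noteq> 0\<close> (\<open>exponential_not_subexponential\<close>). Write
  \<open>\<Phi> = exp g\<close> near 0, so that \<open>L = Re g\<close> and \<open>g''\<close> does not vanish identically.
  Since \<open>g'' = z\<^sup>k q\<close> with \<open>q(0) \<noteq> 0\<close>, there are \<open>k + 2\<close> equally spaced directions \<open>u\<close> in which
  \<open>t \<mapsto> L(t u)\<close> is strictly convex for small \<open>t > 0\<close>, and in one of them its slope at 0 is nonnegative.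
  Along this ray \<open>L\<close> is positive and satisfies a strict Jensen inequality on \<open>[0, r)\<close>
  (\<open>strictly_convex_ray\<close>). Along another ray, in a direction \<open>v\<close>, \<open>L\<close> is negative (\<open>decay_ray\<close>).
  Exponential sums with frequencies on an arbitrarily short piece of a ray are dense
  (\<open>exp_span_dense\<close>).

  Let a finite set \<open>A\<close> of nontrivial monomials be given. Generic positive weights \<open>\<theta>\<^sub>i\<close> for the variables
  single out one \<open>\<beta> \<in> A\<close>, normalised to weight 1, while the other monomials weigh less than 1
  (\<open>separating_weights\<close>). Given a target \<open>\<Sum>\<^sub>t b\<^sub>t exp (t u z)\<close> and a starting point
  \<open>(h\<^sub>i)\<close> consisting of exponential sums with tiny frequencies on the \<open>v\<close>-ray, consider
  \<open>f\<^sub>i(z) = h\<^sub>i(z) + \<Sum>\<^sub>t (b\<^sub>t \<Phi>(t u) powr (-N)) powr \<theta>\<^sub>i * exp (\<theta>\<^sub>i t u z)\<close>.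
  The added sum tends to 0 as \<open>N \<rightarrow> \<infinity>\<close>. When a monomial in the \<open>f\<^sub>i\<close> is expanded, the terms of \<open>\<beta>\<close> that
  use one and the same \<open>t\<close> in every factor add up, after \<open>N\<close> applications of \<open>\<Phi>(D)\<close>, to exactly the
  target. Every other term is multiplied in each step by a number of modulus less than 1: this is
  the strict Jensen inequality at a convex combination of distinct points or of mass less than 1 or, for products
  of the \<open>h\<^sub>i\<close> alone, the negativity of \<open>L\<close> on the \<open>v\<close>-ray (\<open>all_ratio_freq_less\<close>). Hence a small perturbation makes \<open>\<Phi>(D)\<^sup>N f\<^sup>\<beta>\<close> close to the target and
  \<open>\<Phi>(D)\<^sup>N f\<^sup>\<alpha>\<close> close to 0 for the other \<open>\<alpha> \<in> A\<close> (\<open>simultaneous_approximation\<close>).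

  By the Baire category theorem the generic \<open>f\<close> does this for all \<open>A\<close>, all targets in a countable dense set
  and all accuracies at once. For a polynomial \<open>P\<close> with monomials \<open>A\<close> the iterates of \<open>P(f)\<close> then
  approximate every target, because only the \<open>\<beta>\<close>-term of \<open>P(f)\<close> survives; so \<open>P(f)\<close> is hypercyclic, in
  particular nonzero. The generic \<open>f\<close> also has a dense set of entries, which makes the algebra dense.
\<close>

section \<open>Entire functions\<close>

lemma entire_continuous_on: "f \<in> entire \<Longrightarrow> continuous_on S f"
  unfolding entire_def by (metis holomorphic_on_imp_continuous_on holomorphic_on_subset mem_Collect_eq subset_UNIV)

lemma entire_bounded_on_disc:
  assumes "f \<in> entire" obtains M where "\<And>w. norm w \<le> r \<Longrightarrow> norm (f w) \<le> M"
proof -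
  have "compact (f ` cball 0 r)"
    by (intro compact_continuous_image entire_continuous_on assms compact_cball)
  then have "bounded (f ` cball 0 r)" by (rule compact_imp_bounded)
  then obtain M where "\<forall>w\<in>f ` cball 0 r. norm w \<le> M" unfolding bounded_iff by blast
  then have "norm (f w) \<le> M" if "norm w \<le> r" for w using that by simp
  then show ?thesis using that by blast
qed

lemma
  shows entire_diff: "f \<in> entire \<Longrightarrow> g \<in> entire \<Longrightarrow> (\<lambda>z. f z - g z) \<in> entire"
    and entire_mult: "f \<in> entire \<Longrightarrow> g \<in> entire \<Longrightarrow> (\<lambda>z. f z * g z) \<in> entire"
    and entire_cmult: "f \<in> entire \<Longrightarrow> (\<lambda>z. c * f z) \<in> entire"
    and entire_power: "f \<in> entire \<Longrightarrow> (\<lambda>z. f z ^ n) \<in> entire"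
    and entire_const: "(\<lambda>z. c) \<in> entire"
    and entire_exp: "(\<lambda>z. exp (c * z)) \<in> entire"
  by (auto simp: entire_def intro!: holomorphic_intros)

lemma entire_sum: "(\<And>j. j \<in> J \<Longrightarrow> f j \<in> entire) \<Longrightarrow> (\<lambda>z. \<Sum>j\<in>J. f j z) \<in> entire"
  and entire_prod: "(\<And>j. j \<in> J \<Longrightarrow> f j \<in> entire) \<Longrightarrow> (\<lambda>z. \<Prod>j\<in>J. f j z) \<in> entire"
  by (auto simp: entire_def intro!: holomorphic_intros)

section \<open>The compact-open topology\<close>

text \<open>The sets \<open>unif_nbhd f R e\<close> are the basic neighbourhoods of \<open>f\<close> for locally uniform convergence. All
  continuity and openness arguments go through them instead of the subbasis of the
  compact-open topology.\<close>

definition unif_nbhd :: "(complex \<Rightarrow> complex) \<Rightarrow> real \<Rightarrow> real \<Rightarrow> (complex \<Rightarrow> complex) set" where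
  "unif_nbhd f R e = {g \<in> entire. \<forall>z. norm z \<le> R \<longrightarrow> norm (g z - f z) < e}"

lemma unif_nbhd_mono: "R' \<le> R \<Longrightarrow> e \<le> e' \<Longrightarrow> unif_nbhd f R e \<subseteq> unif_nbhd f R' e'"
  unfolding unif_nbhd_def by (smt (verit, best) Collect_mono_iff order.trans less_le_trans)

lemma unif_nbhd_self: "f \<in> entire \<Longrightarrow> 0 < e \<Longrightarrow> f \<in> unif_nbhd f R e"
  by (simp add: unif_nbhd_def)

lemma unif_nbhd_triangle:
  assumes "g \<in> unif_nbhd f R e1" "h \<in> unif_nbhd g R e2"
  shows "h \<in> unif_nbhd f R (e1 + e2)"
proof -
  have "norm (h z - f z) < e1 + e2" if "norm z \<le> R" for z
    using assms that norm_triangle_ineq[of "h z - g z" "g z - f z"]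
    by (force simp: unif_nbhd_def)
  then show ?thesis using assms by (simp add: unif_nbhd_def)
qed

text \<open>A compact subset of an open set keeps a positive distance from its complement, so the subbasic
  sets contain uniform neighbourhoods of their points; this passes to finite intersections and unions.\<close>

lemma openin_imp_unif_nbhd:
  assumes "openin entire_topology W" "f \<in> W"
  shows "\<exists>R e. 0 < e \<and> unif_nbhd f R e \<subseteq> W"
proof -
  have "generate_topology_on {{f \<in> entire. f ` K \<subseteq> U} | K U. compact K \<and> open U} W"
    using assms(1) by (simp add: entire_topology_def openin_topology_generated_by_iff)
  then show ?thesis using assms(2)
  proof (induction arbitrary: f)
    case Empty then show ?case by simp
  next
    case (Int A B)
    then obtain R1 e1 R2 e2 where *: "0 < e1" "unif_nbhd f R1 e1 \<subseteq> A" "0 < e2" "unif_nbhd f R2 e2 \<subseteq> B"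
      by blast
    have "unif_nbhd f (max R1 R2) (min e1 e2) \<subseteq> A \<inter> B"
      using * unif_nbhd_mono[of R1 "max R1 R2" "min e1 e2" e1 f]
        unif_nbhd_mono[of R2 "max R1 R2" "min e1 e2" e2 f] by auto
    then show ?case using * by (metis min_less_iff_conj)
  next
    case (UN K)
    then show ?case by (meson Union_iff Union_upper dual_order.trans)
  next
    case (Basis s)
    then obtain K U where s: "s = {f \<in> entire. f ` K \<subseteq> U}" "compact K" "open U" by auto
    have f: "f \<in> entire" "f ` K \<subseteq> U" using Basis s by auto
    show ?case
    proof (cases "K = {}")
      case True
      then have "unif_nbhd f 0 1 \<subseteq> s" using s by (auto simp: unif_nbhd_def)
      then show ?thesis by (metis zero_less_one)
    next
      case False
      have "compact (f ` K)" by (intro compact_continuous_image entire_continuous_on f s)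
      then obtain e where e: "e > 0" "(\<Union>x\<in>f ` K. ball x e) \<subseteq> U"
        using compact_subset_open_imp_ball_epsilon_subset[of "f ` K" U] f s by auto
      obtain R where R: "\<And>z. z \<in> K \<Longrightarrow> norm z \<le> R"
        using compact_imp_bounded[OF s(2)] bounded_iff by blast
      have "unif_nbhd f R e \<subseteq> s"
      proof
        fix g assume g: "g \<in> unif_nbhd f R e"
        have "g z \<in> U" if "z \<in> K" for z
        proof -
          have "g z \<in> ball (f z) e" using g R[OF that]
            by (auto simp: unif_nbhd_def dist_norm norm_minus_commute)
          then show ?thesis using e that by blast
        qed
        then show "g \<in> s" using g s by (auto simp: unif_nbhd_def)
      qed
      then show ?thesis using e by blast
    qed
  qed
qed

text \<open>By uniform continuity the disc is covered by finitely many small compact pieces on which \<open>f\<close> hardly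
  varies; prescribing the image of each piece up to \<open>e / 2\<close> confines \<open>g\<close> uniformly on the disc.\<close>

lemma unif_nbhd_contains_open:
  assumes "f \<in> entire" "0 < e"
  shows "\<exists>W. openin entire_topology W \<and> f \<in> W \<and> W \<subseteq> unif_nbhd f R e"
proof -
  have "uniformly_continuous_on (cball 0 R) f"
    by (intro compact_uniformly_continuous entire_continuous_on assms compact_cball)
  then obtain d where d: "0 < d"
    "\<And>x y. x \<in> cball 0 R \<Longrightarrow> y \<in> cball 0 R \<Longrightarrow> dist y x < d \<Longrightarrow> dist (f y) (f x) < e / 2"
    unfolding uniformly_continuous_on_def using assms(2) by (metis half_gt_zero)
  obtain k where k: "finite k" "cball 0 R \<subseteq> (\<Union>x\<in>k. ball (x::complex) (d / 3))"
    using compact_eq_totally_bounded[of "cball (0::complex) R"] d(1) by (metis compact_cball zero_less_divide_iff zero_less_numeral)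
  define K where "K x = cball 0 R \<inter> cball x (d / 3)" for x :: complex
  define U where "U x = (\<Union>y\<in>K x. ball (f y) (e / 2))" for x
  define W where "W = (\<Inter>x\<in>k. {g \<in> entire. g ` K x \<subseteq> U x}) \<inter> topspace entire_topology"
  have "openin entire_topology {g \<in> entire. g ` K x \<subseteq> U x}" for x
  proof -
    have "compact (K x)" "open (U x)" by (auto simp: K_def U_def compact_Int)
    then show ?thesis unfolding entire_topology_def by (intro topology_generated_by_Basis) blast
  qed
  then have "openin entire_topology W" unfolding W_def using k by blast
  moreover have "f \<in> W"
    using assms by (auto simp: W_def U_def)
  moreover have "W \<subseteq> unif_nbhd f R e"
  proof
    fix g assume g: "g \<in> W"
    have "norm (g z - f z) < e" if z: "norm z \<le> R" for z
    proof -
      obtain x where x: "x \<in> k" "z \<in> ball x (d / 3)" using k z by (meson UN_E mem_cball_0 subsetD)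
      then have "z \<in> K x" using z by (auto simp: K_def)
      then have "g z \<in> U x" using g x by (auto simp: W_def)
      then obtain y where y: "y \<in> K x" "dist (f y) (g z) < e / 2" by (auto simp: U_def)
      have "dist y z \<le> dist y x + dist x z" by (rule dist_triangle)
      also have "\<dots> < d" using x y d(1) by (auto simp: K_def dist_commute)
      finally have "dist (f y) (f z) < e / 2" using d(2)[of z y] y z by (auto simp: K_def)
      then have "dist (f y) (g z) + dist (f y) (f z) < e" using y(2) by simp
      then have "dist (g z) (f z) < e"
        using dist_triangle[of "g z" "f z" "f y"] by (simp add: dist_commute)
      then show ?thesis by (simp add: dist_norm)
    qed
    then show "g \<in> unif_nbhd f R e" using g by (auto simp: W_def unif_nbhd_def)
  qed
  ultimately show ?thesis by blast
qed

lemma openin_entire_iff: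
  "openin entire_topology W \<longleftrightarrow> W \<subseteq> entire \<and> (\<forall>f\<in>W. \<exists>R e. 0 < e \<and> unif_nbhd f R e \<subseteq> W)"
proof
  assume "openin entire_topology W"
  then show "W \<subseteq> entire \<and> (\<forall>f\<in>W. \<exists>R e. 0 < e \<and> unif_nbhd f R e \<subseteq> W)"
    using openin_imp_unif_nbhd openin_subset by fastforce
next
  assume *: "W \<subseteq> entire \<and> (\<forall>f\<in>W. \<exists>R e. 0 < e \<and> unif_nbhd f R e \<subseteq> W)"
  show "openin entire_topology W"
  proof (subst openin_subopen, intro ballI)
    fix f assume "f \<in> W"
    then obtain R e where "0 < e" "unif_nbhd f R e \<subseteq> W" "f \<in> entire" using * by blast
    then show "\<exists>T. openin entire_topology T \<and> f \<in> T \<and> T \<subseteq> W"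
      using unif_nbhd_contains_open by (meson dual_order.trans)
  qed
qed

section \<open>A complete metric on the space of entire functions\<close>

text \<open>Using the same number \<open>e\<close> as tolerance and as inverse radius yields a metric for locally uniform
  convergence without a series over an exhaustion by discs. The triangle inequality holds because
  \<open>1 / (a + b)\<close> is at most \<open>1 / a\<close> and \<open>1 / b\<close>.\<close>

definition close_upto :: "real \<Rightarrow> (complex \<Rightarrow> complex) \<Rightarrow> (complex \<Rightarrow> complex) \<Rightarrow> bool" where
  "close_upto e f g \<longleftrightarrow> 0 < e \<and> (\<forall>z. norm z \<le> 1 / e \<longrightarrow> norm (f z - g z) \<le> e)"

text \<open>The value 0 off the space of entire functions only serves to make the function nonnegative
  everywhere, as the locale of metric spaces demands.\<close>

definition entire_dist :: "(complex \<Rightarrow> complex) \<Rightarrow> (complex \<Rightarrow> complex) \<Rightarrow> real" where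
  "entire_dist f g = (if f \<in> entire \<and> g \<in> entire then Inf {e. close_upto e f g} else 0)"

lemma le_one_div:
  fixes r R :: real
  assumes "0 < r" "r \<le> 1 / (1 + \<bar>R\<bar>)" shows "R \<le> 1 / r"
proof -
  have "1 + \<bar>R\<bar> \<le> 1 / r" using assms by (simp add: field_simps)
  then show ?thesis by linarith
qed

lemma close_upto_mono: "close_upto e f g \<Longrightarrow> e \<le> e' \<Longrightarrow> close_upto e' f g"
  unfolding close_upto_def
  by (smt (verit, best) frac_le)

lemma close_upto_exists:
  assumes "f \<in> entire" "g \<in> entire" shows "\<exists>e. close_upto e f g"
proof -
  obtain C where C: "\<And>z. norm z \<le> 1 \<Longrightarrow> norm (f z - g z) \<le> C"
    using entire_bounded_on_disc[OF entire_diff[OF assms]] by blast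
  have "close_upto (max 1 C) f g"
    unfolding close_upto_def
  proof (intro conjI allI impI)
    fix z :: complex assume "norm z \<le> 1 / max 1 C"
    also have "\<dots> \<le> 1" by simp
    finally show "norm (f z - g z) \<le> max 1 C" using C[of z] by simp
  qed simp
  then show ?thesis by blast
qed

lemma bdd_below_close_upto: "bdd_below {e. close_upto e f g}"
  by (rule bdd_belowI[of _ 0]) (auto simp: close_upto_def)

lemma entire_dist_less_iff:
  assumes "f \<in> entire" "g \<in> entire"
  shows "entire_dist f g < e \<longleftrightarrow> (\<exists>e'<e. close_upto e' f g)"
  using assms close_upto_exists[OF assms] bdd_below_close_upto
  by (auto simp: entire_dist_def cInf_less_iff)

lemma entire_dist_less_imp_close:
  assumes "f \<in> entire" "g \<in> entire" "entire_dist f g < e"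
  shows "close_upto e f g"
  using entire_dist_less_iff[OF assms(1,2)] assms(3) close_upto_mono by force

lemma entire_dist_le:
  assumes "f \<in> entire" "g \<in> entire" "close_upto e f g"
  shows "entire_dist f g \<le> e"
  using assms bdd_below_close_upto by (simp add: entire_dist_def cInf_lower)

interpretation entire_metric: Metric_space entire entire_dist
proof
  fix f g h
  show "0 \<le> entire_dist f g"
  proof (cases "f \<in> entire \<and> g \<in> entire")
    case True
    then have "{e. close_upto e f g} \<noteq> {}" using close_upto_exists by blast
    then show ?thesis using True
      by (simp add: entire_dist_def) (rule cInf_greatest, auto simp: close_upto_def)
  qed (auto simp: entire_dist_def)
  show "entire_dist f g = entire_dist g f"
    by (simp add: entire_dist_def close_upto_def norm_minus_commute conj_commute)
  show "entire_dist f g = 0 \<longleftrightarrow> f = g" if fg: "f \<in> entire" "g \<in> entire"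
  proof
    assume d: "entire_dist f g = 0"
    show "f = g"
    proof
      fix z
      have "norm (f z - g z) \<le> e" if "0 < e" for e
      proof -
        define e' where "e' = min e (1 / (1 + norm z))"
        have pos: "0 < 1 + norm z" by (simp add: add_pos_nonneg)
        have e': "0 < e'" using that pos by (simp add: e'_def)
        have "e' * (1 + norm z) \<le> 1"
          using pos by (simp add: e'_def min_def field_simps)
        then have "norm z \<le> 1 / e'" using e' by (simp add: field_simps)
        moreover have "close_upto e' f g" using entire_dist_less_imp_close[OF fg] d e' by simp
        ultimately have "norm (f z - g z) \<le> e'" by (simp add: close_upto_def)
        then show ?thesis by (simp add: e'_def)
      qed
      then have "norm (f z - g z) \<le> 0" by (rule field_le_epsilon[where y=0, simplified])
      then show "f z = g z" by simp
    qed
  next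
    assume "f = g"
    then have "close_upto e f g" if "0 < e" for e using that by (simp add: close_upto_def)
    then have "entire_dist f g \<le> e" if "0 < e" for e using entire_dist_le[OF fg] that by blast
    then have "entire_dist f g \<le> 0" by (rule field_le_epsilon[where y=0, simplified])
    then show "entire_dist f g = 0" using \<open>0 \<le> entire_dist f g\<close> by simp
  qed
  show "entire_dist f h \<le> entire_dist f g + entire_dist g h"
    if fgh: "f \<in> entire" "g \<in> entire" "h \<in> entire"
  proof (rule field_le_epsilon)
    fix e :: real assume e: "0 < e"
    define a where "a = entire_dist f g + e / 2"
    define b where "b = entire_dist g h + e / 2"
    have ab: "close_upto a f g" "close_upto b g h"
      using entire_dist_less_imp_close fgh e by (auto simp: a_def b_def)
    then have pos: "0 < a" "0 < b" by (auto simp: close_upto_def)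
    have "close_upto (a + b) f h"
      unfolding close_upto_def
    proof (intro conjI allI impI)
      fix z :: complex assume z: "norm z \<le> 1 / (a + b)"
      have "1 / (a + b) \<le> 1 / a" "1 / (a + b) \<le> 1 / b" using pos by (auto simp: frac_le)
      then have "norm (f z - g z) \<le> a" "norm (g z - h z) \<le> b"
        using ab z by (auto simp: close_upto_def)
      then show "norm (f z - h z) \<le> a + b"
        using norm_triangle_ineq[of "f z - g z" "g z - h z"] by simp
    qed (use pos in simp)
    then have "entire_dist f h \<le> a + b" using entire_dist_le fgh by blast
    then show "entire_dist f h \<le> entire_dist f g + entire_dist g h + e" by (simp add: a_def b_def)
  qed
qed

lemma mtopology_entire: "entire_metric.mtopology = entire_topology"
proof (rule topology_eq[THEN iffD2], intro allI iffI)
  fix W assume W: "openin entire_metric.mtopology W"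
  show "openin entire_topology W"
    unfolding openin_entire_iff
  proof (intro conjI ballI)
    show sub: "W \<subseteq> entire" using W by (simp add: entire_metric.openin_mtopology)
    fix f assume f: "f \<in> W"
    then obtain r where r: "r > 0" "entire_metric.mball f r \<subseteq> W"
      using W by (auto simp: entire_metric.openin_mtopology)
    have "unif_nbhd f (2 / r) (r / 2) \<subseteq> W"
    proof
      fix g assume g: "g \<in> unif_nbhd f (2 / r) (r / 2)"
      then have fg: "f \<in> entire" "g \<in> entire" using f sub by (auto simp: unif_nbhd_def)
      have "close_upto (r / 2) f g" using g r
        by (auto simp: close_upto_def unif_nbhd_def norm_minus_commute less_imp_le)
      then have "entire_dist f g < r" using entire_dist_le[OF fg] r by fastforce
      then show "g \<in> W" using r fg by auto
    qed
    then show "\<exists>R e. 0 < e \<and> unif_nbhd f R e \<subseteq> W" using r by (meson half_gt_zero)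
  qed
next
  fix W assume W: "openin entire_topology W"
  show "openin entire_metric.mtopology W"
    unfolding entire_metric.openin_mtopology
  proof (intro conjI allI impI)
    show sub: "W \<subseteq> entire" using W by (simp add: openin_entire_iff)
    fix f assume f: "f \<in> W"
    then obtain R e where Re: "0 < e" "unif_nbhd f R e \<subseteq> W" using W by (auto simp: openin_entire_iff)
    define r where "r = min (e / 2) (1 / (1 + \<bar>R\<bar>))"
    have r: "0 < r" "r < e" using Re by (auto simp: r_def)
    have "r \<le> 1 / (1 + \<bar>R\<bar>)" by (simp add: r_def)
    then have R: "R \<le> 1 / r" using r le_one_div[of r R] by simp
    have "entire_metric.mball f r \<subseteq> W"
    proof
      fix g assume g: "g \<in> entire_metric.mball f r"
      then have "close_upto r f g" and ge: "g \<in> entire" using entire_dist_less_imp_close by auto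
      then have "norm (g z - f z) < e" if "norm z \<le> R" for z
        using that R r unfolding close_upto_def
        by (metis norm_minus_commute order.trans order.strict_trans1)
      then have "g \<in> unif_nbhd f R e" using ge by (simp add: unif_nbhd_def)
      then show "g \<in> W" using Re by blast
    qed
    then show "\<exists>r>0. entire_metric.mball f r \<subseteq> W" using r by blast
  qed
qed

text \<open>A locally uniform limit of entire functions is entire.\<close>

lemma mcomplete_entire: "entire_metric.mcomplete"
  unfolding entire_metric.mcomplete_def
proof (intro allI impI)
  fix \<sigma> assume "entire_metric.MCauchy \<sigma>"
  then have ent: "\<And>n. \<sigma> n \<in> entire"
    and cau: "\<And>e. 0 < e \<Longrightarrow> \<exists>N. \<forall>n\<ge>N. \<forall>n'\<ge>N. entire_dist (\<sigma> n) (\<sigma> n') < e"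
    unfolding entire_metric.MCauchy_def by auto
  have unif: "\<exists>N. \<forall>n\<ge>N. \<forall>m\<ge>N. \<forall>z. norm z \<le> R \<longrightarrow> norm (\<sigma> n z - \<sigma> m z) \<le> e" if e: "0 < e" for R e
  proof -
    define r where "r = min e (1 / (1 + \<bar>R\<bar>))"
    have r: "0 < r" "r \<le> e" using e by (auto simp: r_def)
    have "r \<le> 1 / (1 + \<bar>R\<bar>)" by (simp add: r_def)
    then have R: "R \<le> 1 / r" using r le_one_div[of r R] by simp
    obtain N where "\<forall>n\<ge>N. \<forall>n'\<ge>N. entire_dist (\<sigma> n) (\<sigma> n') < r" using cau r by blast
    then have "\<forall>n\<ge>N. \<forall>n'\<ge>N. close_upto r (\<sigma> n) (\<sigma> n')" using entire_dist_less_imp_close ent by blast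
    then have "\<forall>n\<ge>N. \<forall>m\<ge>N. \<forall>z. norm z \<le> R \<longrightarrow> norm (\<sigma> n z - \<sigma> m z) \<le> e"
      unfolding close_upto_def using R r by (meson order_trans)
    then show ?thesis by blast
  qed
  have "Cauchy (\<lambda>n. \<sigma> n z)" for z
  proof (rule metric_CauchyI)
    fix e :: real assume "0 < e"
    then obtain N where "\<forall>n\<ge>N. \<forall>m\<ge>N. \<forall>w. norm w \<le> norm z \<longrightarrow> norm (\<sigma> n w - \<sigma> m w) \<le> e / 2"
      using unif[of "e / 2" "norm z"] by auto
    then have "\<forall>n\<ge>N. \<forall>m\<ge>N. norm (\<sigma> n z - \<sigma> m z) < e" using \<open>0 < e\<close> by fastforce
    then show "\<exists>M. \<forall>m\<ge>M. \<forall>n\<ge>M. dist (\<sigma> m z) (\<sigma> n z) < e" by (auto simp: dist_norm)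
  qed
  moreover define f where "f z = lim (\<lambda>n. \<sigma> n z)" for z
  ultimately have f: "(\<lambda>n. \<sigma> n z) \<longlonglongrightarrow> f z" for z
    unfolding f_def convergent_LIMSEQ_iff[symmetric] Cauchy_convergent_iff[symmetric] by blast
  have lim: "\<exists>N. \<forall>n\<ge>N. \<forall>z. norm z \<le> R \<longrightarrow> norm (\<sigma> n z - f z) \<le> e" if e: "0 < e" for R e
  proof -
    obtain N where N: "\<forall>n\<ge>N. \<forall>m\<ge>N. \<forall>z. norm z \<le> R \<longrightarrow> norm (\<sigma> n z - \<sigma> m z) \<le> e"
      using unif[OF e] by blast
    have "norm (\<sigma> n z - f z) \<le> e" if "n \<ge> N" "norm z \<le> R" for n z
    proof (rule tendsto_upperbound[OF _ _ sequentially_bot])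
      show "(\<lambda>m. norm (\<sigma> n z - \<sigma> m z)) \<longlonglongrightarrow> norm (\<sigma> n z - f z)" by (intro tendsto_intros f)
      show "\<forall>\<^sub>F m in sequentially. norm (\<sigma> n z - \<sigma> m z) \<le> e"
        using N that by (auto simp: eventually_sequentially)
    qed
    then show ?thesis by blast
  qed
  have "f holomorphic_on UNIV"
  proof (rule holomorphic_uniform_sequence[OF open_UNIV])
    show "\<sigma> n holomorphic_on UNIV" for n using ent by (auto simp: entire_def)
    show "\<exists>d>0. cball x d \<subseteq> UNIV \<and> uniform_limit (cball x d) \<sigma> f sequentially" for x
    proof (intro exI conjI)
      show "uniform_limit (cball x 1) \<sigma> f sequentially"
      proof (rule uniform_limitI)
        fix e :: real assume e: "0 < e"
        obtain N where N: "\<forall>n\<ge>N. \<forall>z. norm z \<le> norm x + 1 \<longrightarrow> norm (\<sigma> n z - f z) \<le> e / 2"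
          using lim[of "e/2" "norm x + 1"] e by auto
        have "norm z \<le> norm x + 1" if "z \<in> cball x 1" for z
          using that norm_triangle_sub[of z x] by (simp add: dist_norm norm_minus_commute)
        then have "\<forall>n\<ge>N. \<forall>z\<in>cball x 1. dist (\<sigma> n z) (f z) < e"
          using N e by (fastforce simp: dist_norm)
        then show "\<forall>\<^sub>F n in sequentially. \<forall>z\<in>cball x 1. dist (\<sigma> n z) (f z) < e"
          by (auto simp: eventually_sequentially)
      qed
    qed auto
  qed
  then have fe: "f \<in> entire" by (simp add: entire_def)
  have "\<forall>\<^sub>F n in sequentially. entire_dist (\<sigma> n) f < e" if e: "0 < e" for e
  proof -
    obtain N where N: "\<forall>n\<ge>N. \<forall>z. norm z \<le> 2 / e \<longrightarrow> norm (\<sigma> n z - f z) \<le> e / 2"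
      using lim[of "e/2" "2/e"] e by auto
    then have "\<forall>n\<ge>N. close_upto (e / 2) (\<sigma> n) f" using e by (simp add: close_upto_def)
    then have "\<forall>n\<ge>N. entire_dist (\<sigma> n) f < e" using entire_dist_le[OF ent fe] e by fastforce
    then show ?thesis by (auto simp: eventually_sequentially)
  qed
  then have "limitin entire_metric.mtopology \<sigma> f sequentially"
    using fe ent by (simp add: entire_metric.limitin_metric)
  then show "\<exists>x. limitin entire_metric.mtopology \<sigma> x sequentially" by (rule exI[where x=f])
qed

lemma completely_metrizable_entire_seq: "completely_metrizable_space entire_seq_topology"
proof -
  have "completely_metrizable_space entire_topology"
    using entire_metric.completely_metrizable_space_mtopology[OF mcomplete_entire]
    unfolding mtopology_entire .
  then show ?thesis
    unfolding entire_seq_topology_def completely_metrizable_space_product_topology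
    by (intro disjI2 conjI ballI countableI_type)
qed

lemma topspace_entire_seq: "topspace entire_seq_topology = {f. \<forall>n. f n \<in> entire}"
  by (auto simp: entire_seq_topology_def PiE_def Pi_def)

text \<open>The form of the Baire category theorem through which genericity is established.\<close>

lemma generic_in_INT:
  assumes "countable I" and open_dense: "\<And>i. i \<in> I \<Longrightarrow> openin entire_seq_topology (E i)"
    "\<And>i. i \<in> I \<Longrightarrow> entire_seq_topology closure_of E i = topspace entire_seq_topology"
    and "I \<noteq> {}" and P: "\<And>f. f \<in> (\<Inter>i\<in>I. E i) \<Longrightarrow> P f"
  shows "generic_in entire_seq_topology P"
  unfolding generic_in_def
proof (intro exI[of _ "\<Inter>i\<in>I. E i"] conjI ballI)
  have sub: "(\<Inter>i\<in>I. E i) \<subseteq> topspace entire_seq_topology"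
    using open_dense(1) \<open>I \<noteq> {}\<close> openin_subset by blast
  have "(countable intersection_of openin entire_seq_topology) (\<Inter>i\<in>I. E i)"
    unfolding intersection_of_def
    by (rule exI[of _ "E ` I"]) (use assms in auto)
  then show "gdelta_in entire_seq_topology (\<Inter>i\<in>I. E i)" using sub by (simp add: gdelta_in_alt)
  have "entire_seq_topology closure_of \<Inter>(E ` I) = topspace entire_seq_topology"
    by (rule Baire_category) (use assms completely_metrizable_entire_seq in auto)
  then show "dense_in entire_seq_topology (\<Inter>i\<in>I. E i)" using sub by (simp add: dense_in_def)
qed (use P in blast)

section \<open>Convolution operators\<close>

text \<open>Both branches of exponential type, order below 1 and order 1 with finite type, come down to this
  one bound, which is all that the operator theory uses.\<close>

lemma exponential_growth:
  assumes "exponential_type \<Phi>"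
  shows "\<exists>C. \<forall>\<^sub>F r in at_top. max_modulus \<Phi> r \<le> exp (C * r)"
proof (cases "growth_order \<Phi> < 1")
  case True
  have "\<forall>\<^sub>F r in at_top. ereal (ln (ln (max_modulus \<Phi> r)) / ln r) < 1"
    using Limsup_lessD[OF True[unfolded growth_order_def]] .
  then have "\<forall>\<^sub>F r in at_top. max_modulus \<Phi> r \<le> exp (1 * r)"
    using eventually_gt_at_top[of 1]
  proof eventually_elim
    case (elim r)
    show ?case
    proof (cases "max_modulus \<Phi> r \<le> 1")
      case True
      also have "1 \<le> exp (1 * r)" using elim by simp
      finally show ?thesis .
    next
      case False
      then have pos: "0 < ln (max_modulus \<Phi> r)" by simp
      have "ln (ln (max_modulus \<Phi> r)) < ln r" using elim by (simp add: divide_less_eq)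
      then have "ln (max_modulus \<Phi> r) < r" using pos elim by simp
      then have "exp (ln (max_modulus \<Phi> r)) \<le> exp r" by simp
      then show ?thesis using False by simp
    qed
  qed
  then show ?thesis by blast
next
  case False
  then have order: "growth_order \<Phi> = 1" and type: "growth_type \<Phi> < \<infinity>"
    using assms by (auto simp: exponential_type_def)
  obtain C where C: "growth_type \<Phi> < ereal C"
    using less_PInf_Ex_of_nat[of "growth_type \<Phi>"] type by (metis less_ereal.simps(1) ereal_dense2)
  have "\<forall>\<^sub>F r in at_top. ereal (r powr (- real_of_ereal (growth_order \<Phi>)) * ln (max_modulus \<Phi> r)) < ereal C"
    using Limsup_lessD[OF C[unfolded growth_type_def]] .
  then have "\<forall>\<^sub>F r in at_top. max_modulus \<Phi> r \<le> exp (\<bar>C\<bar> * r)"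
    using eventually_gt_at_top[of 1]
  proof eventually_elim
    case (elim r)
    have "ln (max_modulus \<Phi> r) / r < C" using elim by (simp add: order powr_minus field_simps)
    then have *: "ln (max_modulus \<Phi> r) < C * r" using elim by (simp add: field_simps)
    show ?case
    proof (cases "max_modulus \<Phi> r \<le> 1")
      case True
      also have "1 \<le> exp (\<bar>C\<bar> * r)" using elim by simp
      finally show ?thesis .
    next
      case False
      have "C * r \<le> \<bar>C\<bar> * r" using elim by (intro mult_right_mono) auto
      then have "exp (ln (max_modulus \<Phi> r)) \<le> exp (\<bar>C\<bar> * r)" using * by simp
      then show ?thesis using False by simp
    qed
  qed
  then show ?thesis by blast
qed

lemma norm_le_max_modulus:
  assumes "\<Phi> holomorphic_on UNIV" "norm z \<le> r"
  shows "norm (\<Phi> z) \<le> max_modulus \<Phi> r"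
  unfolding max_modulus_def
proof (rule cSUP_upper)
  have "compact ((\<lambda>z. norm (\<Phi> z)) ` cball 0 r)"
    by (intro compact_continuous_image continuous_intros compact_cball
        holomorphic_on_imp_continuous_on holomorphic_on_subset[OF assms(1)]) auto
  then show "bdd_above ((\<lambda>z. norm (\<Phi> z)) ` cball 0 r)"
    by (intro bounded_imp_bdd_above compact_imp_bounded)
qed (use assms in simp)

text \<open>Cauchy's estimate on the circle of radius \<open>n\<close> bounds the \<open>n\<close>-th derivative at 0 by
  \<open>n! exp (C n) / n\<^sup>n\<close>, and \<open>n! \<le> n\<^sup>n\<close>.\<close>

lemma exponential_type_deriv_bound:
  assumes hol: "\<Phi> holomorphic_on UNIV" and et: "exponential_type \<Phi>"
  obtains K R where "0 < K" "0 < R" "\<And>n. norm ((deriv ^^ n) \<Phi> 0) \<le> K * R ^ n"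
proof -
  obtain C where "\<forall>\<^sub>F r in at_top. max_modulus \<Phi> r \<le> exp (C * r)"
    using exponential_growth[OF et] by blast
  then obtain r0 where r0: "\<And>r. r \<ge> r0 \<Longrightarrow> max_modulus \<Phi> r \<le> exp (C * r)"
    by (auto simp: eventually_at_top_linorder)
  define N where "N = nat \<lceil>max r0 1\<rceil>"
  have N: "real N \<ge> r0" "N \<ge> 1" by (auto simp: N_def le_nat_iff) linarith+
  define R where "R = max 1 (exp C)"
  have R: "R \<ge> 1" "0 < R" by (auto simp: R_def)
  define K where "K = 1 + (\<Sum>n\<le>N. norm ((deriv ^^ n) \<Phi> 0))"
  have K: "K \<ge> 1" by (simp add: K_def sum_nonneg)
  have "norm ((deriv ^^ n) \<Phi> 0) \<le> K * R ^ n" for n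
  proof (cases "n \<le> N")
    case True
    have "norm ((deriv ^^ n) \<Phi> 0) \<le> (\<Sum>n\<le>N. norm ((deriv ^^ n) \<Phi> 0))"
      using True by (intro member_le_sum) auto
    also have "\<dots> \<le> K * 1" by (simp add: K_def)
    also have "\<dots> \<le> K * R ^ n" using K R by (intro mult_left_mono) auto
    finally show ?thesis .
  next
    case False
    then have n: "n > 0" "real n \<ge> r0" using N by auto
    have "norm ((deriv ^^ n) \<Phi> 0) \<le> fact n * exp (C * real n) / real n ^ n"
    proof (rule Cauchy_inequality)
      show "\<Phi> holomorphic_on ball 0 (real n)" using hol holomorphic_on_subset by blast
      show "continuous_on (cball 0 (real n)) \<Phi>"
        using hol holomorphic_on_subset holomorphic_on_imp_continuous_on by blast
      show "norm (\<Phi> x) \<le> exp (C * real n)" if "norm (0 - x) = real n" for x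
        using norm_le_max_modulus[OF hol, of x "real n"] r0[of "real n"] that n by simp
    qed (use n in simp)
    also have "\<dots> \<le> exp (C * real n)"
    proof -
      have "(fact n :: real) \<le> real n ^ n" using fact_le_power[of n, where ?'a = real] by simp
      then have "fact n * exp (C * real n) \<le> real n ^ n * exp (C * real n)" by simp
      then show ?thesis using n by (simp add: divide_le_eq mult.commute)
    qed
    also have "\<dots> = exp C ^ n" by (simp add: exp_of_nat_mult[symmetric] mult.commute)
    also have "\<dots> \<le> R ^ n" by (intro power_mono) (auto simp: R_def)
    also have "\<dots> \<le> K * R ^ n" using K R by simp
    finally show ?thesis .
  qed
  then show ?thesis using that K R by (metis less_le_trans zero_less_one)
qed

text \<open>The geometric bound on the derivatives of the symbol is what makes the operator well defined and
  continuous, so it is carried along in place of the growth of \<open>\<Phi>\<close>.\<close>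

locale conv_op =
  fixes \<Phi> :: "complex \<Rightarrow> complex" and K R :: real
  assumes hol: "\<Phi> holomorphic_on UNIV"
    and K: "0 < K" and R: "0 < R"
    and coeff_bound: "norm ((deriv ^^ n) \<Phi> 0) \<le> K * R ^ n"
begin

abbreviation "T \<equiv> diff_op \<Phi>"

abbreviation "tm f n z \<equiv> (deriv ^^ n) \<Phi> 0 / fact n * (deriv ^^ n) f z"

text \<open>Cauchy's estimate on circles of radius \<open>2 R\<close> beats the growth \<open>R\<^sup>n\<close> of the coefficients by \<open>2\<^sup>n\<close>. This
  uniform geometric decay gives convergence, holomorphy and continuity at the same time.\<close>

lemma term_bound:
  assumes f: "f \<in> entire" and M: "\<And>w. norm w \<le> r + 2 * R \<Longrightarrow> norm (f w) \<le> M" and z: "norm z \<le> r"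
  shows "norm (tm f n z) \<le> K * M * (1 / 2) ^ n"
proof -
  have "norm ((deriv ^^ n) f z) \<le> fact n * M / (2 * R) ^ n"
  proof (rule Cauchy_inequality)
    show "f holomorphic_on ball z (2 * R)" "continuous_on (cball z (2 * R)) f"
      using f holomorphic_on_subset holomorphic_on_imp_continuous_on by (auto simp: entire_def)
    show "norm (f w) \<le> M" if "norm (z - w) = 2 * R" for w
      using M z that norm_triangle_ineq[of z "w - z"] by (simp add: norm_minus_commute)
  qed (use R in simp)
  then have "norm ((deriv ^^ n) \<Phi> 0) * norm ((deriv ^^ n) f z) \<le> K * R ^ n * (fact n * M / (2 * R) ^ n)"
    using coeff_bound[of n] K R by (intro mult_mono) auto
  also have "\<dots> = fact n * (K * M * (1 / 2) ^ n)"
    using R by (simp add: power_mult_distrib power_divide)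
  finally show ?thesis by (simp add: norm_mult norm_divide divide_simps mult_ac)
qed

lemma T_summable: assumes "f \<in> entire" shows "summable (\<lambda>n. tm f n z)"
proof -
  obtain M where M: "\<And>w. norm w \<le> norm z + 2 * R \<Longrightarrow> norm (f w) \<le> M"
    using entire_bounded_on_disc[OF assms] by blast
  show ?thesis
    by (rule summable_comparison_test'[of "\<lambda>n. K * M * (1 / 2) ^ n" 0])
      (use term_bound[OF assms M] in \<open>auto intro!: summable_mult summable_geometric\<close>)
qed

lemma T_bound:
  assumes f: "f \<in> entire" and M: "\<And>w. norm w \<le> r + 2 * R \<Longrightarrow> norm (f w) \<le> M" and z: "norm z \<le> r"
  shows "norm (T f z) \<le> 2 * K * M"
proof -
  have "(\<lambda>n. K * M * (1 / 2) ^ n) sums (K * M * (1 / (1 - 1 / 2)))"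
    by (intro sums_mult geometric_sums) simp
  then have s: "(\<lambda>n. K * M * (1 / 2) ^ n) sums (2 * K * M)" by (simp add: mult_ac)
  have "norm (T f z) \<le> suminf (\<lambda>n. K * M * (1 / 2) ^ n)"
    unfolding diff_op_def
    by (rule norm_suminf_le[OF _ sums_summable[OF s]]) (use term_bound[OF f M z] in blast)
  then show ?thesis using sums_unique[OF s] by simp
qed

lemma entire_higher_deriv: "f \<in> entire \<Longrightarrow> (deriv ^^ n) f holomorphic_on S"
  using holomorphic_higher_deriv[of f UNIV n] holomorphic_on_subset by (auto simp: entire_def)

lemma T_entire: assumes f: "f \<in> entire" shows "T f \<in> entire"
proof -
  have "T f holomorphic_on UNIV"
  proof (rule holomorphic_uniform_sequence[OF open_UNIV])
    show "(\<lambda>z. \<Sum>i<n. tm f i z) holomorphic_on UNIV" for n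
      by (intro holomorphic_intros entire_higher_deriv f)
    show "\<exists>d>0. cball x d \<subseteq> UNIV \<and> uniform_limit (cball x d) (\<lambda>n z. \<Sum>i<n. tm f i z) (T f) sequentially" for x
    proof (intro exI conjI)
      obtain M where M: "\<And>w. norm w \<le> (norm x + 1) + 2 * R \<Longrightarrow> norm (f w) \<le> M"
        using entire_bounded_on_disc[OF f] by blast
      have "norm (tm f n z) \<le> K * M * (1 / 2) ^ n" if "z \<in> cball x 1" for n z
      proof (rule term_bound[OF f M])
        show "norm z \<le> norm x + 1"
          using that norm_triangle_sub[of z x] by (simp add: dist_norm norm_minus_commute)
      qed
      then show "uniform_limit (cball x 1) (\<lambda>n z. \<Sum>i<n. tm f i z) (T f) sequentially"
        unfolding diff_op_def
        by (rule Weierstrass_m_test[where M = "\<lambda>n. K * M * (1 / 2) ^ n"])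
          (auto intro!: summable_mult summable_geometric)
    qed auto
  qed
  then show ?thesis by (simp add: entire_def)
qed

lemma Tn_entire: "f \<in> entire \<Longrightarrow> (T ^^ N) f \<in> entire"
  by (induction N) (auto intro: T_entire)

lemma T_add:
  assumes "f \<in> entire" "g \<in> entire"
  shows "T (\<lambda>z. f z + g z) = (\<lambda>z. T f z + T g z)"
proof
  fix z
  have "(deriv ^^ n) (\<lambda>z. f z + g z) z = (deriv ^^ n) f z + (deriv ^^ n) g z" for n
    using assms by (intro higher_deriv_add[of _ UNIV]) (auto simp: entire_def)
  then have "T (\<lambda>z. f z + g z) z = suminf (\<lambda>n. tm f n z + tm g n z)"
    by (simp add: diff_op_def ring_distribs add_divide_distrib)
  also have "\<dots> = T f z + T g z"
    unfolding diff_op_def by (rule suminf_add[symmetric]) (use T_summable assms in auto)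
  finally show "T (\<lambda>z. f z + g z) z = T f z + T g z" .
qed

lemma T_cmult:
  assumes "f \<in> entire"
  shows "T (\<lambda>z. c * f z) = (\<lambda>z. c * T f z)"
proof
  fix z
  have "(deriv ^^ n) (\<lambda>z. c * f z) z = c * (deriv ^^ n) f z" for n
    using assms by (intro higher_deriv_cmult[of _ UNIV]) (auto simp: entire_def)
  then have "T (\<lambda>z. c * f z) z = suminf (\<lambda>n. c * tm f n z)"
    by (simp add: diff_op_def mult_ac)
  also have "\<dots> = c * T f z"
    unfolding diff_op_def by (rule suminf_mult) (use T_summable assms in auto)
  finally show "T (\<lambda>z. c * f z) z = c * T f z" .
qed

lemma Tn_add:
  assumes "f \<in> entire" "g \<in> entire"
  shows "(T ^^ N) (\<lambda>z. f z + g z) = (\<lambda>z. (T ^^ N) f z + (T ^^ N) g z)"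
  by (induction N) (use assms in \<open>auto simp: T_add Tn_entire\<close>)

lemma Tn_cmult:
  assumes "f \<in> entire"
  shows "(T ^^ N) (\<lambda>z. c * f z) = (\<lambda>z. c * (T ^^ N) f z)"
  by (induction N) (use assms in \<open>auto simp: T_cmult Tn_entire\<close>)

lemma Tn_sum:
  assumes "finite J" "\<And>j. j \<in> J \<Longrightarrow> f j \<in> entire"
  shows "(T ^^ N) (\<lambda>z. \<Sum>j\<in>J. c j * f j z) = (\<lambda>z. \<Sum>j\<in>J. c j * (T ^^ N) (f j) z)"
  using assms
proof (induction J)
  case empty
  show ?case using Tn_cmult[OF entire_const, of N 0 0] by simp
next
  case (insert x F)
  then show ?case by (simp add: Tn_add Tn_cmult entire_sum entire_cmult)
qed

lemma higher_deriv_exp: "(deriv ^^ n) (\<lambda>z::complex. exp (l * z)) = (\<lambda>z. l ^ n * exp (l * z))"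
proof (induction n)
  case (Suc n)
  have "deriv (\<lambda>z. l ^ n * exp (l * z)) = (\<lambda>z. l ^ Suc n * exp (l * z))"
    by (rule ext, rule DERIV_imp_deriv) (auto intro!: derivative_eq_intros)
  then show ?case using Suc by simp
qed simp

lemma T_exp: "T (\<lambda>z. exp (l * z)) = (\<lambda>z. \<Phi> l * exp (l * z))"
proof
  fix z
  have "(\<lambda>n. (deriv ^^ n) \<Phi> 0 / fact n * (l - 0) ^ n) sums \<Phi> l"
    by (rule holomorphic_power_series[of \<Phi> 0 "norm l + 1"]) (use hol holomorphic_on_subset in auto)
  then have "(\<lambda>n. (deriv ^^ n) \<Phi> 0 / fact n * l ^ n * exp (l * z)) sums (\<Phi> l * exp (l * z))"
    by (intro sums_mult2) simp
  then show "T (\<lambda>z. exp (l * z)) z = \<Phi> l * exp (l * z)"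
    unfolding diff_op_def higher_deriv_exp by (simp add: sums_iff mult.assoc)
qed

lemma Tn_exp: "(T ^^ N) (\<lambda>z. exp (l * z)) = (\<lambda>z. \<Phi> l ^ N * exp (l * z))"
proof (induction N)
  case (Suc N)
  then show ?case by (simp add: T_cmult[OF entire_exp] T_exp mult.left_commute mult.assoc)
qed simp

lemma Tn_exp_sum:
  assumes "finite J"
  shows "(T ^^ N) (\<lambda>z. \<Sum>j\<in>J. c j * exp (l j * z)) = (\<lambda>z. \<Sum>j\<in>J. c j * \<Phi> (l j) ^ N * exp (l j * z))"
  using Tn_sum[OF assms entire_exp, of N c l] by (simp add: Tn_exp mult.assoc)

lemma T_diff_bound:
  assumes f: "f \<in> entire" "g \<in> entire"
    and M: "\<And>w. norm w \<le> r + 2 * R \<Longrightarrow> norm (g w - f w) \<le> M" and z: "norm z \<le> r"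
  shows "norm (T g z - T f z) \<le> 2 * K * M"
proof -
  have "T (\<lambda>z. g z - f z + f z) = (\<lambda>z. T (\<lambda>z. g z - f z) z + T f z)"
    by (intro T_add entire_diff f)
  then have "T g z - T f z = T (\<lambda>z. g z - f z) z" by (simp add: fun_eq_iff)
  then show ?thesis using T_bound[OF entire_diff[OF f(2,1)] M z] by simp
qed

end

section \<open>Density of exponential sums\<close>

text \<open>On the disc of radius \<open>S\<close> the Taylor series is dominated by a geometric series, by Cauchy's estimate
  on the circle of radius \<open>2 S\<close>.\<close>

lemma entire_taylor_uniform:
  assumes h: "h \<in> entire" and e: "0 < e"
  obtains n where "\<And>z. norm z \<le> R \<Longrightarrow> norm (h z - (\<Sum>i<n. (deriv ^^ i) h 0 / fact i * z ^ i)) < e"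
proof -
  define S where "S = max R 1"
  have S: "0 < S" "R \<le> S" by (auto simp: S_def)
  have hol: "h holomorphic_on X" for X using h holomorphic_on_subset by (auto simp: entire_def)
  obtain M where M: "\<And>w. norm w \<le> 2 * S \<Longrightarrow> norm (h w) \<le> M"
    using entire_bounded_on_disc[OF h] by blast
  have M0: "0 \<le> M" using order_trans[OF norm_ge_zero M[of 0]] S by simp
  have bound: "norm ((deriv ^^ n) h 0 / fact n * z ^ n) \<le> M * (1 / 2) ^ n" if z: "norm z \<le> S" for n z
  proof -
    have "norm ((deriv ^^ n) h 0) \<le> fact n * M / (2 * S) ^ n"
      by (rule Cauchy_inequality) (use hol M S holomorphic_on_imp_continuous_on in auto)
    then have "norm ((deriv ^^ n) h 0) / fact n * norm z ^ n \<le> M / (2 * S) ^ n * S ^ n"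
      using z M0 S by (intro mult_mono power_mono) (auto simp: field_simps)
    also have "\<dots> = M * (1 / 2) ^ n" using S by (simp add: power_mult_distrib power_divide)
    finally show ?thesis by (simp add: norm_mult norm_divide norm_power)
  qed
  have "uniform_limit (cball 0 S) (\<lambda>n z. \<Sum>i<n. (deriv ^^ i) h 0 / fact i * z ^ i)
      (\<lambda>z. suminf (\<lambda>i. (deriv ^^ i) h 0 / fact i * z ^ i)) sequentially"
    by (rule Weierstrass_m_test[where M = "\<lambda>n. M * (1 / 2) ^ n"])
      (use bound in \<open>auto intro!: summable_mult summable_geometric\<close>)
  then obtain n where n: "\<forall>z\<in>cball 0 S. dist (\<Sum>i<n. (deriv ^^ i) h 0 / fact i * z ^ i)
      (suminf (\<lambda>i. (deriv ^^ i) h 0 / fact i * z ^ i)) < e"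
    using e unfolding uniform_limit_iff eventually_sequentially by blast
  have "suminf (\<lambda>i. (deriv ^^ i) h 0 / fact i * z ^ i) = h z" for z
    using holomorphic_power_series[OF hol, of z 0 "norm z + 1"] by (simp add: sums_iff)
  then have "norm (h z - (\<Sum>i<n. (deriv ^^ i) h 0 / fact i * z ^ i)) < e" if "norm z \<le> R" for z
    using n S that by (auto simp: dist_norm norm_minus_commute)
  then show ?thesis using that by blast
qed

text \<open>Polynomials with coefficients in a countable dense set of complex numbers.\<close>

lemma countable_dense_entire:
  obtains Q where "countable Q" "Q \<subseteq> entire"
    "\<And>h R e. h \<in> entire \<Longrightarrow> 0 < e \<Longrightarrow> \<exists>g\<in>Q. \<forall>z. norm z \<le> R \<longrightarrow> norm (g z - h z) < e"
proof -
  obtain D :: "complex set" where D: "countable D" "\<And>X. open X \<Longrightarrow> X \<noteq> {} \<Longrightarrow> \<exists>d\<in>D. d \<in> X"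
    using countable_dense_setE by blast
  define Q where "Q = (\<lambda>l z. \<Sum>i<length l. l ! i * z ^ i) ` lists D"
  show ?thesis
  proof (rule that)
    show "countable Q" unfolding Q_def using D(1) by simp
    show "Q \<subseteq> entire" by (auto simp: Q_def entire_def intro!: holomorphic_intros)
    fix h R and e :: real assume h: "h \<in> entire" and e: "0 < e"
    obtain n where n: "\<And>z. norm z \<le> R \<Longrightarrow>
        norm (h z - (\<Sum>i<n. (deriv ^^ i) h 0 / fact i * z ^ i)) < e / 2"
      using entire_taylor_uniform[OF h, of "e / 2"] e by auto
    define c where "c i = (deriv ^^ i) h 0 / fact i" for i
    define B where "B = 1 + (\<Sum>i<n. \<bar>R\<bar> ^ i)"
    have B: "1 \<le> B" by (simp add: B_def sum_nonneg)
    define d where "d = e / (2 * B)"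
    have d: "0 < d" using e B by (simp add: d_def)
    have "\<exists>q\<in>D. q \<in> ball (c i) d" for i using D(2)[of "ball (c i) d"] d by simp
    then obtain q where q: "\<And>i. q i \<in> D" "\<And>i. norm (q i - c i) < d"
      by (simp add: dist_norm norm_minus_commute) metis
    define g where "g z = (\<Sum>i<n. q i * z ^ i)" for z
    have "g = (\<lambda>z. \<Sum>i<length (map q [0..<n]). map q [0..<n] ! i * z ^ i)"
      by (auto simp: g_def intro!: ext sum.cong)
    moreover have "map q [0..<n] \<in> lists D" using q by auto
    ultimately have "g \<in> Q" unfolding Q_def by blast
    moreover have "norm (g z - h z) < e" if z: "norm z \<le> R" for z
    proof -
      have "norm (g z - (\<Sum>i<n. c i * z ^ i)) = norm (\<Sum>i<n. (q i - c i) * z ^ i)"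
        by (simp add: g_def sum_subtractf left_diff_distrib)
      also have "\<dots> \<le> (\<Sum>i<n. d * \<bar>R\<bar> ^ i)"
        by (rule sum_norm_le) (use z q d in \<open>auto simp: norm_mult norm_power less_imp_le intro!: mult_mono power_mono\<close>)
      also have "\<dots> = d * (B - 1)" by (simp add: B_def sum_distrib_left)
      also have "\<dots> \<le> d * B" using d by simp
      also have "\<dots> = e / 2" using B by (simp add: d_def)
      finally show ?thesis
        using n[OF z] norm_triangle_ineq[of "g z - (\<Sum>i<n. c i * z ^ i)" "(\<Sum>i<n. c i * z ^ i) - h z"]
        by (simp add: c_def norm_minus_commute)
    qed
    ultimately show "\<exists>g\<in>Q. \<forall>z. norm z \<le> R \<longrightarrow> norm (g z - h z) < e" by blast
  qed
qed

text \<open>Frequencies are the real multiples \<open>t u\<close> of a fixed direction. Indexing the coefficients by \<open>t\<close> itself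
  keeps the frequencies of a sum distinct, which the strict Jensen inequality will require.\<close>

definition exp_sum :: "complex \<Rightarrow> (real \<Rightarrow> complex) \<Rightarrow> complex \<Rightarrow> complex" where
  "exp_sum u a z = (\<Sum>t | a t \<noteq> 0. a t * exp (of_real t * u * z))"

definition exp_span :: "complex \<Rightarrow> real \<Rightarrow> (complex \<Rightarrow> complex) set" where
  "exp_span u r = {exp_sum u a | a. finite {t. a t \<noteq> 0} \<and> {t. a t \<noteq> 0} \<subseteq> {0<..<r}}"

lemma exp_sum_superset:
  assumes "finite G" "{t. a t \<noteq> 0} \<subseteq> G"
  shows "exp_sum u a z = (\<Sum>t\<in>G. a t * exp (of_real t * u * z))"
  unfolding exp_sum_def by (rule sum.mono_neutral_left) (use assms in auto)

lemma exp_span_add: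
  assumes "f \<in> exp_span u r" "g \<in> exp_span u r"
  shows "(\<lambda>z. f z + g z) \<in> exp_span u r"
proof -
  obtain a b where a: "f = exp_sum u a" "finite {t. a t \<noteq> 0}" "{t. a t \<noteq> 0} \<subseteq> {0<..<r}"
    and b: "g = exp_sum u b" "finite {t. b t \<noteq> 0}" "{t. b t \<noteq> 0} \<subseteq> {0<..<r}"
    using assms by (auto simp: exp_span_def)
  define G where "G = {t. a t \<noteq> 0} \<union> {t. b t \<noteq> 0}"
  have G: "finite G" "{t. a t \<noteq> 0} \<subseteq> G" "{t. b t \<noteq> 0} \<subseteq> G" "{t. a t + b t \<noteq> 0} \<subseteq> G" "G \<subseteq> {0<..<r}"
    using a b by (auto simp: G_def)
  have "(\<lambda>z. f z + g z) = exp_sum u (\<lambda>t. a t + b t)"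
    unfolding a b by (rule ext) (simp add: exp_sum_superset[OF G(1)] G sum.distrib[symmetric] ring_distribs)
  moreover have "finite {t. a t + b t \<noteq> 0}" using G finite_subset by blast
  ultimately show ?thesis unfolding exp_span_def using G by blast
qed

lemma exp_span_cmult:
  assumes "f \<in> exp_span u r"
  shows "(\<lambda>z. c * f z) \<in> exp_span u r"
proof -
  obtain a where a: "f = exp_sum u a" "finite {t. a t \<noteq> 0}" "{t. a t \<noteq> 0} \<subseteq> {0<..<r}"
    using assms by (auto simp: exp_span_def)
  have sub: "{t. c * a t \<noteq> 0} \<subseteq> {t. a t \<noteq> 0}" by auto
  have "(\<lambda>z. c * f z) = exp_sum u (\<lambda>t. c * a t)"
    unfolding a exp_sum_superset[OF a(2) sub]
    by (rule ext) (simp add: exp_sum_def sum_distrib_left mult.assoc)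
  moreover have "finite {t. c * a t \<noteq> 0}" using sub a finite_subset by blast
  ultimately show ?thesis unfolding exp_span_def using sub a by blast
qed

lemma exp_span_zero: "(\<lambda>z. 0) \<in> exp_span u r"
proof -
  have "(\<lambda>z. 0) = exp_sum u (\<lambda>t. 0)" by (rule ext) (simp add: exp_sum_def)
  then show ?thesis unfolding exp_span_def by (intro CollectI exI[of _ "\<lambda>t. 0"]) simp
qed

lemma exp_span_exp:
  assumes "0 < t" "t < r" shows "(\<lambda>z. exp (of_real t * u * z)) \<in> exp_span u r"
proof -
  define a :: "real \<Rightarrow> complex" where "a s = (if s = t then 1 else 0)" for s
  have a: "{s. a s \<noteq> 0} = {t}" by (auto simp: a_def)
  have "exp_sum u a = (\<lambda>z. exp (of_real t * u * z))"
    by (rule ext) (simp add: exp_sum_def a, simp add: a_def)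
  moreover have "exp_sum u a \<in> exp_span u r"
    unfolding exp_span_def using a assms by (intro CollectI exI[of _ a]) simp
  ultimately show ?thesis by simp
qed

lemma exp_span_sum:
  assumes "finite J" "\<And>j. j \<in> J \<Longrightarrow> f j \<in> exp_span u r"
  shows "(\<lambda>z. \<Sum>j\<in>J. f j z) \<in> exp_span u r"
  using assms by (induction J) (auto intro: exp_span_zero exp_span_add)

lemma uniform_limit_bound:
  fixes f :: "'a \<Rightarrow> 'b \<Rightarrow> 'c::real_normed_vector"
  assumes "\<forall>\<^sub>F t in F. \<forall>z\<in>S. norm (f t z - g z) \<le> b t" "(b \<longlongrightarrow> 0) F"
  shows "uniform_limit S f g F"
proof (rule uniform_limitI)
  fix e :: real assume "0 < e"
  then have "\<forall>\<^sub>F t in F. b t < e" using assms(2) order_tendstoD(2) by blast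
  with assms(1) show "\<forall>\<^sub>F t in F. \<forall>z\<in>S. dist (f t z) (g z) < e"
    by eventually_elim (auto simp: dist_norm)
qed

lemma uniform_limit_exp_one:
  fixes u :: complex
  shows "uniform_limit (cball 0 R) (\<lambda>t z. exp (of_real t * u * z)) (\<lambda>z. 1) (at_right 0)"
proof (rule uniform_limit_bound)
  define b where "b t = exp (\<bar>t\<bar> * norm u * R) * (\<bar>t\<bar> * norm u * R)" for t
  have "norm (exp (of_real t * u * z) - 1) \<le> b t" if "z \<in> cball 0 R" for z t
  proof -
    have z: "norm (of_real t * u * z) \<le> \<bar>t\<bar> * norm u * R"
      using that by (auto simp: norm_mult intro!: mult_left_mono)
    have "norm (exp (of_real t * u * z) - 1) \<le> exp \<bar>Re (of_real t * u * z)\<bar> * norm (of_real t * u * z)"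
      using Taylor_exp[of "of_real t * u * z" 0] by simp
    also have "\<dots> \<le> b t" unfolding b_def
      using z abs_Re_le_cmod[of "of_real t * u * z"] by (intro mult_mono) (auto intro: order_trans)
    finally show ?thesis .
  qed
  then show "\<forall>\<^sub>F t in at_right 0. \<forall>z\<in>cball 0 R. norm (exp (of_real t * u * z) - 1) \<le> b t"
    by (simp add: eventually_at_filter)
  have "(b \<longlongrightarrow> exp (\<bar>0\<bar> * norm u * R) * (\<bar>0\<bar> * norm u * R)) (at_right 0)"
    unfolding b_def by (intro tendsto_intros)
  then show "(b \<longlongrightarrow> 0) (at_right 0)" by simp
qed

lemma uniform_limit_exp_quotient:
  fixes u :: complex
  assumes u: "u \<noteq> 0"
  shows "uniform_limit (cball 0 R) (\<lambda>t z. (exp (of_real t * u * z) - 1) / (of_real t * u)) (\<lambda>z. z) (at_right 0)"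
proof (rule uniform_limit_bound)
  define b where "b t = exp (\<bar>t\<bar> * norm u * R) * (\<bar>t\<bar> * norm u * R\<^sup>2)" for t
  have "norm ((exp (of_real t * u * z) - 1) / (of_real t * u) - z) \<le> b t" if "z \<in> cball 0 R" "0 < t" for z t
  proof -
    define w where "w = of_real t * u * z"
    have z: "norm w \<le> \<bar>t\<bar> * norm u * R"
      using that by (auto simp: w_def norm_mult intro!: mult_left_mono)
    have tu: "norm (of_real t * u) = t * norm u" "0 < t * norm u" using that u by (auto simp: norm_mult)
    have "norm (exp w - (1 + w)) \<le> exp \<bar>Re w\<bar> * norm w ^ 2"
      using Taylor_exp[of w 1] by (simp add: power2_eq_square)
    also have "\<dots> \<le> exp (\<bar>t\<bar> * norm u * R) * (\<bar>t\<bar> * norm u * R)\<^sup>2"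
      using z abs_Re_le_cmod[of w] by (intro mult_mono power_mono) (auto intro: order_trans)
    also have "\<dots> = b t * (t * norm u)" using that by (simp add: b_def power2_eq_square)
    finally have "norm (exp w - (1 + w)) / norm (of_real t * u) \<le> b t"
      using tu by (simp add: divide_le_eq)
    moreover have "(exp w - 1) / (of_real t * u) - z = (exp w - (1 + w)) / (of_real t * u)"
      using that u by (simp add: w_def field_simps)
    ultimately show ?thesis by (simp add: w_def norm_divide)
  qed
  then show "\<forall>\<^sub>F t in at_right 0. \<forall>z\<in>cball 0 R. norm ((exp (of_real t * u * z) - 1) / (of_real t * u) - z) \<le> b t"
    by (simp add: eventually_at_filter)
  have "(b \<longlongrightarrow> exp (\<bar>0\<bar> * norm u * R) * (\<bar>0\<bar> * norm u * R\<^sup>2)) (at_right 0)"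
    unfolding b_def by (intro tendsto_intros)
  then show "(b \<longlongrightarrow> 0) (at_right 0)" by simp
qed

text \<open>As \<open>t \<rightarrow> 0\<close> the difference quotient \<open>(exp (t u z) - 1) / (t u)\<close> tends to \<open>z\<close>. Its \<open>n\<close>-th power is an
  exponential sum; the extra factor \<open>exp (t u z)\<close>, which tends to 1, removes the frequency 0.\<close>

lemma monomial_approx:
  assumes u: "u \<noteq> 0" and r: "0 < r" and e: "0 < e"
  shows "\<exists>g\<in>exp_span u r. \<forall>z. norm z \<le> R \<longrightarrow> norm (g z - z ^ n) < e"
proof -
  define q where "q t z = (exp (of_real t * u * z) - 1) / (of_real t * u)" for t :: real and z
  have pw: "uniform_limit (cball 0 R) (\<lambda>t z. q t z ^ k) (\<lambda>z. z ^ k) (at_right 0)" for k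
  proof (induction k)
    case (Suc k)
    have "bounded ((\<lambda>z::complex. z ^ k) ` cball 0 R)" "bounded ((\<lambda>z::complex. z) ` cball 0 R)"
      by (auto intro!: compact_imp_bounded compact_continuous_image continuous_intros)
    then show ?case
      using uniform_lim_mult[OF uniform_limit_exp_quotient[OF u] Suc] by (simp add: q_def)
  qed (simp add: uniform_limit_const)
  have "bounded ((\<lambda>z::complex. z ^ n) ` cball 0 R)" "bounded ((\<lambda>z::complex. 1 :: complex) ` cball 0 R)"
    by (auto intro!: compact_imp_bounded compact_continuous_image continuous_intros)
  then have "uniform_limit (cball 0 R) (\<lambda>t z. exp (of_real t * u * z) * q t z ^ n) (\<lambda>z. 1 * z ^ n) (at_right 0)"
    using uniform_lim_mult[OF uniform_limit_exp_one pw] by blast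
  then have "\<forall>\<^sub>F t in at_right 0. \<forall>z\<in>cball 0 R. dist (exp (of_real t * u * z) * q t z ^ n) (1 * z ^ n) < e"
    using e by (rule uniform_limitD)
  moreover have "\<forall>\<^sub>F t in at_right 0. t \<in> {0<..<r / (n + 1)}"
    using r by (intro eventually_at_right_real) auto
  ultimately have "\<forall>\<^sub>F t in at_right 0. (\<forall>z\<in>cball 0 R. dist (exp (of_real t * u * z) * q t z ^ n) (1 * z ^ n) < e)
      \<and> t \<in> {0<..<r / (n + 1)}" by eventually_elim auto
  then obtain t where t: "\<And>z. norm z \<le> R \<Longrightarrow> norm (exp (of_real t * u * z) * q t z ^ n - z ^ n) < e"
    "0 < t" "t < r / (n + 1)"
    using eventually_happens'[OF trivial_limit_at_right_real] by (fastforce simp: dist_norm)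
  define g where "g z = exp (of_real t * u * z) * q t z ^ n" for z
  define c where "c k = of_nat (n choose k) * (-1) ^ (n - k) / (of_real t * u) ^ n" for k
  have g: "g z = (\<Sum>k\<le>n. c k * exp (of_real (real (k + 1) * t) * u * z))" for z
  proof -
    have "(exp (of_real t * u * z) + (- 1)) ^ n
        = (\<Sum>k\<le>n. of_nat (n choose k) * exp (of_real t * u * z) ^ k * (- 1) ^ (n - k))"
      by (rule binomial_ring)
    then have "g z = exp (of_real t * u * z) *
        (\<Sum>k\<le>n. of_nat (n choose k) * exp (of_real t * u * z) ^ k * (- 1) ^ (n - k)) / (of_real t * u) ^ n"
      by (simp add: g_def q_def power_divide)
    also have "\<dots> = (\<Sum>k\<le>n. c k * exp (of_real t * u * z) ^ (k + 1))"
      by (simp add: c_def sum_distrib_left sum_divide_distrib mult_ac)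
    also have "\<dots> = (\<Sum>k\<le>n. c k * exp (of_real (real (k + 1) * t) * u * z))"
      by (intro sum.cong refl) (simp only: exp_of_nat_mult[symmetric] of_real_mult of_real_of_nat_eq mult.assoc)
    finally show ?thesis .
  qed
  have "(\<lambda>z. \<Sum>k\<le>n. c k * exp (of_real (real (k + 1) * t) * u * z)) \<in> exp_span u r"
  proof (intro exp_span_sum exp_span_cmult exp_span_exp)
    fix k assume k: "k \<in> {..n}"
    show "0 < real (k + 1) * t" using t by simp
    have "real (k + 1) * t \<le> real (n + 1) * t" using t k by (intro mult_right_mono) auto
    also have "\<dots> < r" using t by (simp add: field_simps)
    finally show "real (k + 1) * t < r" .
  qed simp
  then have "g \<in> exp_span u r" using g by presburger
  then show ?thesis using t by (auto simp: g_def intro!: bexI[of _ g])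
qed

text \<open>Monomials can be approximated, hence Taylor polynomials, hence all entire functions.\<close>

theorem exp_span_dense:
  assumes u: "u \<noteq> 0" and r: "0 < r" and h: "h \<in> entire" and e: "0 < e"
  shows "\<exists>a. finite {t. a t \<noteq> 0} \<and> {t. a t \<noteq> 0} \<subseteq> {0<..<r} \<and>
    (\<forall>z. norm z \<le> R \<longrightarrow> norm (exp_sum u a z - h z) < e)"
proof -
  obtain n where n: "\<And>z. norm z \<le> R \<Longrightarrow> norm (h z - (\<Sum>i<n. (deriv ^^ i) h 0 / fact i * z ^ i)) < e / 2"
    using entire_taylor_uniform[OF h, of "e / 2"] e by auto
  define c where "c i = (deriv ^^ i) h 0 / fact i" for i
  define B where "B = 1 + (\<Sum>i<n. norm (c i))"
  have B: "1 \<le> B" by (simp add: B_def sum_nonneg)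
  have "\<exists>g\<in>exp_span u r. \<forall>z. norm z \<le> R \<longrightarrow> norm (g z - z ^ i) < e / (2 * B)" for i
    using monomial_approx[OF u r] e B by simp
  then obtain g where g: "\<And>i. g i \<in> exp_span u r"
    "\<And>i z. norm z \<le> R \<Longrightarrow> norm (g i z - z ^ i) < e / (2 * B)" by metis
  have "(\<lambda>z. \<Sum>i<n. c i * g i z) \<in> exp_span u r"
    by (intro exp_span_sum exp_span_cmult g) simp
  then obtain a where a: "(\<lambda>z. \<Sum>i<n. c i * g i z) = exp_sum u a" "finite {t. a t \<noteq> 0}" "{t. a t \<noteq> 0} \<subseteq> {0<..<r}"
    unfolding exp_span_def by blast
  have "norm (exp_sum u a z - h z) < e" if z: "norm z \<le> R" for z
  proof -
    have "norm (exp_sum u a z - (\<Sum>i<n. c i * z ^ i)) = norm (\<Sum>i<n. c i * (g i z - z ^ i))"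
      by (simp add: a(1)[symmetric] sum_subtractf right_diff_distrib)
    also have "\<dots> \<le> (\<Sum>i<n. norm (c i) * (e / (2 * B)))"
      by (rule sum_norm_le, unfold norm_mult) (intro mult_left_mono less_imp_le g(2) z norm_ge_zero)
    also have "\<dots> = (\<Sum>i<n. norm (c i)) * (e / (2 * B))" by (rule sum_distrib_right[symmetric])
    also have "\<dots> \<le> B * (e / (2 * B))" using e B by (intro mult_right_mono) (auto simp: B_def)
    also have "\<dots> = e / 2" using B by simp
    finally show ?thesis
      using n[OF z] norm_triangle_ineq[of "exp_sum u a z - (\<Sum>i<n. c i * z ^ i)" "(\<Sum>i<n. c i * z ^ i) - h z"]
      by (simp add: c_def norm_minus_commute)
  qed
  then show ?thesis using a by blast
qed

section \<open>The logarithm of the symbol along rays\<close>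

lemma complex_root_exists:
  fixes d :: complex
  assumes "0 < n" "norm d = 1"
  obtains w where "w ^ n = d" "norm w = 1"
proof -
  define w where "w = exp (Ln d / of_nat n)"
  have w: "w ^ n = d"
    unfolding w_def exp_of_nat_mult[symmetric] using assms by (auto intro!: exp_Ln)
  then have "norm w ^ n = 1" using assms by (simp add: norm_power[symmetric])
  then have "norm w = 1" using power_eq_1_iff[of "norm w" n] assms by simp
  then show ?thesis using w that by blast
qed

lemma Re_of_real_mult: "Re (of_real a * z) = a * Re z"
  by simp

text \<open>The \<open>n\<close> directions in which \<open>c u\<^sup>n\<close> is positive differ by \<open>n\<close>-th roots of unity. These sum to 0, so the
  real parts \<open>Re (\<alpha> u)\<close> cannot all be negative. It is here that \<open>n \<ge> 2\<close> matters.\<close>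

lemma direction_exists:
  fixes c \<alpha> :: complex
  assumes c: "c \<noteq> 0" and n: "2 \<le> n"
  obtains u where "norm u = 1" "0 < Re (c * u ^ n)" "0 \<le> Re (\<alpha> * u)"
proof -
  obtain u0 where u0: "u0 ^ n = of_real (norm c) / c" "norm u0 = 1"
    using complex_root_exists[of n "of_real (norm c) / c"] c n by (auto simp: norm_divide)
  define Z where "Z = {z::complex. z ^ n = 1}"
  have Z: "finite Z" "1 \<in> Z" "\<Sum>Z = 0"
    using finite_roots_unity[of n] sum_roots_unity[of n] n by (auto simp: Z_def)
  have "\<exists>\<zeta>\<in>Z. 0 \<le> Re (\<alpha> * (u0 * \<zeta>))"
  proof (rule ccontr)
    assume "\<not> ?thesis"
    then have "(\<Sum>\<zeta>\<in>Z. Re (\<alpha> * (u0 * \<zeta>))) < (\<Sum>\<zeta>\<in>Z. 0)"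
      using Z by (intro sum_strict_mono) (auto simp: not_le)
    moreover have "(\<Sum>\<zeta>\<in>Z. Re (\<alpha> * (u0 * \<zeta>))) = Re (\<alpha> * u0 * \<Sum>Z)"
      by (simp add: sum_distrib_left mult.assoc)
    ultimately show False using Z by simp
  qed
  then obtain \<zeta> where z: "\<zeta> ^ n = 1" "0 \<le> Re (\<alpha> * (u0 * \<zeta>))" by (auto simp: Z_def)
  have "norm \<zeta> = 1" using power_eq_1_iff[OF z(1)] n by auto
  moreover have "c * (u0 * \<zeta>) ^ n = of_real (norm c)" using z u0 c by (simp add: power_mult_distrib)
  ultimately show ?thesis using that[of "u0 * \<zeta>"] u0 z c by (simp add: norm_mult)
qed

lemma negative_direction_exists:
  fixes c :: complex
  assumes c: "c \<noteq> 0" and n: "0 < n"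
  obtains v where "norm v = 1" "Re (c * v ^ n) < 0"
proof -
  obtain v where "v ^ n = - of_real (norm c) / c" "norm v = 1"
    using complex_root_exists[of n "- of_real (norm c) / c"] c n by (auto simp: norm_divide)
  moreover from this have "c * v ^ n = - of_real (norm c)" using c by simp
  ultimately show ?thesis using that[of v] c by simp
qed

lemma holomorphic_factor_at_0:
  assumes hol: "h holomorphic_on ball 0 \<rho>" and w: "w \<in> ball 0 \<rho>" "h w \<noteq> 0"
  shows "\<exists>r q k. 0 < r \<and> r \<le> \<rho> \<and> q holomorphic_on ball 0 r \<and> q 0 \<noteq> 0 \<and>
    (\<forall>z\<in>ball 0 r. h z = z ^ k * q z)"
proof -
  have "0 < \<rho>" using w(1) by (metis ball_eq_empty empty_iff not_le)
  then have c0: "0 \<in> ball 0 \<rho>" by simp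
  show ?thesis
  proof (cases "h 0 = 0")
    case False
    then show ?thesis using hol \<open>0 < \<rho>\<close> by (intro exI[of _ \<rho>] exI[of _ h] exI[of _ 0]) simp
  next
    case True
    have nc: "\<not> h constant_on ball 0 \<rho>"
      using True w c0 unfolding constant_on_def by metis
    show ?thesis
    proof (rule holomorphic_factor_zero_nonconstant[OF hol open_ball connected_ball c0 True nc])
      fix q r k
      assume *: "0 < (k::nat)" "0 < r" "ball (0::complex) r \<subseteq> ball 0 \<rho>" "q holomorphic_on ball 0 r"
        "\<And>z. z \<in> ball 0 r \<Longrightarrow> h z = (z - 0) ^ k * q z" "\<And>z. z \<in> ball 0 r \<Longrightarrow> q z \<noteq> 0"
      have "r \<le> \<rho>" using *(2,3) by (simp add: ball_subset_ball_iff)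
      moreover have "q 0 \<noteq> 0" using *(2) *(6)[of 0] by simp
      ultimately show ?thesis using * by (intro exI[of _ r] exI[of _ q] exI[of _ k]) simp
    qed
  qed
qed

lemma DERIV_Re_ray:
  fixes f :: "complex \<Rightarrow> complex"
  assumes "(f has_field_derivative D) (at (of_real t * u))"
  shows "((\<lambda>t. Re (f (of_real t * u))) has_real_derivative Re (u * D)) (at t)"
proof -
  have "((\<lambda>t. of_real t * u) has_vector_derivative 1 * u) (at t)"
    by (auto intro!: derivative_eq_intros simp: has_vector_derivative_def scaleR_conv_of_real)
  then have "((\<lambda>t. of_real t * u) has_vector_derivative u) (at t)" by simp
  then have "(f \<circ> (\<lambda>t. of_real t * u) has_vector_derivative u * D) (at t)"
    by (rule field_vector_diff_chain_at) (use assms in simp)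
  then show ?thesis
    unfolding has_real_derivative_iff_has_vector_derivative
    using bounded_linear.has_vector_derivative[OF bounded_linear_Re] by (fastforce simp: o_def)
qed

lemma positive_near_0:
  fixes q :: "complex \<Rightarrow> complex"
  assumes "q holomorphic_on ball 0 r" "0 < r" "0 < Re (c * q 0)"
  obtains r' where "0 < r'" "r' \<le> r" "\<And>z. norm z < r' \<Longrightarrow> 0 < Re (c * q z)"
proof -
  have "continuous_on (ball 0 r) (\<lambda>z. Re (c * q z))"
    by (intro continuous_intros holomorphic_on_imp_continuous_on assms)
  then obtain A where A: "open A" "A \<inter> ball 0 r = {z \<in> ball 0 r. 0 < Re (c * q z)}"
    using open_Collect_less_Int[of "ball 0 r" "\<lambda>_. 0" "\<lambda>z. Re (c * q z)"] continuous_on_const by blast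
  then have "open {z \<in> ball 0 r. 0 < Re (c * q z)}" by (metis open_Int open_ball)
  moreover have "0 \<in> {z \<in> ball 0 r. 0 < Re (c * q z)}" using assms by simp
  ultimately obtain e where e: "0 < e" "ball 0 e \<subseteq> {z \<in> ball 0 r. 0 < Re (c * q z)}"
    using open_contains_ball by blast
  then have "ball (0::complex) e \<subseteq> ball 0 r" by blast
  then have "e \<le> r" using e by (simp add: ball_subset_ball_iff)
  then show ?thesis using that[of e] e by (auto simp: subset_iff)
qed

text \<open>Let \<open>\<phi>(t) = Re (g (t u))\<close>. If \<open>g''(z) = z\<^sup>k q(z)\<close> then \<open>\<phi>''(t)\<close> is \<open>t\<^sup>k\<close> times a quantity close to
  \<open>Re (q(0) u\<^bsup>k + 2\<^esup>)\<close>, so \<open>\<phi>\<close> is strictly convex for small \<open>t\<close> as soon as that number is positive; a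
  nonnegative slope \<open>\<phi>'(0) = Re (g'(0) u)\<close> then makes \<open>\<phi>\<close> positive. Strict convexity is recorded as the
  existence of a supporting line that touches only at \<open>x\<close>; the point \<open>y = 0\<close> is included.\<close>

lemma strictly_convex_ray:
  assumes hol: "g holomorphic_on ball 0 \<rho>" and g0: "Re (g 0) = 0"
    and w: "w \<in> ball 0 \<rho>" "deriv (deriv g) w \<noteq> 0"
  obtains u r where "norm u = 1" "0 < r" "r \<le> \<rho>" "\<And>t. 0 < t \<Longrightarrow> t < r \<Longrightarrow> 0 < Re (g (of_real t * u))"
    "\<And>x. 0 < x \<Longrightarrow> x < r \<Longrightarrow> \<exists>s. \<forall>y. 0 \<le> y \<longrightarrow> y < r \<longrightarrow> y \<noteq> x \<longrightarrow>
        Re (g (of_real x * u)) + s * (y - x) < Re (g (of_real y * u))"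
proof -
  have hol2: "deriv (deriv g) holomorphic_on ball 0 \<rho>" by (intro holomorphic_deriv hol open_ball)
  obtain k q r0 where q: "0 < r0" "r0 \<le> \<rho>" "q holomorphic_on ball 0 r0" "q 0 \<noteq> 0"
    "\<And>z. z \<in> ball 0 r0 \<Longrightarrow> deriv (deriv g) z = z ^ k * q z"
    using holomorphic_factor_at_0[OF hol2 w] by (elim exE conjE) (rule that, auto)
  obtain u where u: "norm u = 1" "0 < Re (q 0 * u ^ (k + 2))" "0 \<le> Re (deriv g 0 * u)"
    using direction_exists[OF q(4), of "k + 2" "deriv g 0"] by auto
  obtain r where r: "0 < r" "r \<le> r0" "\<And>z. norm z < r \<Longrightarrow> 0 < Re (u ^ (k + 2) * q z)"
    using positive_near_0[OF q(3,1), of "u ^ (k + 2)"] u(2) by (metis mult.commute)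
  define \<phi> where "\<phi> t = Re (g (of_real t * u))" for t
  define \<psi> where "\<psi> t = Re (u * deriv g (of_real t * u))" for t
  have tu: "of_real t * u \<in> ball 0 \<rho>" "of_real t * u \<in> ball 0 r0" "norm (of_real t * u) < r" if "\<bar>t\<bar> < r" for t
    using that r q u by (auto simp: norm_mult)
  have d1: "(\<phi> has_real_derivative \<psi> t) (at t)" if "\<bar>t\<bar> < r" for t
    unfolding \<phi>_def \<psi>_def by (intro DERIV_Re_ray holomorphic_derivI[OF hol open_ball] tu that)
  have d2: "(\<psi> has_real_derivative Re (u * (u * deriv (deriv g) (of_real t * u)))) (at t)" if "\<bar>t\<bar> < r" for t
    unfolding \<psi>_def
    by (intro DERIV_Re_ray[of "\<lambda>z. u * deriv g z"] DERIV_cmult holomorphic_derivI[of _ "ball 0 \<rho>"]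
        holomorphic_deriv hol open_ball tu that)
  have pos: "0 < Re (u * (u * deriv (deriv g) (of_real t * u)))" if "0 < t" "t < r" for t
  proof -
    have "u * (u * deriv (deriv g) (of_real t * u)) = of_real (t ^ k) * (u ^ (k + 2) * q (of_real t * u))"
      using q(5) tu(2)[of t] that by (simp add: power_mult_distrib power_add power2_eq_square)
    also have "Re \<dots> = t ^ k * Re (u ^ (k + 2) * q (of_real t * u))" by (simp only: Re_of_real_mult)
    also have "\<dots> > 0" using r(3)[OF tu(3)] that by simp
    finally show ?thesis .
  qed
  have mono: "\<psi> x < \<psi> y" if "0 \<le> x" "x < y" "y < r" for x y
  proof (rule DERIV_pos_imp_increasing_open[OF that(2)])
    show "\<exists>D. (\<psi> has_real_derivative D) (at t) \<and> 0 < D" if "x < t" "t < y" for t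
      using d2[of t] pos[of t] that \<open>0 \<le> x\<close> \<open>y < r\<close> by auto
    have "\<forall>t\<in>{x..y}. isCont \<psi> t"
    proof
      fix t assume "t \<in> {x..y}"
      then have "\<bar>t\<bar> < r" using that by auto
      then show "isCont \<psi> t" by (rule DERIV_isCont[OF d2])
    qed
    then show "continuous_on {x..y} \<psi>" by (simp add: continuous_at_imp_continuous_on)
  qed
  have mvt: "\<exists>z. a < z \<and> z < b \<and> \<phi> b - \<phi> a = (b - a) * \<psi> z" if "0 \<le> a" "a < b" "b < r" for a b
  proof -
    have "(\<phi> has_real_derivative \<psi> t) (at t)" if "a \<le> t" "t \<le> b" for t
      by (rule d1) (use that \<open>0 \<le> a\<close> \<open>b < r\<close> in auto)
    then show ?thesis using MVT2[OF that(2), of \<phi> \<psi>] by blast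
  qed
  show ?thesis
  proof (rule that[OF u(1) r(1)])
    show "r \<le> \<rho>" using r q by simp
    show "0 < Re (g (of_real t * u))" if t: "0 < t" "t < r" for t
    proof -
      obtain z where z: "0 < z" "z < t" "\<phi> t - \<phi> 0 = t * \<psi> z" using mvt[of 0 t] t by auto
      have "\<psi> 0 < \<psi> z" using mono z t by simp
      moreover have "0 \<le> \<psi> 0" using u by (simp add: \<psi>_def mult.commute)
      ultimately have "0 < t * \<psi> z" using t by simp
      moreover have "\<phi> 0 = 0" by (simp add: \<phi>_def g0)
      ultimately show ?thesis using z by (simp add: \<phi>_def)
    qed
    show "\<exists>s. \<forall>y. 0 \<le> y \<longrightarrow> y < r \<longrightarrow> y \<noteq> x \<longrightarrow>
        Re (g (of_real x * u)) + s * (y - x) < Re (g (of_real y * u))" if x: "0 < x" "x < r" for x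
    proof (intro exI allI impI)
      fix y assume y: "0 \<le> y" "y < r" "y \<noteq> x"
      have "\<phi> x + \<psi> x * (y - x) < \<phi> y"
      proof (cases "x < y")
        case True
        then obtain z where z: "x < z" "z < y" "\<phi> y - \<phi> x = (y - x) * \<psi> z" using mvt[of x y] x y by auto
        have "\<psi> x < \<psi> z" using mono z x y by simp
        then have "(y - x) * \<psi> x < (y - x) * \<psi> z" using True by simp
        moreover have "\<psi> x * (y - x) = (y - x) * \<psi> x" by simp
        ultimately show ?thesis using z(3) by linarith
      next
        case False
        then obtain z where z: "y < z" "z < x" "\<phi> x - \<phi> y = (x - y) * \<psi> z" using mvt[of y x] x y by auto
        have "\<psi> z < \<psi> x" using mono z x y by simp
        then have "(x - y) * \<psi> z < (x - y) * \<psi> x" using False y by simp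
        moreover have "\<psi> x * (y - x) = - ((x - y) * \<psi> x)" by (simp add: algebra_simps)
        ultimately show ?thesis using z(3) by linarith
      qed
      then show "Re (g (of_real x * u)) + \<psi> x * (y - x) < Re (g (of_real y * u))" by (simp add: \<phi>_def)
    qed
  qed
qed

text \<open>The first nonconstant term of the Taylor expansion of \<open>g\<close> can be made negative by turning \<open>v\<close>.\<close>

lemma decay_ray:
  assumes hol: "g holomorphic_on ball 0 \<rho>" and g0: "Re (g 0) = 0"
    and w: "w \<in> ball 0 \<rho>" "g w \<noteq> g 0"
  obtains v r where "norm v = 1" "0 < r" "r \<le> \<rho>" "\<And>t. 0 < t \<Longrightarrow> t < r \<Longrightarrow> Re (g (of_real t * v)) < 0"
proof -
  have hol': "(\<lambda>z. g z - g 0) holomorphic_on ball 0 \<rho>" by (intro holomorphic_intros hol)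
  have "g w - g 0 \<noteq> 0" using w by simp
  from holomorphic_factor_at_0[OF hol' w(1) this] obtain k q r0 where q: "0 < r0" "r0 \<le> \<rho>" "q holomorphic_on ball 0 r0" "q 0 \<noteq> 0"
    "\<And>z. z \<in> ball 0 r0 \<Longrightarrow> g z - g 0 = z ^ k * q z"
    by (elim exE conjE) (rule that, auto)
  have "0 < k" using q(5)[of 0] q(1,4) by (cases k) auto
  then obtain v where v: "norm v = 1" "Re (q 0 * v ^ k) < 0"
    using negative_direction_exists[OF q(4)] by blast
  obtain r where r: "0 < r" "r \<le> r0" "\<And>z. norm z < r \<Longrightarrow> 0 < Re (- (v ^ k) * q z)"
    using positive_near_0[OF q(3,1), of "- (v ^ k)"] v(2) by (auto simp: mult.commute)
  show ?thesis
  proof (rule that[OF v(1) r(1)])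
    show "r \<le> \<rho>" using r q by simp
    fix t assume t: "0 < t" "t < r"
    have n: "norm (of_real t * v) = t" using t v by (simp add: norm_mult)
    have "g (of_real t * v) - g 0 = of_real (t ^ k) * (v ^ k * q (of_real t * v))"
      using q(5)[of "of_real t * v"] n t r by (simp add: power_mult_distrib)
    then have "Re (g (of_real t * v) - g 0) = t ^ k * Re (v ^ k * q (of_real t * v))"
      by (simp only: Re_of_real_mult)
    moreover have "t ^ k * Re (v ^ k * q (of_real t * v)) < 0"
      using r(3)[of "of_real t * v"] n t by (auto intro!: mult_pos_neg)
    ultimately show "Re (g (of_real t * v)) < 0" using g0 by simp
  qed
qed

text \<open>If \<open>g''\<close> vanished near 0, then \<open>g\<close> would be affine there and \<open>\<Phi>\<close> would be an exponential everywhere by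
  the identity theorem.\<close>

lemma local_log:
  assumes hol: "\<Phi> holomorphic_on UNIV" and one: "norm (\<Phi> 0) = 1"
    and not_exp: "\<not> (\<exists>a b. \<forall>z. \<Phi> z = exp (a * z + b))"
  obtains g \<rho> w w' where "0 < \<rho>" "g holomorphic_on ball 0 \<rho>" "\<And>z. z \<in> ball 0 \<rho> \<Longrightarrow> \<Phi> z = exp (g z)"
    "Re (g 0) = 0" "w \<in> ball 0 \<rho>" "deriv (deriv g) w \<noteq> 0" "w' \<in> ball 0 \<rho>" "g w' \<noteq> g 0"
proof -
  have "isCont \<Phi> 0"
    using hol holomorphic_on_imp_continuous_on continuous_on_eq_continuous_at open_UNIV by blast
  then obtain \<rho> where \<rho>: "0 < \<rho>" "\<And>z. dist 0 z < \<rho> \<Longrightarrow> \<Phi> z \<noteq> 0"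
    using continuous_at_avoid[of 0 \<Phi> 0] one by fastforce
  have holB: "\<Phi> holomorphic_on ball 0 \<rho>" using hol holomorphic_on_subset by blast
  have nz: "\<Phi> z \<noteq> 0" if "z \<in> ball 0 \<rho>" for z using \<rho> that by simp
  obtain g where g: "g holomorphic_on ball 0 \<rho>" "\<And>z. z \<in> ball 0 \<rho> \<Longrightarrow> \<Phi> z = exp (g z)"
    by (rule contractible_imp_holomorphic_log[OF holB convex_imp_contractible[OF convex_ball]])
      (erule nz, rule that, auto)
  have affine: False if "\<And>z. z \<in> ball 0 \<rho> \<Longrightarrow> g z = a * z + b" for a b
  proof -
    have "\<Phi> z = exp (a * z + b)" for z
      by (rule analytic_continuation_open[of "ball 0 \<rho>" UNIV])
        (use that g \<rho> hol in \<open>auto intro!: holomorphic_intros\<close>)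
    then show False using not_exp by blast
  qed
  have "\<exists>w'\<in>ball 0 \<rho>. g w' \<noteq> g 0" using affine[of 0 "g 0"] by force
  moreover have "\<exists>w\<in>ball 0 \<rho>. deriv (deriv g) w \<noteq> 0"
  proof (rule ccontr)
    assume "\<not> ?thesis"
    then have z: "deriv (deriv g) w = 0" if "w \<in> ball 0 \<rho>" for w using that by blast
    have "(deriv g has_field_derivative 0) (at w within ball 0 \<rho>)" if "w \<in> ball 0 \<rho>" for w
      using holomorphic_derivI[OF holomorphic_deriv[OF g(1) open_ball] open_ball that, of "ball 0 \<rho>"] z[OF that] by simp
    then obtain a where a: "\<forall>w\<in>ball 0 \<rho>. deriv g w = a"
      using has_field_derivative_zero_constant[OF convex_ball] by blast
    have "((\<lambda>w. g w - a * w) has_field_derivative 0) (at w within ball 0 \<rho>)" if "w \<in> ball 0 \<rho>" for w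
    proof -
      have "(g has_field_derivative a) (at w within ball 0 \<rho>)"
        using holomorphic_derivI[OF g(1) open_ball that, of "ball 0 \<rho>"] a that by simp
      then show ?thesis by (auto intro!: derivative_eq_intros)
    qed
    then obtain b where "\<forall>w\<in>ball 0 \<rho>. g w - a * w = b"
      using has_field_derivative_zero_constant[OF convex_ball] by blast
    then show False using affine[of a b] by (simp add: diff_eq_eq add.commute)
  qed
  moreover have "Re (g 0) = 0" using g(2)[of 0] \<rho> one by simp
  ultimately show ?thesis using that \<rho> g by blast
qed

section \<open>Monomials and separating weights\<close>

definition mono_eval :: "(nat \<Rightarrow>\<^sub>0 nat) \<Rightarrow> (nat \<Rightarrow> complex \<Rightarrow> complex) \<Rightarrow> complex \<Rightarrow> complex" where
  "mono_eval \<alpha> f z = (\<Prod>i\<in>Poly_Mapping.keys \<alpha>. f i z ^ Poly_Mapping.lookup \<alpha> i)"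

text \<open>One slot for each factor of the monomial, counted with multiplicity: the pair of a variable and the number
  of its occurrence. Expanding a monomial of sums means choosing a summand for each slot.\<close>

definition slots :: "(nat \<Rightarrow>\<^sub>0 nat) \<Rightarrow> (nat \<times> nat) set" where
  "slots \<alpha> = Sigma (Poly_Mapping.keys \<alpha>) (\<lambda>i. {..<Poly_Mapping.lookup \<alpha> i})"

lemma finite_slots: "finite (slots \<alpha>)"
  by (simp add: slots_def)

lemma norm_exp_mult_le:
  fixes c z :: complex
  assumes "norm z \<le> R" shows "norm (exp (c * z)) \<le> exp (norm c * R)"
proof -
  have "norm (exp (c * z)) \<le> exp (norm (c * z))" by (rule norm_exp)
  also have "\<dots> \<le> exp (norm c * R)" using assms by (simp add: norm_mult mult_left_mono)
  finally show ?thesis .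
qed

lemma slots_nonempty: "\<alpha> \<noteq> 0 \<Longrightarrow> slots \<alpha> \<noteq> {}"
proof -
  assume "\<alpha> \<noteq> 0"
  then obtain i where "i \<in> Poly_Mapping.keys \<alpha>" using keys_eq_empty by blast
  then have "(i, 0) \<in> slots \<alpha>" by (simp add: slots_def in_keys_iff)
  then show ?thesis by blast
qed

lemma mono_eval_slots: "mono_eval \<alpha> f z = (\<Prod>p\<in>slots \<alpha>. f (fst p) z)"
proof -
  have "(\<Prod>p\<in>slots \<alpha>. f (fst p) z) = (\<Prod>i\<in>Poly_Mapping.keys \<alpha>. \<Prod>j<Poly_Mapping.lookup \<alpha> i. f i z)"
    unfolding slots_def by (subst prod.Sigma) (auto simp: case_prod_beta)
  then show ?thesis by (simp add: mono_eval_def)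
qed

lemma sum_slots:
  fixes \<theta> :: "nat \<Rightarrow> real"
  shows "(\<Sum>p\<in>slots \<alpha>. \<theta> (fst p)) = (\<Sum>i\<in>Poly_Mapping.keys \<alpha>. Poly_Mapping.lookup \<alpha> i * \<theta> i)"
proof -
  have "(\<Sum>p\<in>slots \<alpha>. \<theta> (fst p)) = (\<Sum>i\<in>Poly_Mapping.keys \<alpha>. \<Sum>j<Poly_Mapping.lookup \<alpha> i. \<theta> i)"
    unfolding slots_def by (subst sum.Sigma) (auto simp: case_prod_beta)
  then show ?thesis by simp
qed

lemma mono_eval_entire:
  assumes "\<And>i. f i \<in> entire" shows "mono_eval \<alpha> f \<in> entire"
proof -
  have "(\<lambda>z. mono_eval \<alpha> f z) \<in> entire"
    unfolding mono_eval_def by (intro entire_prod entire_power assms)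
  then show ?thesis by simp
qed

text \<open>With \<open>x\<^sup>i\<close> as the weight of the \<open>i\<close>-th variable, two monomials have equal weight only if \<open>x\<close> is a root of a
  nonzero polynomial. Off these finitely many \<open>x\<close> the weights are distinct, so that the maximum is attained
  once; dividing by it normalises the weight of \<open>\<beta>\<close> to 1.\<close>

lemma separating_weights:
  assumes A: "finite A" "A \<noteq> {}" "0 \<notin> A"
  obtains \<theta> :: "nat \<Rightarrow> real" and \<beta> where "\<beta> \<in> A" "\<And>i. 0 < \<theta> i" "(\<Sum>p\<in>slots \<beta>. \<theta> (fst p)) = 1"
    "\<And>\<alpha>. \<alpha> \<in> A \<Longrightarrow> \<alpha> \<noteq> \<beta> \<Longrightarrow> (\<Sum>p\<in>slots \<alpha>. \<theta> (fst p)) < 1"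
proof -
  define V where "V = (\<Union>\<alpha>\<in>A. Poly_Mapping.keys \<alpha>)"
  have V: "finite V" using A by (simp add: V_def)
  define P :: "(nat \<Rightarrow>\<^sub>0 nat) \<Rightarrow> real poly" where
    "P \<alpha> = (\<Sum>i\<in>V. monom (of_nat (Poly_Mapping.lookup \<alpha> i)) i)" for \<alpha>
  have coeff_P: "coeff (P \<alpha>) i = of_nat (Poly_Mapping.lookup \<alpha> i)" if "\<alpha> \<in> A" for \<alpha> i
  proof (cases "i \<in> V")
    case True
    then show ?thesis using V by (simp add: P_def coeff_sum coeff_monom)
  next
    case False
    then have "Poly_Mapping.lookup \<alpha> i = 0" using that by (auto simp: V_def in_keys_iff)
    then show ?thesis using V False by (simp add: P_def coeff_sum coeff_monom)
  qed
  have P_inj: "P \<alpha> - P \<beta> \<noteq> 0" if "\<alpha> \<in> A" "\<beta> \<in> A" "\<alpha> \<noteq> \<beta>" for \<alpha> \<beta>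
  proof
    assume "P \<alpha> - P \<beta> = 0"
    then have "coeff (P \<alpha>) i = coeff (P \<beta>) i" for i by simp
    then have "Poly_Mapping.lookup \<alpha> i = Poly_Mapping.lookup \<beta> i" for i using that by (simp add: coeff_P)
    then show False using that by (simp add: poly_mapping_eqI)
  qed
  \<comment> \<open>the values of \<open>x\<close> at which two monomials have the same weight\<close>
  define bad where "bad = (\<Union>(\<alpha>, \<beta>)\<in>{(\<alpha>, \<beta>). \<alpha> \<in> A \<and> \<beta> \<in> A \<and> \<alpha> \<noteq> \<beta>}. {x. poly (P \<alpha> - P \<beta>) x = 0})"
  have "finite bad"
    unfolding bad_def
  proof (rule finite_UN_I)
    have "{(\<alpha>, \<beta>). \<alpha> \<in> A \<and> \<beta> \<in> A \<and> \<alpha> \<noteq> \<beta>} \<subseteq> A \<times> A" by auto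
    then show "finite {(\<alpha>, \<beta>). \<alpha> \<in> A \<and> \<beta> \<in> A \<and> \<alpha> \<noteq> \<beta>}" using A(1) finite_subset by blast
    fix k assume "k \<in> {(\<alpha>, \<beta>). \<alpha> \<in> A \<and> \<beta> \<in> A \<and> \<alpha> \<noteq> \<beta>}"
    then obtain \<alpha> \<beta> where k: "k = (\<alpha>, \<beta>)" "P \<alpha> - P \<beta> \<noteq> 0" using P_inj by blast
    show "finite (case k of (\<alpha>, \<beta>) \<Rightarrow> {x. poly (P \<alpha> - P \<beta>) x = 0})"
      using poly_roots_finite[OF k(2)] by (simp add: k(1))
  qed
  from this obtain x where x: "0 < x" "x \<notin> bad"
  proof -
    assume "finite bad"
    then have "\<not> {0<..} \<subseteq> bad" using infinite_Ioi[of "0::real"] finite_subset by blast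
    then show ?thesis using that by auto
  qed
  define W where "W \<alpha> = poly (P \<alpha>) x" for \<alpha>
  have W_inj: "W \<alpha> \<noteq> W \<beta>" if "\<alpha> \<in> A" "\<beta> \<in> A" "\<alpha> \<noteq> \<beta>" for \<alpha> \<beta>
    using x(2) that by (auto simp: bad_def W_def)
  have W: "W \<alpha> = (\<Sum>i\<in>Poly_Mapping.keys \<alpha>. Poly_Mapping.lookup \<alpha> i * x ^ i)" if "\<alpha> \<in> A" for \<alpha>
  proof -
    have "W \<alpha> = (\<Sum>i\<in>V. Poly_Mapping.lookup \<alpha> i * x ^ i)"
      by (simp add: W_def P_def poly_sum poly_monom)
    also have "\<dots> = (\<Sum>i\<in>Poly_Mapping.keys \<alpha>. Poly_Mapping.lookup \<alpha> i * x ^ i)"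
      using V that by (intro sum.mono_neutral_right) (auto simp: V_def in_keys_iff)
    finally show ?thesis .
  qed
  obtain \<beta> where \<beta>: "\<beta> \<in> A" "\<And>\<alpha>. \<alpha> \<in> A \<Longrightarrow> W \<alpha> \<le> W \<beta>"
  proof -
    have "Max (W ` A) \<in> W ` A" using A by (intro Max_in) auto
    then obtain \<beta> where "\<beta> \<in> A" "W \<beta> = Max (W ` A)" by auto
    moreover have "W \<alpha> \<le> Max (W ` A)" if "\<alpha> \<in> A" for \<alpha> using A that by simp
    ultimately show ?thesis using that by simp
  qed
  have Wpos: "0 < W \<beta>"
  proof -
    have "Poly_Mapping.keys \<beta> \<noteq> {}" using \<beta> A(3) by auto
    then show ?thesis unfolding W[OF \<beta>(1)] using x by (intro sum_pos) (auto simp: in_keys_iff)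
  qed
  show ?thesis
  proof (rule that[OF \<beta>(1), of "\<lambda>i. x ^ i / W \<beta>"])
    have s: "(\<Sum>p\<in>slots \<alpha>. x ^ fst p / W \<beta>) = W \<alpha> / W \<beta>" if "\<alpha> \<in> A" for \<alpha>
      using sum_slots[of "\<lambda>i. x ^ i / W \<beta>" \<alpha>] by (simp add: W[OF that] sum_divide_distrib)
    show "0 < x ^ i / W \<beta>" for i using x Wpos by simp
    show "(\<Sum>p\<in>slots \<beta>. x ^ fst p / W \<beta>) = 1" using s[OF \<beta>(1)] Wpos by simp
    show "(\<Sum>p\<in>slots \<alpha>. x ^ fst p / W \<beta>) < 1" if "\<alpha> \<in> A" "\<alpha> \<noteq> \<beta>" for \<alpha>
      using s[OF that(1)] \<beta>(2)[OF that(1)] W_inj[OF that(1) \<beta>(1) that(2)] Wpos by simp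
  qed
qed

section \<open>Simultaneous approximation of monomials\<close>

text \<open>The two rays: along \<open>u\<close> the function \<open>log |\<Phi>|\<close> is positive and strictly convex, along \<open>v\<close> it is negative.\<close>

locale convex_ray = conv_op +
  fixes g :: "complex \<Rightarrow> complex" and \<rho> :: real and u v :: complex and r r' :: real
  assumes Phi_exp: "\<And>z. z \<in> ball 0 \<rho> \<Longrightarrow> \<Phi> z = exp (g z)"
    and g0: "Re (g 0) = 0"
    and u: "norm u = 1" and r: "0 < r" "r \<le> \<rho>"
    and pos: "\<And>t. 0 < t \<Longrightarrow> t < r \<Longrightarrow> 0 < Re (g (of_real t * u))"
    and tangent: "\<And>x. 0 < x \<Longrightarrow> x < r \<Longrightarrow> \<exists>s. \<forall>y. 0 \<le> y \<longrightarrow> y < r \<longrightarrow> y \<noteq> x \<longrightarrow>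
        Re (g (of_real x * u)) + s * (y - x) < Re (g (of_real y * u))"
    and v: "norm v = 1" and r': "0 < r'" "r' \<le> \<rho>"
    and decay: "\<And>t. 0 < t \<Longrightarrow> t < r' \<Longrightarrow> Re (g (of_real t * v)) < 0"
begin

definition "lv x = Re (g (of_real x * u))"

text \<open>The missing mass \<open>1 - sum th S\<close> is thought of as sitting at the point 0, where \<open>lv\<close> vanishes. This is
  Jensen's inequality for the supporting line at the barycentre, and it is strict unless all the mass sits at one
  point.\<close>

lemma jensen_strict:
  assumes S: "finite S" "S \<noteq> {}" and th: "\<And>p. p \<in> S \<Longrightarrow> 0 < th p" and le1: "sum th S \<le> 1"
    and t: "\<And>p. p \<in> S \<Longrightarrow> 0 < t p \<and> t p < r"
    and strict: "sum th S < 1 \<or> (\<exists>p\<in>S. \<exists>q\<in>S. t p \<noteq> t q)"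
  shows "lv (\<Sum>p\<in>S. th p * t p) < (\<Sum>p\<in>S. th p * lv (t p))"
    and "0 < (\<Sum>p\<in>S. th p * t p)" "(\<Sum>p\<in>S. th p * t p) < r"
proof -
  define x where "x = (\<Sum>p\<in>S. th p * t p)"
  define \<sigma> where "\<sigma> = sum th S"
  have x0: "0 < x" unfolding x_def using S th t by (intro sum_pos) auto
  have "x < (\<Sum>p\<in>S. th p * r)" unfolding x_def using S th t by (intro sum_strict_mono) auto
  also have "\<dots> = \<sigma> * r" by (simp add: \<sigma>_def sum_distrib_right)
  also have "\<dots> \<le> 1 * r" using le1 r by (intro mult_right_mono) (auto simp: \<sigma>_def)
  finally have xr: "x < r" by simp
  show "0 < (\<Sum>p\<in>S. th p * t p)" "(\<Sum>p\<in>S. th p * t p) < r" using x0 xr by (auto simp: x_def)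
  obtain s where s: "\<And>y. 0 \<le> y \<Longrightarrow> y < r \<Longrightarrow> y \<noteq> x \<Longrightarrow> lv x + s * (y - x) < lv y"
    using tangent[OF x0 xr] unfolding lv_def by blast
  \<comment> \<open>the supporting line at \<open>x\<close> lies strictly below \<open>lv 0 = 0\<close>\<close>
  have s0: "lv x - s * x < 0" using s[of 0] x0 r by (simp add: lv_def g0)
  have le: "th p * (lv x + s * (t p - x)) \<le> th p * lv (t p)" if "p \<in> S" for p
    using s[of "t p"] t[OF that] th[OF that] by (cases "t p = x") auto
  have lt: "th p * (lv x + s * (t p - x)) < th p * lv (t p)" if "p \<in> S" "t p \<noteq> x" for p
    using s[of "t p"] t[OF that(1)] th[OF that(1)] that by auto
  have "(\<Sum>p\<in>S. th p * (lv x + s * (t p - x))) = (\<Sum>p\<in>S. th p * (lv x - s * x) + s * (th p * t p))"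
    by (intro sum.cong refl) (simp add: algebra_simps)
  also have "\<dots> = \<sigma> * (lv x - s * x) + s * x"
    by (simp add: sum.distrib sum_distrib_right[symmetric] sum_distrib_left[symmetric] \<sigma>_def x_def)
  finally have eq: "(\<Sum>p\<in>S. th p * (lv x + s * (t p - x))) = \<sigma> * (lv x - s * x) + s * x" .
  have "lv x < (\<Sum>p\<in>S. th p * lv (t p))"
  proof (cases "\<sigma> < 1")
    case True
    then have "(1 - \<sigma>) * (lv x - s * x) < 0" using s0 by (simp add: mult_pos_neg)
    moreover have "(\<Sum>p\<in>S. th p * (lv x + s * (t p - x))) \<le> (\<Sum>p\<in>S. th p * lv (t p))"
      using le by (intro sum_mono)
    ultimately show ?thesis using eq by (simp add: algebra_simps)
  next
    case False
    then have 1: "\<sigma> = 1" using le1 by (simp add: \<sigma>_def)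
    then obtain p where p: "p \<in> S" "t p \<noteq> x" using strict by (auto simp: \<sigma>_def)
    have "(\<Sum>p\<in>S. th p * (lv x + s * (t p - x))) < (\<Sum>p\<in>S. th p * lv (t p))"
      using S le lt p by (intro sum_strict_mono_ex1) auto
    then show ?thesis using eq 1 by simp
  qed
  then show "lv (\<Sum>p\<in>S. th p * t p) < (\<Sum>p\<in>S. th p * lv (t p))" by (simp add: x_def)
qed

lemma norm_Phi_u: "0 < x \<Longrightarrow> x < r \<Longrightarrow> norm (\<Phi> (of_real x * u)) = exp (lv x)"
  using Phi_exp[of "of_real x * u"] u r by (simp add: norm_mult lv_def)

lemma norm_Phi_v: assumes "0 < x" "x < r'" shows "norm (\<Phi> (of_real x * v)) < 1"
  using Phi_exp[of "of_real x * v"] v r' decay[OF assms] assms by (simp add: norm_mult)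

lemma uniform_radius:
  assumes "finite X" "\<And>k. k \<in> X \<Longrightarrow> \<exists>d>0::real. \<forall>y. norm (y::complex) < d \<longrightarrow> P k y"
  shows "\<exists>d>0. \<forall>k\<in>X. \<forall>y. norm y < d \<longrightarrow> P k y"
  using assms
proof (induction X)
  case empty then show ?case by (auto intro: exI[of _ 1])
next
  case (insert k X)
  then obtain d1 d2 where "0 < d1" "\<forall>k\<in>X. \<forall>y. norm y < d1 \<longrightarrow> P k y" "0 < d2" "\<forall>y. norm y < d2 \<longrightarrow> P k y"
    by blast
  then show ?case by (intro exI[of _ "min d1 d2"]) auto
qed

text \<open>The strict inequalities supplied by Jensen concern finitely many points of the \<open>u\<close>-ray, so they survive
  a small displacement \<open>y\<close>. The frequencies on the \<open>v\<close>-ray will be taken so small that they only cause such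
  displacements.\<close>

lemma small_radius:
  fixes \<D> :: "(nat \<times> nat) set set" and \<theta> :: "nat \<Rightarrow> real"
  assumes "finite \<D>" "\<And>D. D \<in> \<D> \<Longrightarrow> finite D" "finite W" "W \<subseteq> {0<..<r}"
  shows "\<exists>d>0. \<forall>D\<in>\<D>. \<forall>S\<subseteq>D. \<forall>t\<in>PiE S (\<lambda>_. W). \<forall>y. norm y < d \<longrightarrow>
    0 < (\<Sum>p\<in>S. \<theta> (fst p) * t p) \<longrightarrow> (\<Sum>p\<in>S. \<theta> (fst p) * t p) < r \<longrightarrow>
    lv (\<Sum>p\<in>S. \<theta> (fst p) * t p) < (\<Sum>p\<in>S. \<theta> (fst p) * lv (t p)) \<longrightarrow>
    norm (\<Phi> (of_real (\<Sum>p\<in>S. \<theta> (fst p) * t p) * u + y)) < exp (\<Sum>p\<in>S. \<theta> (fst p) * lv (t p))"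
proof -
  define P where "P = (\<lambda>(S :: (nat \<times> nat) set, t) y. 0 < (\<Sum>p\<in>S. \<theta> (fst p) * t p) \<longrightarrow> (\<Sum>p\<in>S. \<theta> (fst p) * t p) < r \<longrightarrow>
    lv (\<Sum>p\<in>S. \<theta> (fst p) * t p) < (\<Sum>p\<in>S. \<theta> (fst p) * lv (t p)) \<longrightarrow>
    norm (\<Phi> (of_real (\<Sum>p\<in>S. \<theta> (fst p) * t p) * u + y)) < exp (\<Sum>p\<in>S. \<theta> (fst p) * lv (t p)))"
  define X where "X = (\<Union>D\<in>\<D>. Sigma (Pow D) (\<lambda>S. PiE S (\<lambda>_. W)))"
  have X: "finite X"
    unfolding X_def using assms finite_subset by (intro finite_UN_I finite_SigmaI finite_PiE) auto
  have "\<exists>d>0. \<forall>y. norm y < d \<longrightarrow> P k y" for k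
  proof -
    obtain S t where k: "k = (S, t)" by fastforce
    define x where "x = (\<Sum>p\<in>S. \<theta> (fst p) * t p)"
    define Y where "Y = (\<Sum>p\<in>S. \<theta> (fst p) * lv (t p))"
    show ?thesis
    proof (cases "0 < x \<and> x < r \<and> lv x < Y")
      case True
      have "continuous_on UNIV (\<lambda>y. norm (\<Phi> (of_real x * u + y)))"
        by (intro continuous_intros continuous_on_compose2[OF holomorphic_on_imp_continuous_on[OF hol]]) auto
      then have "open ((\<lambda>y. norm (\<Phi> (of_real x * u + y))) -` {..<exp Y})"
        by (intro open_vimage) auto
      moreover have "0 \<in> (\<lambda>y. norm (\<Phi> (of_real x * u + y))) -` {..<exp Y}"
        using True norm_Phi_u[of x] by simp
      ultimately obtain d where "0 < d" "ball 0 d \<subseteq> (\<lambda>y. norm (\<Phi> (of_real x * u + y))) -` {..<exp Y}"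
        using open_contains_ball by blast
      then show ?thesis by (intro exI[of _ d]) (auto simp: k P_def x_def Y_def subset_iff)
    next
      case False
      then show ?thesis by (intro exI[of _ 1]) (auto simp: k P_def x_def Y_def)
    qed
  qed
  then obtain d where d: "d > 0" "\<forall>k\<in>X. \<forall>y. norm y < d \<longrightarrow> P k y"
    using uniform_radius[OF X, of P] by blast
  have "P (S, t) y" if "D \<in> \<D>" "S \<subseteq> D" "t \<in> PiE S (\<lambda>_. W)" "norm y < d" for D S t y
    using d(2) that by (auto simp: X_def)
  then show ?thesis using d(1) unfolding P_def by (intro exI[of _ d]) auto
qed

end


text \<open>The \<open>i\<close>-th entry is the exponential sum with coefficients \<open>a i\<close> on the \<open>v\<close>-ray plus a perturbation built from the
  coefficients \<open>b\<close> of the target on the \<open>u\<close>-ray.\<close>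

locale perturbation = convex_ray +
  fixes \<theta> :: "nat \<Rightarrow> real" and a :: "nat \<Rightarrow> real \<Rightarrow> complex" and b :: "real \<Rightarrow> complex" and \<delta> :: real
  assumes theta_pos: "\<And>i. 0 < \<theta> i"
    and a: "\<And>i. finite {t. a i t \<noteq> 0}" "\<And>i. {t. a i t \<noteq> 0} \<subseteq> {0<..<\<delta>}"
    and b: "finite {t. b t \<noteq> 0}" "{t. b t \<noteq> 0} \<subseteq> {0<..<r}"
begin

definition "W = {t. b t \<noteq> 0}"

definition freqs :: "nat \<Rightarrow> (real + real) set" where
  "freqs i = Inl ` {t. a i t \<noteq> 0} \<union> Inr ` W"

text \<open>The summands of the \<open>N\<close>-th approximation are \<open>coef * ratio ^ N * exp (freq * z)\<close>. The tag \<open>Inl\<close> marks the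
  unperturbed part and \<open>Inr\<close> the perturbation, whose coefficients are the \<open>\<theta> i\<close>-th power of
  \<open>b t * exp (- N * g (t * u)) = b t / \<Phi> (t * u) ^ N\<close>; writing this with \<open>Ln\<close> and \<open>g\<close> makes the exponents
  add up when the factors are multiplied.\<close>

fun coef :: "nat \<Rightarrow> real + real \<Rightarrow> complex" where
  "coef i (Inl t) = a i t"
| "coef i (Inr t) = exp (of_real (\<theta> i) * Ln (b t))"

fun ratio :: "nat \<Rightarrow> real + real \<Rightarrow> complex" where
  "ratio i (Inl t) = 1"
| "ratio i (Inr t) = exp (- (of_real (\<theta> i) * g (of_real t * u)))"

fun freq :: "nat \<Rightarrow> real + real \<Rightarrow> complex" where
  "freq i (Inl t) = of_real t * v"
| "freq i (Inr t) = of_real (\<theta> i * t) * u"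

definition F :: "nat \<Rightarrow> nat \<Rightarrow> complex \<Rightarrow> complex" where
  "F N i z = (\<Sum>q\<in>freqs i. coef i q * ratio i q ^ N * exp (freq i q * z))"

lemma finite_freqs: "finite (freqs i)"
  using a b by (simp add: freqs_def W_def)

lemma W: "finite W" "W \<subseteq> {0<..<r}"
  using b by (auto simp: W_def)

lemma F_entire: "F N i \<in> entire"
proof -
  have "(\<lambda>z. F N i z) \<in> entire"
    unfolding F_def by (intro entire_sum entire_cmult entire_exp)
  then show ?thesis by simp
qed

lemma F_split:
  "F N i z = exp_sum v (a i) z +
    (\<Sum>t\<in>W. exp (of_real (\<theta> i) * Ln (b t)) * ratio i (Inr t) ^ N * exp (of_real (\<theta> i * t) * u * z))"
proof -
  have "F N i z = (\<Sum>q\<in>Inl ` {t. a i t \<noteq> 0}. coef i q * ratio i q ^ N * exp (freq i q * z))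
      + (\<Sum>q\<in>Inr ` W. coef i q * ratio i q ^ N * exp (freq i q * z))"
    unfolding F_def freqs_def using a W by (intro sum.union_disjoint) auto
  then show ?thesis by (simp add: sum.reindex exp_sum_def)
qed

lemma norm_ratio_less: "t \<in> W \<Longrightarrow> norm (ratio i (Inr t)) < 1"
  using pos[of t] W theta_pos[of i] by auto

lemma F_close:
  assumes "finite V" "0 < e"
  shows "\<forall>\<^sub>F N in sequentially. \<forall>i\<in>V. \<forall>z. norm z \<le> Rad \<longrightarrow> norm (F N i z - exp_sum v (a i) z) < e"
proof (rule eventually_ball_finite[OF assms(1)], rule ballI)
  fix i
  define B where "B N = (\<Sum>t\<in>W. norm (exp (of_real (\<theta> i) * Ln (b t))) * norm (ratio i (Inr t)) ^ N *
      exp (norm (of_real (\<theta> i * t) * u) * Rad))" for N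
  have "B \<longlonglongrightarrow> (\<Sum>t\<in>W. norm (exp (of_real (\<theta> i) * Ln (b t))) * 0 * exp (norm (of_real (\<theta> i * t) * u) * Rad))"
    unfolding B_def by (intro tendsto_intros LIMSEQ_realpow_zero norm_ratio_less) auto
  then have "B \<longlonglongrightarrow> 0" by simp
  then have "\<forall>\<^sub>F N in sequentially. B N < e" using assms(2) order_tendstoD(2) by blast
  then show "\<forall>\<^sub>F N in sequentially. \<forall>z. norm z \<le> Rad \<longrightarrow> norm (F N i z - exp_sum v (a i) z) < e"
  proof eventually_elim
    case (elim N)
    have "norm (F N i z - exp_sum v (a i) z) \<le> B N" if "norm z \<le> Rad" for z
      unfolding F_split B_def add_diff_cancel_left'
    proof (rule sum_norm_le)
      fix t
      have "norm (exp (of_real (\<theta> i * t) * u * z)) \<le> exp (norm (of_real (\<theta> i * t) * u) * Rad)"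
        by (rule norm_exp_mult_le[OF that])
      then show "norm (exp (of_real (\<theta> i) * Ln (b t)) * ratio i (Inr t) ^ N * exp (of_real (\<theta> i * t) * u * z))
          \<le> norm (exp (of_real (\<theta> i) * Ln (b t))) * norm (ratio i (Inr t)) ^ N * exp (norm (of_real (\<theta> i * t) * u) * Rad)"
        unfolding norm_mult[of _ "exp (_ * z)"] norm_mult[of "exp (_ * Ln _)"] norm_power
        by (intro mult_left_mono) auto
    qed
    then show ?case using elim by force
  qed
qed

definition "choices D = PiE D (\<lambda>p. freqs (fst p))"

definition "all_coef D h = (\<Prod>p\<in>D. coef (fst p) (h p))"
definition "all_ratio D h = (\<Prod>p\<in>D. ratio (fst p) (h p))"
definition "all_freq D h = (\<Sum>p\<in>D. freq (fst p) (h p))"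

lemma finite_choices: "finite D \<Longrightarrow> finite (choices D)"
  unfolding choices_def by (intro finite_PiE finite_freqs)

text \<open>Each choice of summands contributes one exponential, an eigenvector of the operator. The same \<open>N\<close> counts the
  approximation and the iterate, so that \<open>ratio\<close> and \<open>\<Phi>\<close> are raised to the same power.\<close>

lemma Tn_mono:
  "(T ^^ N) (mono_eval \<alpha> (F N)) = (\<lambda>z. \<Sum>h\<in>choices (slots \<alpha>).
     all_coef (slots \<alpha>) h * (all_ratio (slots \<alpha>) h * \<Phi> (all_freq (slots \<alpha>) h)) ^ N * exp (all_freq (slots \<alpha>) h * z))"
proof -
  have e: "mono_eval \<alpha> (F N) = (\<lambda>z. \<Sum>h\<in>choices (slots \<alpha>).
     (all_coef (slots \<alpha>) h * all_ratio (slots \<alpha>) h ^ N) * exp (all_freq (slots \<alpha>) h * z))"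
    unfolding mono_eval_slots F_def choices_def all_coef_def all_ratio_def all_freq_def
    by (simp add: prod_sum_PiE finite_slots finite_freqs prod.distrib prod_power_distrib
        sum_distrib_right exp_sum)
  show ?thesis
    unfolding e Tn_exp_sum[OF finite_choices[OF finite_slots]]
    by (simp only: power_mult_distrib mult.assoc)
qed

text \<open>The choices that take the same perturbation term in every slot.\<close>

definition "pure D = (\<lambda>t. restrict (\<lambda>p. Inr t) D) ` W"

lemma pure_subset: "pure D \<subseteq> choices D"
  by (auto simp: pure_def choices_def freqs_def)

text \<open>As the weights of the slots add up to 1, the product of the \<open>\<theta>\<close>-th powers is \<open>b t / \<Phi> (t * u) ^ N\<close> and the
  frequencies add up to \<open>t * u\<close>; the \<open>N\<close>-th iterate restores \<open>b t\<close> exactly.\<close>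

lemma pure_sum:
  assumes D: "finite D" "D \<noteq> {}" and one: "(\<Sum>p\<in>D. \<theta> (fst p)) = 1"
  shows "(\<Sum>h\<in>pure D. all_coef D h * (all_ratio D h * \<Phi> (all_freq D h)) ^ N * exp (all_freq D h * z)) = exp_sum u b z"
proof -
  have inj: "inj_on (\<lambda>t. restrict (\<lambda>p. Inr t :: real + real) D) W"
  proof (rule inj_onI)
    fix s t assume eq: "restrict (\<lambda>p. Inr s :: real + real) D = restrict (\<lambda>p. Inr t) D"
    obtain p where "p \<in> D" using D by blast
    then show "s = t" using fun_cong[OF eq, of p] by simp
  qed
  have one': "(\<Sum>p\<in>D. of_real (\<theta> (fst p))) = (1 :: complex)"
    using one by (metis of_real_1 of_real_sum)
  have "all_coef D (restrict (\<lambda>p. Inr t) D) * (all_ratio D (restrict (\<lambda>p. Inr t) D) *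
      \<Phi> (all_freq D (restrict (\<lambda>p. Inr t) D))) ^ N * exp (all_freq D (restrict (\<lambda>p. Inr t) D) * z)
      = b t * exp (of_real t * u * z)" (is "?lhs t = _") if t: "t \<in> W" for t
  proof -
    have "all_coef D (restrict (\<lambda>p. Inr t) D) = exp (\<Sum>p\<in>D. of_real (\<theta> (fst p)) * Ln (b t))"
      using D by (simp add: all_coef_def exp_sum)
    then have 1: "all_coef D (restrict (\<lambda>p. Inr t) D) = b t"
      using t by (simp add: sum_distrib_right[symmetric] one' W_def)
    have "all_ratio D (restrict (\<lambda>p. Inr t) D) = exp (\<Sum>p\<in>D. of_real (\<theta> (fst p)) * (- g (of_real t * u)))"
      using D by (simp add: all_ratio_def exp_sum)
    then have 2: "all_ratio D (restrict (\<lambda>p. Inr t) D) = exp (- g (of_real t * u))"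
      by (simp only: sum_distrib_right[symmetric] one' mult_1)
    have "all_freq D (restrict (\<lambda>p. Inr t) D) = (\<Sum>p\<in>D. of_real (\<theta> (fst p)) * (of_real t * u))"
      by (simp add: all_freq_def mult.assoc)
    then have 3: "all_freq D (restrict (\<lambda>p. Inr t) D) = of_real t * u"
      by (simp only: sum_distrib_right[symmetric] one' mult_1)
    have "norm (of_real t * u) < \<rho>" using t W u r by (auto simp: norm_mult)
    then have "\<Phi> (of_real t * u) = exp (g (of_real t * u))" using Phi_exp by simp
    then show ?thesis by (simp add: 1 2 3 exp_minus)
  qed
  then have "(\<Sum>t\<in>W. ?lhs t) = (\<Sum>t\<in>W. b t * exp (of_real t * u * z))" by (rule sum.cong[OF refl])
  then show ?thesis
    unfolding pure_def sum.reindex[OF inj] o_def exp_sum_def W_def[symmetric] .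
qed

text \<open>Let \<open>S\<close> be the slots filled from the perturbation. If \<open>S\<close> is empty, the total frequency lies on the \<open>v\<close>-ray, where
  \<open>|\<Phi>| < 1\<close>. Otherwise it is close to the barycentre of the points \<open>t\<close> on the \<open>u\<close>-ray, and the strict Jensen
  inequality applies: for an impure choice the weights on \<open>S\<close> sum to less than 1 or the points differ.\<close>

lemma all_ratio_freq_less:
  assumes D: "finite D" "D \<noteq> {}" and le1: "(\<Sum>p\<in>D. \<theta> (fst p)) \<le> 1"
    and h: "h \<in> choices D" and impure: "(\<Sum>p\<in>D. \<theta> (fst p)) < 1 \<or> h \<notin> pure D"
    and d: "card D * \<delta> \<le> d" "card D * \<delta> \<le> r'"
    and radius: "\<And>S t y. S \<subseteq> D \<Longrightarrow> t \<in> PiE S (\<lambda>_. W) \<Longrightarrow> norm (y::complex) < d \<Longrightarrow>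
      0 < (\<Sum>p\<in>S. \<theta> (fst p) * t p) \<Longrightarrow> (\<Sum>p\<in>S. \<theta> (fst p) * t p) < r \<Longrightarrow>
      lv (\<Sum>p\<in>S. \<theta> (fst p) * t p) < (\<Sum>p\<in>S. \<theta> (fst p) * lv (t p)) \<Longrightarrow>
      norm (\<Phi> (of_real (\<Sum>p\<in>S. \<theta> (fst p) * t p) * u + y)) < exp (\<Sum>p\<in>S. \<theta> (fst p) * lv (t p))"
  shows "norm (all_ratio D h * \<Phi> (all_freq D h)) < 1"
proof -
  define S where "S = {p \<in> D. \<exists>t. h p = Inr t}"
  define S' where "S' = D - S"
  have S: "S \<subseteq> D" "finite S" "finite S'" "D = S \<union> S'" "S \<inter> S' = {}"
    using D by (auto simp: S_def S'_def)
  have hp: "h p \<in> freqs (fst p)" if "p \<in> D" for p using h that by (auto simp: choices_def)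
  define t where "t = restrict (\<lambda>p. projr (h p)) S"
  have t: "h p = Inr (t p)" "t p \<in> W" if "p \<in> S" for p
    using that hp[of p] by (auto simp: S_def t_def freqs_def)
  define s where "s p = projl (h p)" for p
  have s: "h p = Inl (s p)" "0 < s p" "s p < \<delta>" if "p \<in> S'" for p
    using that hp[of p] a(2)[of "fst p"] by (auto simp: S'_def S_def s_def freqs_def)
  define y where "y = (\<Sum>p\<in>S'. s p)"
  define x where "x = (\<Sum>p\<in>S. \<theta> (fst p) * t p)"
  \<comment> \<open>the total frequency splits into a point of the \<open>u\<close>-ray and a small displacement along \<open>v\<close>\<close>
  have freq: "all_freq D h = of_real x * u + of_real y * v"
    unfolding all_freq_def S(4) sum.union_disjoint[OF S(2,3,5)] x_def y_def
    by (simp add: t s sum_distrib_right of_real_sum)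
  have ratio: "norm (all_ratio D h) = exp (- (\<Sum>p\<in>S. \<theta> (fst p) * lv (t p)))"
    unfolding all_ratio_def S(4) prod.union_disjoint[OF S(2,3,5)]
    by (simp add: t s prod_norm[symmetric] exp_sum S sum_negf[symmetric] lv_def)
  have y_less: "y < card D * \<delta>" "0 < y" if "S' \<noteq> {}"
  proof -
    have "y < (\<Sum>p\<in>S'. \<delta>)" unfolding y_def using s that S by (intro sum_strict_mono) auto
    also have "\<dots> = card S' * \<delta>" by simp
    also have "\<dots> \<le> card D * \<delta>"
    proof (intro mult_right_mono)
      show "real (card S') \<le> real (card D)" using D by (simp add: S'_def card_mono)
      show "0 \<le> \<delta>" using s that by fastforce
    qed
    finally show "y < card D * \<delta>" .
    show "0 < y" unfolding y_def using s that S by (intro sum_pos) auto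
  qed
  show ?thesis
  proof (cases "S = {}")
    case True
    then have "S' \<noteq> {}" using S D by auto
    then have "norm (\<Phi> (of_real y * v)) < 1" using norm_Phi_v y_less d by simp
    moreover have "norm (all_ratio D h) = 1" unfolding ratio True by simp
    moreover have "all_freq D h = of_real y * v" unfolding freq x_def True by simp
    ultimately show ?thesis by (simp add: norm_mult)
  next
    case False
    have tW: "t \<in> PiE S (\<lambda>_. W)" using t by (auto simp: t_def)
    have sumS: "(\<Sum>p\<in>S. \<theta> (fst p)) \<le> (\<Sum>p\<in>D. \<theta> (fst p))"
      using S D theta_pos by (intro sum_mono2) (auto simp: less_imp_le)
    have "(\<Sum>p\<in>S. \<theta> (fst p)) < 1 \<or> (\<exists>p\<in>S. \<exists>q\<in>S. t p \<noteq> t q)"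
    proof (rule ccontr)
      assume "\<not> ?thesis"
      then have *: "1 \<le> (\<Sum>p\<in>S. \<theta> (fst p))" "\<And>p q. p \<in> S \<Longrightarrow> q \<in> S \<Longrightarrow> t p = t q"
        unfolding de_Morgan_disj not_less by blast+
      have "S' = {}"
      proof (rule ccontr)
        assume "S' \<noteq> {}"
        then have "0 < (\<Sum>p\<in>S'. \<theta> (fst p))" using S theta_pos by (intro sum_pos) auto
        moreover have "(\<Sum>p\<in>D. \<theta> (fst p)) = (\<Sum>p\<in>S. \<theta> (fst p)) + (\<Sum>p\<in>S'. \<theta> (fst p))"
          unfolding S(4) using S by (intro sum.union_disjoint) auto
        ultimately show False using * le1 by simp
      qed
      then have SD: "S = D" using S by simp
      obtain p0 where p0: "p0 \<in> S" using False by blast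
      have "h = restrict (\<lambda>p. Inr (t p0)) D"
      proof
        fix p show "h p = restrict (\<lambda>p. Inr (t p0)) D p"
        proof (cases "p \<in> D")
          case True
          then show ?thesis using t(1)[of p] *(2)[of p p0] p0 SD by simp
        next
          case False
          then show ?thesis using PiE_arb[OF h[unfolded choices_def]] by simp
        qed
      qed
      then have "h \<in> pure D" using t(2)[OF p0] by (auto simp: pure_def)
      moreover have "\<not> (\<Sum>p\<in>D. \<theta> (fst p)) < 1" using *(1) SD by simp
      ultimately show False using impure by blast
    qed
    note distinct_or_less = this
    have t0: "0 < t p \<and> t p < r" if "p \<in> S" for p using t(2)[OF that] W(2) by auto
    note J = jensen_strict[OF S(2) False theta_pos order.trans[OF sumS le1] t0 distinct_or_less, folded x_def]
    have "norm (of_real y * v) < d \<or> S' = {}"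
      using y_less d v by (cases "S' = {}") (simp_all add: norm_mult)
    then have "norm (\<Phi> (of_real x * u + of_real y * v)) < exp (\<Sum>p\<in>S. \<theta> (fst p) * lv (t p))"
    proof
      assume "norm (of_real y * v) < d"
      then show ?thesis using radius[OF S(1) tW, of "of_real y * v"] J unfolding x_def by simp
    next
      assume "S' = {}"
      then have "y = 0" by (simp add: y_def)
      then show ?thesis using norm_Phi_u J by simp
    qed
    then have "norm (all_ratio D h * \<Phi> (all_freq D h)) <
        exp (- (\<Sum>p\<in>S. \<theta> (fst p) * lv (t p))) * exp (\<Sum>p\<in>S. \<theta> (fst p) * lv (t p))"
      unfolding norm_mult ratio freq by (intro mult_strict_left_mono) auto
    then show ?thesis by (simp add: exp_minus)
  qed
qed

lemma small_terms:
  assumes X: "finite X" and less: "\<And>h. h \<in> X \<Longrightarrow> norm (all_ratio D h * \<Phi> (all_freq D h)) < 1" and e: "0 < e"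
  shows "\<forall>\<^sub>F N in sequentially. \<forall>z. norm z \<le> Rad \<longrightarrow>
    norm (\<Sum>h\<in>X. all_coef D h * (all_ratio D h * \<Phi> (all_freq D h)) ^ N * exp (all_freq D h * z)) < e"
proof -
  define B where "B N = (\<Sum>h\<in>X. norm (all_coef D h) * norm (all_ratio D h * \<Phi> (all_freq D h)) ^ N *
      exp (norm (all_freq D h) * Rad))" for N
  have "B \<longlonglongrightarrow> (\<Sum>h\<in>X. norm (all_coef D h) * 0 * exp (norm (all_freq D h) * Rad))"
    unfolding B_def by (intro tendsto_intros LIMSEQ_realpow_zero less) auto
  then have "B \<longlonglongrightarrow> 0" by simp
  then have "\<forall>\<^sub>F N in sequentially. B N < e" using e order_tendstoD(2) by blast
  then show ?thesis
  proof eventually_elim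
    case (elim N)
    have "norm (\<Sum>h\<in>X. all_coef D h * (all_ratio D h * \<Phi> (all_freq D h)) ^ N * exp (all_freq D h * z)) \<le> B N"
      if "norm z \<le> Rad" for z
      unfolding B_def
    proof (rule sum_norm_le)
      fix h
      have "norm (exp (all_freq D h * z)) \<le> exp (norm (all_freq D h) * Rad)"
        by (rule norm_exp_mult_le[OF that])
      then show "norm (all_coef D h * (all_ratio D h * \<Phi> (all_freq D h)) ^ N * exp (all_freq D h * z))
          \<le> norm (all_coef D h) * norm (all_ratio D h * \<Phi> (all_freq D h)) ^ N * exp (norm (all_freq D h) * Rad)"
        unfolding norm_mult[of _ "exp _"] norm_mult[of "all_coef _ _"] norm_power
        by (intro mult_left_mono) auto
    qed
    then show ?case using elim by force
  qed
qed

end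

context convex_ray
begin

text \<open>The order of the choices matters: weights, then the target's frequencies on the \<open>u\<close>-ray, then the length
  \<open>\<delta>\<close> of the piece of the \<open>v\<close>-ray, then the approximation of \<open>f0\<close> by frequencies below \<open>\<delta>\<close>, and finally \<open>N\<close>.\<close>

theorem simultaneous_approximation:
  assumes A: "finite A" "A \<noteq> {}" "0 \<notin> A"
  shows "\<exists>\<beta>\<in>A. \<forall>f0 G V Rad e. (\<forall>i. f0 i \<in> entire) \<longrightarrow> G \<in> entire \<longrightarrow> finite V \<longrightarrow> 0 < e \<longrightarrow>
    (\<exists>f N. (\<forall>i. f i \<in> entire) \<and> (\<forall>i\<in>V. \<forall>z. norm z \<le> Rad \<longrightarrow> norm (f i z - f0 i z) < e) \<and>
      (\<forall>z. norm z \<le> Rad \<longrightarrow> norm ((T ^^ N) (mono_eval \<beta> f) z - G z) < e) \<and>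
      (\<forall>\<alpha>\<in>A - {\<beta>}. \<forall>z. norm z \<le> Rad \<longrightarrow> norm ((T ^^ N) (mono_eval \<alpha> f) z) < e))"
proof (rule separating_weights[OF A])
  fix \<theta> :: "nat \<Rightarrow> real" and \<beta> assume \<beta>: "\<beta> \<in> A" and theta: "\<And>i. 0 < \<theta> i" "(\<Sum>p\<in>slots \<beta>. \<theta> (fst p)) = 1"
    "\<And>\<alpha>. \<alpha> \<in> A \<Longrightarrow> \<alpha> \<noteq> \<beta> \<Longrightarrow> (\<Sum>p\<in>slots \<alpha>. \<theta> (fst p)) < 1"
  show ?thesis
  proof (intro bexI[OF _ \<beta>] allI impI)
    fix f0 :: "nat \<Rightarrow> complex \<Rightarrow> complex" and G and V :: "nat set" and Rad e :: real
    assume f0: "\<forall>i. f0 i \<in> entire" and G: "G \<in> entire" and V: "finite V" and e: "0 < e"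
    have e2: "0 < e / 2" using e by simp
    have uv: "u \<noteq> 0" "v \<noteq> 0" using u v by auto
    obtain b where target: "finite {t. b t \<noteq> 0}" "{t. b t \<noteq> 0} \<subseteq> {0<..<r}"
      "\<And>z. norm z \<le> Rad \<Longrightarrow> norm (exp_sum u b z - G z) < e / 2"
      using exp_span_dense[OF uv(1) r(1) G e2, of Rad] by blast
    obtain d where d: "d > 0" and radius: "\<forall>D\<in>slots ` A. \<forall>S\<subseteq>D. \<forall>t\<in>PiE S (\<lambda>_. {t. b t \<noteq> 0}). \<forall>y. norm y < d \<longrightarrow>
      0 < (\<Sum>p\<in>S. \<theta> (fst p) * t p) \<longrightarrow> (\<Sum>p\<in>S. \<theta> (fst p) * t p) < r \<longrightarrow>
      lv (\<Sum>p\<in>S. \<theta> (fst p) * t p) < (\<Sum>p\<in>S. \<theta> (fst p) * lv (t p)) \<longrightarrow>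
      norm (\<Phi> (of_real (\<Sum>p\<in>S. \<theta> (fst p) * t p) * u + y)) < exp (\<Sum>p\<in>S. \<theta> (fst p) * lv (t p))"
      using small_radius[OF finite_imageI[OF A(1)] _ target(1,2), of slots \<theta>] finite_slots by blast
    \<comment> \<open>at most \<open>M\<close> frequencies on the \<open>v\<close>-ray are added up, each below \<open>\<delta>\<close>; the sum stays below \<open>d\<close> and \<open>r'\<close>\<close>
    define M where "M = 1 + (\<Sum>\<alpha>\<in>A. real (card (slots \<alpha>)))"
    define \<delta> where "\<delta> = min d r' / M"
    have M: "1 \<le> M" by (simp add: M_def sum_nonneg)
    have \<delta>: "0 < \<delta>" using M d r' by (simp add: \<delta>_def)
    have card_le: "card (slots \<alpha>) * \<delta> \<le> d" "card (slots \<alpha>) * \<delta> \<le> r'" if "\<alpha> \<in> A" for \<alpha>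
    proof -
      have "real (card (slots \<alpha>)) \<le> (\<Sum>\<alpha>\<in>A. real (card (slots \<alpha>)))"
        using that A(1) by (intro member_le_sum) auto
      then have "card (slots \<alpha>) * \<delta> \<le> M * \<delta>" using \<delta> by (intro mult_right_mono) (auto simp: M_def)
      also have "\<dots> = min d r'" using M by (simp add: \<delta>_def)
      finally show "card (slots \<alpha>) * \<delta> \<le> d" "card (slots \<alpha>) * \<delta> \<le> r'" by auto
    qed
    have "\<forall>i. \<exists>a. finite {t. a t \<noteq> 0} \<and> {t. a t \<noteq> 0} \<subseteq> {0<..<\<delta>} \<and>
      (\<forall>z. norm z \<le> Rad \<longrightarrow> norm (exp_sum v a z - f0 i z) < e / 2)"
      using exp_span_dense[OF uv(2) \<delta> _ e2] f0 by simp
    from choice[OF this] obtain a where approx: "\<And>i. finite {t. a i t \<noteq> 0}" "\<And>i. {t. a i t \<noteq> 0} \<subseteq> {0<..<\<delta>}"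
      "\<And>i z. norm z \<le> Rad \<Longrightarrow> norm (exp_sum v (a i) z - f0 i z) < e / 2" by blast
    interpret perturbation \<Phi> K R g \<rho> u v r r' \<theta> a b \<delta>
      by unfold_locales (use theta approx target in auto)
    have less: "norm (all_ratio (slots \<alpha>) h * \<Phi> (all_freq (slots \<alpha>) h)) < 1"
      if \<alpha>: "\<alpha> \<in> A" and h: "h \<in> choices (slots \<alpha>)" and imp: "\<alpha> \<noteq> \<beta> \<or> h \<notin> pure (slots \<alpha>)" for \<alpha> h
    proof (rule all_ratio_freq_less[OF finite_slots _ _ h _ card_le[OF \<alpha>]])
      show "slots \<alpha> \<noteq> {}" using slots_nonempty \<alpha> A(3) by metis
      show "(\<Sum>p\<in>slots \<alpha>. \<theta> (fst p)) \<le> 1"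
        using theta(2) theta(3)[OF \<alpha>] by (cases "\<alpha> = \<beta>") auto
      show "(\<Sum>p\<in>slots \<alpha>. \<theta> (fst p)) < 1 \<or> h \<notin> pure (slots \<alpha>)" using theta(3)[OF \<alpha>] imp by blast
    qed (use radius \<alpha> in \<open>auto simp: W_def\<close>)
    have "\<forall>\<^sub>F N in sequentially. \<forall>i\<in>V. \<forall>z. norm z \<le> Rad \<longrightarrow> norm (F N i z - exp_sum v (a i) z) < e / 2"
      by (rule F_close[OF V e2])
    moreover have "\<forall>\<^sub>F N in sequentially. \<forall>z. norm z \<le> Rad \<longrightarrow>
        norm ((T ^^ N) (mono_eval \<beta> (F N)) z - exp_sum u b z) < e / 2"
    proof -
      have X: "finite (choices (slots \<beta>) - pure (slots \<beta>))" by (simp add: finite_choices finite_slots)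
      have "(T ^^ N) (mono_eval \<beta> (F N)) z - exp_sum u b z = (\<Sum>h\<in>choices (slots \<beta>) - pure (slots \<beta>).
          all_coef (slots \<beta>) h * (all_ratio (slots \<beta>) h * \<Phi> (all_freq (slots \<beta>) h)) ^ N * exp (all_freq (slots \<beta>) h * z))" for N z
      proof -
        have ne: "slots \<beta> \<noteq> {}" using slots_nonempty \<beta> A(3) by metis
        show ?thesis
          unfolding Tn_mono sum.subset_diff[OF pure_subset finite_choices[OF finite_slots]]
            pure_sum[OF finite_slots ne theta(2)] by simp
      qed
      then show ?thesis using small_terms[OF X _ e2, of "slots \<beta>" Rad] less[OF \<beta>] by simp
    qed
    moreover have "\<forall>\<^sub>F N in sequentially. \<forall>\<alpha>\<in>A - {\<beta>}. \<forall>z. norm z \<le> Rad \<longrightarrow> norm ((T ^^ N) (mono_eval \<alpha> (F N)) z) < e"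
    proof (rule eventually_ball_finite, use A(1) in simp, rule ballI)
      fix \<alpha> assume \<alpha>: "\<alpha> \<in> A - {\<beta>}"
      show "\<forall>\<^sub>F N in sequentially. \<forall>z. norm z \<le> Rad \<longrightarrow> norm ((T ^^ N) (mono_eval \<alpha> (F N)) z) < e"
        unfolding Tn_mono
        by (rule small_terms[OF finite_choices[OF finite_slots] _ e]) (use less[of \<alpha>] \<alpha> in blast)
    qed
    ultimately have "\<forall>\<^sub>F N in sequentially.
      (\<forall>i\<in>V. \<forall>z. norm z \<le> Rad \<longrightarrow> norm (F N i z - exp_sum v (a i) z) < e / 2) \<and>
      (\<forall>z. norm z \<le> Rad \<longrightarrow> norm ((T ^^ N) (mono_eval \<beta> (F N)) z - exp_sum u b z) < e / 2) \<and>
      (\<forall>\<alpha>\<in>A - {\<beta>}. \<forall>z. norm z \<le> Rad \<longrightarrow> norm ((T ^^ N) (mono_eval \<alpha> (F N)) z) < e)"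
      by eventually_elim blast
    from eventually_happens'[OF sequentially_bot this] obtain N where
        N1: "\<forall>i\<in>V. \<forall>z. norm z \<le> Rad \<longrightarrow> norm (F N i z - exp_sum v (a i) z) < e / 2"
      and N2: "\<forall>z. norm z \<le> Rad \<longrightarrow> norm ((T ^^ N) (mono_eval \<beta> (F N)) z - exp_sum u b z) < e / 2"
      and N3: "\<forall>\<alpha>\<in>A - {\<beta>}. \<forall>z. norm z \<le> Rad \<longrightarrow> norm ((T ^^ N) (mono_eval \<alpha> (F N)) z) < e"
      by (elim exE conjE)
    have tri: "norm (x - z) < e" if "norm (x - y) < e / 2" "norm (y - z) < e / 2" for x y z :: complex
      using norm_triangle_ineq[of "x - y" "y - z"] that by simp
    show "\<exists>f N. (\<forall>i. f i \<in> entire) \<and> (\<forall>i\<in>V. \<forall>z. norm z \<le> Rad \<longrightarrow> norm (f i z - f0 i z) < e) \<and>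
      (\<forall>z. norm z \<le> Rad \<longrightarrow> norm ((T ^^ N) (mono_eval \<beta> f) z - G z) < e) \<and>
      (\<forall>\<alpha>\<in>A - {\<beta>}. \<forall>z. norm z \<le> Rad \<longrightarrow> norm ((T ^^ N) (mono_eval \<alpha> f) z) < e)"
    proof (intro exI[of _ "F N"] exI[of _ N] conjI allI ballI impI)
      show "F N i \<in> entire" for i by (rule F_entire)
      show "norm (F N i z - f0 i z) < e" if "i \<in> V" "norm z \<le> Rad" for i z
        by (rule tri[OF N1[rule_format, OF that] approx(3)[OF that(2)]])
      show "norm ((T ^^ N) (mono_eval \<beta> (F N)) z - G z) < e" if "norm z \<le> Rad" for z
        by (rule tri[OF N2[rule_format, OF that] target(3)[OF that]])
    qed (use N3 in blast)
  qed
qed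

end

section \<open>The algebra generated by a sequence\<close>

lemma eval_cpoly_superset:
  assumes "finite M" "Poly_Mapping.keys P \<subseteq> M"
  shows "eval_cpoly P f z = (\<Sum>m\<in>M. Poly_Mapping.lookup P m * mono_eval m f z)"
  unfolding eval_cpoly_def mono_eval_def[symmetric]
  by (rule sum.mono_neutral_left) (use assms in \<open>auto simp: in_keys_iff\<close>)

lemma eval_cpoly_add: "eval_cpoly (P + Q) f z = eval_cpoly P f z + eval_cpoly Q f z"
proof -
  define M where "M = Poly_Mapping.keys P \<union> Poly_Mapping.keys Q"
  have M: "finite M" "Poly_Mapping.keys P \<subseteq> M" "Poly_Mapping.keys Q \<subseteq> M" "Poly_Mapping.keys (P + Q) \<subseteq> M"
    using Poly_Mapping.keys_add[of P Q] by (auto simp: M_def)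
  show ?thesis
    by (simp add: eval_cpoly_superset[OF M(1)] M lookup_add distrib_right sum.distrib)
qed

lemma eval_cpoly_single: "eval_cpoly (Poly_Mapping.single m c) f z = c * mono_eval m f z"
  by (subst eval_cpoly_superset[of "{m}"]) auto

lemma eval_cpoly_zero: "eval_cpoly 0 f z = 0"
  by (simp add: eval_cpoly_def)

lemma polys_without_const_add:
  assumes "P \<in> polys_without_const k" "Q \<in> polys_without_const k"
  shows "P + Q \<in> polys_without_const k"
  using assms Poly_Mapping.keys_add[of P Q] by (auto simp: polys_without_const_def lookup_add)

lemma polys_without_const_single:
  assumes "m \<noteq> 0" "Poly_Mapping.keys m \<subseteq> {..<k}"
  shows "Poly_Mapping.single m c \<in> polys_without_const k"
  using assms by (auto simp: polys_without_const_def lookup_single)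

lemma polys_without_const_mono: "k \<le> l \<Longrightarrow> polys_without_const k \<subseteq> polys_without_const l"
  by (force simp: polys_without_const_def)

text \<open>Allowing repeated monomials in the sum spares computing the coefficients of a product of polynomials when
  closure under multiplication is proved.\<close>

lemma sum_in_generated_algebra:
  assumes "finite J" "\<And>j. j \<in> J \<Longrightarrow> m j \<noteq> 0" "\<And>j. j \<in> J \<Longrightarrow> Poly_Mapping.keys (m j) \<subseteq> {..<k}"
  shows "(\<lambda>z. \<Sum>j\<in>J. c j * mono_eval (m j) f z) \<in> generated_algebra f"
proof -
  have "\<exists>P\<in>polys_without_const k. eval_cpoly P f = (\<lambda>z. \<Sum>j\<in>J. c j * mono_eval (m j) f z)"
    using assms
  proof (induction J)
    case empty
    have "0 \<in> polys_without_const k" by (simp add: polys_without_const_def)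
    then show ?case by (intro bexI[of _ 0]) (auto simp: eval_cpoly_zero)
  next
    case (insert j J)
    then obtain P where P: "P \<in> polys_without_const k" "eval_cpoly P f = (\<lambda>z. \<Sum>j\<in>J. c j * mono_eval (m j) f z)"
      by auto
    have "Poly_Mapping.single (m j) (c j) \<in> polys_without_const k"
      using insert by (intro polys_without_const_single) auto
    then show ?case using insert P
      by (intro bexI[of _ "Poly_Mapping.single (m j) (c j) + P"] polys_without_const_add)
        (auto simp: eval_cpoly_add eval_cpoly_single)
  qed
  then show ?thesis unfolding generated_algebra_def by force
qed

lemma mono_eval_superset:
  assumes "finite I" "Poly_Mapping.keys m \<subseteq> I"
  shows "mono_eval m f z = (\<Prod>i\<in>I. f i z ^ Poly_Mapping.lookup m i)"
  unfolding mono_eval_def by (rule prod.mono_neutral_left) (use assms in \<open>auto simp: in_keys_iff\<close>)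

lemma mono_eval_add: "mono_eval (m + n) f z = mono_eval m f z * mono_eval n f z"
proof -
  define I where "I = Poly_Mapping.keys m \<union> Poly_Mapping.keys n"
  have I: "finite I" "Poly_Mapping.keys m \<subseteq> I" "Poly_Mapping.keys n \<subseteq> I" "Poly_Mapping.keys (m + n) \<subseteq> I"
    using Poly_Mapping.keys_add[of m n] by (auto simp: I_def)
  show ?thesis
    by (simp add: mono_eval_superset[OF I(1)] I lookup_add power_add prod.distrib)
qed

lemma exponents_add_eq_0: "m + n = (0 :: nat \<Rightarrow>\<^sub>0 nat) \<Longrightarrow> m = 0"
  by (rule poly_mapping_eqI) (metis add_eq_0_iff_both_eq_0 lookup_add lookup_zero)

lemma polys_without_const_keys:
  assumes "P \<in> polys_without_const k" "m \<in> Poly_Mapping.keys P"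
  shows "m \<noteq> 0" "Poly_Mapping.keys m \<subseteq> {..<k}"
  using assms by (auto simp: polys_without_const_def in_keys_iff)

lemma eval_cpoly_mono_eval: "eval_cpoly P f z = (\<Sum>m\<in>Poly_Mapping.keys P. Poly_Mapping.lookup P m * mono_eval m f z)"
  by (simp add: eval_cpoly_def mono_eval_def)

lemma eval_cpoly_entire:
  assumes "\<And>i. f i \<in> entire" shows "eval_cpoly P f \<in> entire"
proof -
  have "(\<lambda>z. eval_cpoly P f z) \<in> entire"
    unfolding eval_cpoly_mono_eval by (intro entire_sum entire_cmult mono_eval_entire assms)
  then show ?thesis by simp
qed

lemma generated_subalgebra:
  assumes f: "\<And>i. f i \<in> entire"
  shows "entire_subalgebra (generated_algebra f)"
  unfolding entire_subalgebra_def
proof (intro conjI ballI allI)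
  show "generated_algebra f \<subseteq> entire" using eval_cpoly_entire[OF f] by (auto simp: generated_algebra_def)
  show "(\<lambda>_. 0) \<in> generated_algebra f" using sum_in_generated_algebra[of "{}" _ 0 _ f] by simp
next
  fix F G assume "F \<in> generated_algebra f" "G \<in> generated_algebra f"
  then obtain P Q k l where PQ: "F = eval_cpoly P f" "P \<in> polys_without_const k" "G = eval_cpoly Q f" "Q \<in> polys_without_const l"
    by (auto simp: generated_algebra_def)
  define n where "n = max k l"
  have P: "P \<in> polys_without_const n" and Q: "Q \<in> polys_without_const n"
    using PQ polys_without_const_mono[of k n] polys_without_const_mono[of l n] by (auto simp: n_def)
  have "eval_cpoly (P + Q) f \<in> generated_algebra f"
    using polys_without_const_add[OF P Q] by (auto simp: generated_algebra_def)
  moreover have "eval_cpoly (P + Q) f = (\<lambda>z. F z + G z)" by (rule ext) (simp add: PQ eval_cpoly_add)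
  ultimately show "(\<lambda>z. F z + G z) \<in> generated_algebra f" by simp
  have "(\<lambda>z. \<Sum>x\<in>Poly_Mapping.keys P \<times> Poly_Mapping.keys Q.
      (Poly_Mapping.lookup P (fst x) * Poly_Mapping.lookup Q (snd x)) * mono_eval (fst x + snd x) f z) \<in> generated_algebra f"
  proof (rule sum_in_generated_algebra[where k = n])
    fix x assume x: "x \<in> Poly_Mapping.keys P \<times> Poly_Mapping.keys Q"
    show "fst x + snd x \<noteq> 0" using x polys_without_const_keys[OF P] exponents_add_eq_0 by force
    show "Poly_Mapping.keys (fst x + snd x) \<subseteq> {..<n}"
      by (rule order.trans[OF Poly_Mapping.keys_add Un_least])
        (rule polys_without_const_keys(2)[OF P] polys_without_const_keys(2)[OF Q], use x in force)+
  qed simp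
  moreover have "(\<lambda>z. \<Sum>x\<in>Poly_Mapping.keys P \<times> Poly_Mapping.keys Q.
      (Poly_Mapping.lookup P (fst x) * Poly_Mapping.lookup Q (snd x)) * mono_eval (fst x + snd x) f z) = (\<lambda>z. F z * G z)"
    by (rule ext) (simp add: PQ eval_cpoly_mono_eval sum_product sum.cartesian_product mono_eval_add
        case_prod_beta mult_ac)
  ultimately show "(\<lambda>z. F z * G z) \<in> generated_algebra f" by simp
next
  fix c F assume "F \<in> generated_algebra f"
  then obtain P k where P: "F = eval_cpoly P f" "P \<in> polys_without_const k"
    by (auto simp: generated_algebra_def)
  have "(\<lambda>z. \<Sum>m\<in>Poly_Mapping.keys P. (c * Poly_Mapping.lookup P m) * mono_eval m f z) \<in> generated_algebra f"
    by (rule sum_in_generated_algebra[where k = k]) (use polys_without_const_keys[OF P(2)] in auto)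
  moreover have "(\<lambda>z. \<Sum>m\<in>Poly_Mapping.keys P. (c * Poly_Mapping.lookup P m) * mono_eval m f z) = (\<lambda>z. c * F z)"
    by (rule ext) (simp add: P eval_cpoly_mono_eval sum_distrib_left mult.assoc)
  ultimately show "(\<lambda>z. c * F z) \<in> generated_algebra f" by simp
qed

lemma generator_in_generated_algebra: "f i \<in> generated_algebra f"
proof -
  define m :: "nat \<Rightarrow>\<^sub>0 nat" where "m = Poly_Mapping.single i 1"
  have m: "m \<noteq> 0" "Poly_Mapping.keys m = {i}" "Poly_Mapping.lookup m i = 1"
  proof -
    show "Poly_Mapping.keys m = {i}" "Poly_Mapping.lookup m i = 1" by (simp_all add: m_def)
    then show "m \<noteq> 0" by (metis lookup_zero zero_neq_one)
  qed
  have "(\<lambda>z. \<Sum>j\<in>{m}. 1 * mono_eval j f z) \<in> generated_algebra f"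
    by (rule sum_in_generated_algebra[where k = "Suc i"]) (use m in auto)
  then show ?thesis using m by (simp add: mono_eval_def)
qed

lemma countable_monomials: "countable (UNIV :: (nat \<Rightarrow>\<^sub>0 nat) set)"
proof -
  define G where "G m = (\<lambda>i. (i, Poly_Mapping.lookup m i)) ` Poly_Mapping.keys m" for m :: "nat \<Rightarrow>\<^sub>0 nat"
  have "inj G"
  proof (rule injI)
    fix m n :: "nat \<Rightarrow>\<^sub>0 nat" assume eq: "G m = G n"
    have G: "(i, x) \<in> G k \<longleftrightarrow> Poly_Mapping.lookup k i = x \<and> x \<noteq> 0" for i x k by (auto simp: G_def in_keys_iff)
    show "m = n"
    proof (rule poly_mapping_eqI)
      fix i show "Poly_Mapping.lookup m i = Poly_Mapping.lookup n i"
        using G[of i "Poly_Mapping.lookup m i" m] G[of i "Poly_Mapping.lookup m i" n]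
          G[of i "Poly_Mapping.lookup n i" n] G[of i "Poly_Mapping.lookup n i" m] eq by metis
    qed
  qed
  moreover have "countable (range G)"
    by (rule countable_subset[OF _ countable_Collect_finite]) (auto simp: G_def)
  ultimately show ?thesis using countable_image_inj_on by blast
qed

section \<open>Continuity of monomials and iterates\<close>

lemma openin_unif_nbhd:
  assumes G: "G \<in> entire" shows "openin entire_topology (unif_nbhd G R e)"
  unfolding openin_entire_iff
proof (intro conjI ballI)
  show "unif_nbhd G R e \<subseteq> entire" by (auto simp: unif_nbhd_def)
  fix f assume f: "f \<in> unif_nbhd G R e"
  then have fe: "f \<in> entire" by (simp add: unif_nbhd_def)
  show "\<exists>R' e'. 0 < e' \<and> unif_nbhd f R' e' \<subseteq> unif_nbhd G R e"
  proof (cases "0 \<le> R")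
    case False
    have "norm z > R" for z :: complex using False norm_ge_zero[of z] by linarith
    then have "unif_nbhd f R 1 \<subseteq> unif_nbhd G R e" by (auto simp: unif_nbhd_def not_le[symmetric])
    then show ?thesis using zero_less_one by blast
  next
    case True
    have "continuous_on (cball 0 R) (\<lambda>z. norm (f z - G z))"
      by (intro continuous_intros entire_continuous_on fe G)
    moreover have "cball (0::complex) R \<noteq> {}" using True by simp
    ultimately obtain x where x: "x \<in> cball 0 R" "\<And>z. z \<in> cball 0 R \<Longrightarrow> norm (f z - G z) \<le> norm (f x - G x)"
      using continuous_attains_sup[OF compact_cball, of 0 R "\<lambda>z. norm (f z - G z)"] by auto
    define e' where "e' = e - norm (f x - G x)"
    have "0 < e'" using f x by (simp add: e'_def unif_nbhd_def)
    moreover have "unif_nbhd f R e' \<subseteq> unif_nbhd G R e"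
    proof
      fix h assume h: "h \<in> unif_nbhd f R e'"
      have "norm (h z - G z) < e" if "norm z \<le> R" for z
      proof -
        have "norm (h z - f z) < e'" using h that by (simp add: unif_nbhd_def)
        moreover have "norm (f z - G z) \<le> norm (f x - G x)" using x(2) that by simp
        ultimately show ?thesis using norm_triangle_ineq[of "h z - f z" "f z - G z"] by (simp add: e'_def)
      qed
      then show "h \<in> unif_nbhd G R e" using h by (simp add: unif_nbhd_def)
    qed
    ultimately show ?thesis by blast
  qed
qed

lemma continuous_map_entire_iff:
  "continuous_map X entire_topology \<Psi> \<longleftrightarrow> (\<forall>x\<in>topspace X. \<Psi> x \<in> entire \<and>
     (\<forall>R e. 0 < e \<longrightarrow> (\<exists>W. openin X W \<and> x \<in> W \<and> (\<forall>y\<in>W. \<Psi> y \<in> unif_nbhd (\<Psi> x) R e))))" (is "?L \<longleftrightarrow> ?R")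
proof
  assume L: ?L
  show ?R
  proof (intro ballI conjI allI impI)
    fix x assume x: "x \<in> topspace X"
    then show px: "\<Psi> x \<in> entire" using continuous_map_image_subset_topspace[OF L] by auto
    fix R and e :: real assume "0 < e"
    show "\<exists>W. openin X W \<and> x \<in> W \<and> (\<forall>y\<in>W. \<Psi> y \<in> unif_nbhd (\<Psi> x) R e)"
    proof (intro exI conjI ballI)
      show "openin X {y \<in> topspace X. \<Psi> y \<in> unif_nbhd (\<Psi> x) R e}"
        by (rule openin_continuous_map_preimage[OF L openin_unif_nbhd[OF px]])
    qed (use x px \<open>0 < e\<close> unif_nbhd_self in auto)
  qed
next
  assume R: ?R
  show ?L
    unfolding continuous_map_def
  proof (intro conjI allI impI)
    show "\<Psi> \<in> topspace X \<rightarrow> topspace entire_topology" using R by auto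
    fix U assume U: "openin entire_topology U"
    show "openin X {x \<in> topspace X. \<Psi> x \<in> U}"
    proof (subst openin_subopen, intro ballI)
      fix x assume x: "x \<in> {x \<in> topspace X. \<Psi> x \<in> U}"
      then obtain Rad e where e: "0 < e" "unif_nbhd (\<Psi> x) Rad e \<subseteq> U" using U by (auto simp: openin_entire_iff)
      have "\<exists>W. openin X W \<and> x \<in> W \<and> (\<forall>y\<in>W. \<Psi> y \<in> unif_nbhd (\<Psi> x) Rad e)" using R x e(1) by simp
      then obtain W where "openin X W" "x \<in> W" "\<forall>y\<in>W. \<Psi> y \<in> unif_nbhd (\<Psi> x) Rad e" by (elim exE conjE)
      then show "\<exists>T. openin X T \<and> x \<in> T \<and> T \<subseteq> {x \<in> topspace X. \<Psi> x \<in> U}"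
        using e openin_subset[of X W] by (intro exI[of _ W]) auto
    qed
  qed
qed

lemma continuous_map_entireD:
  assumes "continuous_map X entire_topology \<Psi>" "x \<in> topspace X" "0 < e"
  shows "\<exists>W. openin X W \<and> x \<in> W \<and> (\<forall>y\<in>W. \<Psi> y \<in> unif_nbhd (\<Psi> x) R e)"
  using assms unfolding continuous_map_entire_iff by simp

text \<open>Locally uniform convergence is compatible with products because entire functions are bounded on discs.\<close>

lemma continuous_map_entire_mult:
  assumes F: "continuous_map X entire_topology F" and G: "continuous_map X entire_topology G"
  shows "continuous_map X entire_topology (\<lambda>x z. F x z * G x z)"
  unfolding continuous_map_entire_iff
proof (intro ballI conjI allI impI)
  fix x assume x: "x \<in> topspace X"
  have ent: "F x \<in> entire" "G x \<in> entire" using F G x by (auto simp: continuous_map_entire_iff)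
  show "(\<lambda>z. F x z * G x z) \<in> entire" by (intro entire_mult ent)
  fix R and e :: real assume e: "0 < e"
  obtain M1 where M1: "\<And>z. norm z \<le> R \<Longrightarrow> norm (F x z) \<le> M1" using entire_bounded_on_disc[OF ent(1)] by blast
  obtain M2 where M2: "\<And>z. norm z \<le> R \<Longrightarrow> norm (G x z) \<le> M2" using entire_bounded_on_disc[OF ent(2)] by blast
  define M where "M = 1 + \<bar>M1\<bar> + \<bar>M2\<bar>"
  define e' where "e' = min 1 (e / (2 * M))"
  have M: "1 \<le> M" by (simp add: M_def)
  have e': "0 < e'" "e' \<le> 1" "e' * (2 * M) \<le> e" using e M by (auto simp: e'_def min_def field_simps)
  obtain W1 where W1: "openin X W1" "x \<in> W1" "\<forall>y\<in>W1. F y \<in> unif_nbhd (F x) R e'"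
    using continuous_map_entireD[OF F x e'(1), of R] by (elim exE conjE)
  obtain W2 where W2: "openin X W2" "x \<in> W2" "\<forall>y\<in>W2. G y \<in> unif_nbhd (G x) R e'"
    using continuous_map_entireD[OF G x e'(1), of R] by (elim exE conjE)
  show "\<exists>W. openin X W \<and> x \<in> W \<and> (\<forall>y\<in>W. (\<lambda>z. F y z * G y z) \<in> unif_nbhd (\<lambda>z. F x z * G x z) R e)"
  proof (intro exI[of _ "W1 \<inter> W2"] conjI ballI)
    fix y assume y: "y \<in> W1 \<inter> W2"
    then have Fy: "F y \<in> unif_nbhd (F x) R e'" and Gy: "G y \<in> unif_nbhd (G x) R e'" using W1 W2 by auto
    have "norm (F y z * G y z - F x z * G x z) < e" if z: "norm z \<le> R" for z
    proof -
      have 1: "norm (F y z - F x z) < e'" "norm (G y z - G x z) < e'" using Fy Gy z by (auto simp: unif_nbhd_def)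
      have 2: "norm (F x z) \<le> \<bar>M1\<bar>" "norm (G x z) \<le> \<bar>M2\<bar>" using M1[OF z] M2[OF z] by auto
      have 3: "norm (G y z) \<le> \<bar>M2\<bar> + 1"
        using norm_triangle_ineq[of "G y z - G x z" "G x z"] 1 2 e' by simp
      have "F y z * G y z - F x z * G x z = (F y z - F x z) * G y z + F x z * (G y z - G x z)"
        by (simp add: algebra_simps)
      then have "norm (F y z * G y z - F x z * G x z) \<le>
          norm (F y z - F x z) * norm (G y z) + norm (F x z) * norm (G y z - G x z)"
        by (metis norm_mult norm_triangle_ineq)
      also have "\<dots> \<le> e' * (\<bar>M2\<bar> + 1) + \<bar>M1\<bar> * e'"
        using 1 2 3 e'(1) by (intro add_mono mult_mono) auto
      also have "\<dots> = e' * M" by (simp add: M_def algebra_simps)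
      also have "\<dots> < e' * (2 * M)" using e' M by simp
      finally show ?thesis using e' by simp
    qed
    then show "(\<lambda>z. F y z * G y z) \<in> unif_nbhd (\<lambda>z. F x z * G x z) R e"
      using Fy Gy by (simp add: unif_nbhd_def entire_mult)
  qed (use W1 W2 in auto)
qed

lemma continuous_map_entire_one: "continuous_map X entire_topology (\<lambda>x z. 1)"
  unfolding continuous_map_const topspace_entire_topology by (intro disjI2 entire_const)

lemma continuous_map_entire_power:
  assumes "continuous_map X entire_topology F"
  shows "continuous_map X entire_topology (\<lambda>x z. F x z ^ n)"
  by (induction n) (simp_all add: continuous_map_entire_one[simplified] continuous_map_entire_mult assms)

lemma continuous_map_entire_prod:
  assumes "finite J" "\<And>j. j \<in> J \<Longrightarrow> continuous_map X entire_topology (F j)"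
  shows "continuous_map X entire_topology (\<lambda>x z. \<Prod>j\<in>J. F j x z)"
  using assms by (induction J) (simp_all add: continuous_map_entire_one[simplified] continuous_map_entire_mult)

lemma continuous_map_mono_eval: "continuous_map entire_seq_topology entire_topology (mono_eval m)"
proof -
  have "continuous_map entire_seq_topology entire_topology (\<lambda>f. f i)" for i
    unfolding entire_seq_topology_def by (rule continuous_map_product_projection) simp
  then have "continuous_map entire_seq_topology entire_topology
      (\<lambda>f z. \<Prod>i\<in>Poly_Mapping.keys m. f i z ^ Poly_Mapping.lookup m i)"
    by (intro continuous_map_entire_prod continuous_map_entire_power) auto
  moreover have "mono_eval m = (\<lambda>f z. \<Prod>i\<in>Poly_Mapping.keys m. f i z ^ Poly_Mapping.lookup m i)"
    by (intro ext) (simp add: mono_eval_def)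
  ultimately show ?thesis by simp
qed

lemma (in conv_op) continuous_map_T: "continuous_map entire_topology entire_topology T"
  unfolding continuous_map_entire_iff
proof (intro ballI conjI allI impI)
  fix f assume "f \<in> topspace entire_topology"
  then have f: "f \<in> entire" by simp
  then show "T f \<in> entire" by (rule T_entire)
  fix S and e :: real assume e: "0 < e"
  \<comment> \<open>the operator expands errors at most by the factor \<open>2 * K\<close>\<close>
  define d where "d = e / (4 * K)"
  have d: "0 < d" using e K by (simp add: d_def)
  show "\<exists>W. openin entire_topology W \<and> f \<in> W \<and> (\<forall>h\<in>W. T h \<in> unif_nbhd (T f) S e)"
  proof (intro exI conjI ballI)
    show "openin entire_topology (unif_nbhd f (S + 2 * R) d)" by (rule openin_unif_nbhd[OF f])
    show "f \<in> unif_nbhd f (S + 2 * R) d" by (rule unif_nbhd_self[OF f d])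
    fix h assume h: "h \<in> unif_nbhd f (S + 2 * R) d"
    then have he: "h \<in> entire" by (simp add: unif_nbhd_def)
    have "norm (T h z - T f z) < e" if "norm z \<le> S" for z
    proof -
      have "norm (T h z - T f z) \<le> 2 * K * d"
        by (rule T_diff_bound[OF f he _ that]) (use h in \<open>auto simp: unif_nbhd_def less_imp_le\<close>)
      also have "\<dots> < e" using e K by (simp add: d_def)
      finally show ?thesis .
    qed
    then show "T h \<in> unif_nbhd (T f) S e" using T_entire[OF he] by (simp add: unif_nbhd_def)
  qed
qed

lemma (in conv_op) continuous_map_Tn:
  assumes "continuous_map X entire_topology F"
  shows "continuous_map X entire_topology (\<lambda>x. (T ^^ N) (F x))"
proof (induction N)
  case (Suc N)
  then show ?case using continuous_map_compose[OF Suc continuous_map_T] by (simp add: o_def)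
qed (use assms in simp)

section \<open>Genericity\<close>

lemma finite_common_nbhd:
  assumes "finite V" "\<And>i. i \<in> V \<Longrightarrow> \<exists>R e. 0 < e \<and> unif_nbhd (f i) R e \<subseteq> U i"
  shows "\<exists>R e. 0 < e \<and> (\<forall>i\<in>V. unif_nbhd (f i) R e \<subseteq> U i)"
  using assms
proof (induction V)
  case empty then show ?case by (auto intro: exI[of _ 1])
next
  case (insert i V)
  then obtain R1 e1 R2 e2 where *: "0 < e1" "\<forall>i\<in>V. unif_nbhd (f i) R1 e1 \<subseteq> U i" "0 < e2" "unif_nbhd (f i) R2 e2 \<subseteq> U i"
    by (metis insertCI)
  have "unif_nbhd (f j) (max R1 R2) (min e1 e2) \<subseteq> unif_nbhd (f j) R1 e1"
    "unif_nbhd (f j) (max R1 R2) (min e1 e2) \<subseteq> unif_nbhd (f j) R2 e2" for j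
    by (rule unif_nbhd_mono; simp)+
  then have "\<forall>j\<in>insert i V. unif_nbhd (f j) (max R1 R2) (min e1 e2) \<subseteq> U j"
    using * by (metis insertE order.trans)
  then show ?case using * by (intro exI[of _ "max R1 R2"] exI[of _ "min e1 e2"]) simp
qed

text \<open>An open set of sequences restricts only finitely many entries, and these only on one disc and up to one
  tolerance.\<close>

lemma openin_entire_seq_nbhd:
  assumes O: "openin entire_seq_topology S" "f0 \<in> S"
  shows "\<exists>V R e. finite V \<and> 0 < e \<and>
    (\<forall>f. (\<forall>i. f i \<in> entire) \<longrightarrow> (\<forall>i\<in>V. f i \<in> unif_nbhd (f0 i) R e) \<longrightarrow> f \<in> S)"
proof -
  obtain U where U: "finite {i. U i \<noteq> entire}" "\<And>i. openin entire_topology (U i)"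
    "f0 \<in> PiE UNIV U" "PiE UNIV U \<subseteq> S"
    using O unfolding entire_seq_topology_def openin_product_topology_alt by auto
  have "\<exists>R e. 0 < e \<and> unif_nbhd (f0 i) R e \<subseteq> U i" for i
    using U(2)[of i] U(3) unfolding openin_entire_iff by auto
  then obtain R e where Re: "0 < e" "\<forall>i\<in>{i. U i \<noteq> entire}. unif_nbhd (f0 i) R e \<subseteq> U i"
    using finite_common_nbhd[OF U(1), of f0 U] by blast
  have "f \<in> S" if "\<forall>i. f i \<in> entire" "\<forall>i\<in>{i. U i \<noteq> entire}. f i \<in> unif_nbhd (f0 i) R e" for f
  proof -
    have "f i \<in> U i" for i using that Re by (cases "U i = entire") auto
    then show ?thesis using U(4) by auto
  qed
  then show ?thesis using U(1) Re(1) by blast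
qed

text \<open>This excludes 0 from the hypercyclic vectors, which yields freeness of the generators, and shows that a dense
  algebra is nonzero.\<close>

lemma zero_orbit_not_dense: "\<not> dense_in entire_topology {\<lambda>_. 0}"
proof
  assume "dense_in entire_topology {\<lambda>_. 0 :: complex}"
  moreover have "openin entire_topology (unif_nbhd (\<lambda>_. 1) 0 1)" by (intro openin_unif_nbhd entire_const)
  moreover have "(\<lambda>_. 1) \<in> unif_nbhd (\<lambda>_. 1) 0 1" by (intro unif_nbhd_self entire_const) simp
  ultimately have "(\<lambda>_. 0 :: complex) \<in> unif_nbhd (\<lambda>_. 1) 0 1"
    unfolding dense_in_def dense_intersects_open by blast
  then have "norm (0 - 1 :: complex) < 1" unfolding unif_nbhd_def by force
  then show False by simp
qed

context convex_ray
begin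

text \<open>The open dense sets whose intersection is the generic set. A single \<open>s\<close> controls radius and tolerance.\<close>

definition hitting :: "real \<Rightarrow> (complex \<Rightarrow> complex) \<Rightarrow> (nat \<Rightarrow>\<^sub>0 nat) set \<Rightarrow> (nat \<Rightarrow>\<^sub>0 nat) \<Rightarrow> (nat \<Rightarrow> complex \<Rightarrow> complex) set" where
  "hitting s G A \<beta> = {f \<in> topspace entire_seq_topology. \<exists>N.
     (T ^^ N) (mono_eval \<beta> f) \<in> unif_nbhd G s (1 / s) \<and>
     (\<forall>\<alpha>\<in>A - {\<beta>}. (T ^^ N) (mono_eval \<alpha> f) \<in> unif_nbhd (\<lambda>_. 0) s (1 / s))}"

definition visiting :: "real \<Rightarrow> (complex \<Rightarrow> complex) \<Rightarrow> (nat \<Rightarrow> complex \<Rightarrow> complex) set" where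
  "visiting s G = {f \<in> topspace entire_seq_topology. \<exists>i. f i \<in> unif_nbhd G s (1 / s)}"

lemma openin_hitting:
  assumes "G \<in> entire" "finite A"
  shows "openin entire_seq_topology (hitting s G A \<beta>)"
proof -
  define H where "H \<alpha> G N = {f \<in> topspace entire_seq_topology. (T ^^ N) (mono_eval \<alpha> f) \<in> unif_nbhd G s (1 / s)}"
    for \<alpha> G N
  have H: "openin entire_seq_topology (H \<alpha> G N)" if "G \<in> entire" for \<alpha> G N
    unfolding H_def
    by (rule openin_continuous_map_preimage[OF continuous_map_Tn[OF continuous_map_mono_eval] openin_unif_nbhd[OF that]])
  have "hitting s G A \<beta> = (\<Union>N. H \<beta> G N \<inter> ((\<Inter>\<alpha>\<in>A - {\<beta>}. H \<alpha> (\<lambda>_. 0) N) \<inter> topspace entire_seq_topology))"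
    by (auto simp: hitting_def H_def)
  moreover have "openin entire_seq_topology \<dots>"
    by (intro openin_Union openin_Int openin_INT H entire_const assms ballI) 
       (auto intro!: openin_Int openin_INT H entire_const assms)
  ultimately show ?thesis by simp
qed

lemma openin_visiting:
  assumes "G \<in> entire"
  shows "openin entire_seq_topology (visiting s G)"
proof -
  have "continuous_map entire_seq_topology entire_topology (\<lambda>f. f i)" for i
    unfolding entire_seq_topology_def by (rule continuous_map_product_projection) simp
  then have "openin entire_seq_topology {f \<in> topspace entire_seq_topology. f i \<in> unif_nbhd G s (1 / s)}" for i
    by (rule openin_continuous_map_preimage[OF _ openin_unif_nbhd[OF assms]])
  then have "openin entire_seq_topology (\<Union>i. {f \<in> topspace entire_seq_topology. f i \<in> unif_nbhd G s (1 / s)})"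
    by blast
  moreover have "visiting s G = (\<Union>i. {f \<in> topspace entire_seq_topology. f i \<in> unif_nbhd G s (1 / s)})"
    by (auto simp: visiting_def)
  ultimately show ?thesis by simp
qed

text \<open>An entry outside the finitely many restricted ones can be chosen at will.\<close>

lemma dense_visiting:
  assumes "G \<in> entire" "0 < s"
  shows "entire_seq_topology closure_of visiting s G = topspace entire_seq_topology"
  unfolding dense_intersects_open
proof (intro allI impI)
  fix S assume S: "openin entire_seq_topology S \<and> S \<noteq> {}"
  then obtain f0 where f0: "f0 \<in> S" by blast
  then have f0e: "\<And>i. f0 i \<in> entire" using S openin_subset topspace_entire_seq by blast
  obtain V R e where V: "finite V" "0 < e"
    "\<forall>f. (\<forall>i. f i \<in> entire) \<longrightarrow> (\<forall>i\<in>V. f i \<in> unif_nbhd (f0 i) R e) \<longrightarrow> f \<in> S"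
    using openin_entire_seq_nbhd[OF _ f0] S by (elim conjE) (metis (no_types, lifting))
  obtain i where i: "i \<notin> V" using V(1) ex_new_if_finite infinite_UNIV_nat by blast
  define f where "f = f0(i := G)"
  have fe: "\<forall>j. f j \<in> entire" using f0e assms by (simp add: f_def)
  have "f j \<in> unif_nbhd (f0 j) R e" if "j \<in> V" for j
    using unif_nbhd_self[OF f0e V(2)] that i by (auto simp: f_def)
  then have "f \<in> S" using V(3) fe by blast
  moreover have "f \<in> visiting s G"
    using fe assms unif_nbhd_self[of G "1 / s" s]
    by (auto simp: visiting_def topspace_entire_seq f_def intro!: exI[of _ i])
  ultimately show "visiting s G \<inter> S \<noteq> {}" by blast
qed

lemma exists_dense_hitting:
  assumes A: "finite A" "A \<noteq> {}" "0 \<notin> A"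
  shows "\<exists>\<beta>\<in>A. \<forall>s G. 0 < s \<longrightarrow> G \<in> entire \<longrightarrow>
    entire_seq_topology closure_of hitting s G A \<beta> = topspace entire_seq_topology"
proof -
  from simultaneous_approximation[OF A] obtain \<beta> where \<beta>: "\<beta> \<in> A" and approx:
    "\<forall>f0 G V Rad e. (\<forall>i. f0 i \<in> entire) \<longrightarrow> G \<in> entire \<longrightarrow> finite V \<longrightarrow> 0 < e \<longrightarrow>
    (\<exists>f N. (\<forall>i. f i \<in> entire) \<and> (\<forall>i\<in>V. \<forall>z. norm z \<le> Rad \<longrightarrow> norm (f i z - f0 i z) < e) \<and>
      (\<forall>z. norm z \<le> Rad \<longrightarrow> norm ((T ^^ N) (mono_eval \<beta> f) z - G z) < e) \<and>
      (\<forall>\<alpha>\<in>A - {\<beta>}. \<forall>z. norm z \<le> Rad \<longrightarrow> norm ((T ^^ N) (mono_eval \<alpha> f) z) < e))"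
    by (elim bexE)
  show ?thesis
  proof (intro bexI[OF _ \<beta>] allI impI)
    fix s :: real and G assume s: "0 < s" and G: "G \<in> entire"
    show "entire_seq_topology closure_of hitting s G A \<beta> = topspace entire_seq_topology"
      unfolding dense_intersects_open
    proof (intro allI impI)
      fix S assume S: "openin entire_seq_topology S \<and> S \<noteq> {}"
      then obtain f0 where f0: "f0 \<in> S" by blast
      then have f0e: "\<forall>i. f0 i \<in> entire" using S openin_subset topspace_entire_seq by blast
      have "openin entire_seq_topology S" using S by simp
      from openin_entire_seq_nbhd[OF this f0] obtain V R e where V: "finite V" "0 < e"
        "\<forall>f. (\<forall>i. f i \<in> entire) \<longrightarrow> (\<forall>i\<in>V. f i \<in> unif_nbhd (f0 i) R e) \<longrightarrow> f \<in> S"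
        by (elim exE conjE)
      have e': "0 < min e (1 / s)" using V s by simp
      from approx[rule_format, of f0 G V "min e (1 / s)" "max R s", OF f0e[rule_format] G V(1) e'] obtain f N where
        fe: "\<forall>i. f i \<in> entire"
        and 1: "\<forall>i\<in>V. \<forall>z. norm z \<le> max R s \<longrightarrow> norm (f i z - f0 i z) < min e (1 / s)"
        and 2: "\<forall>z. norm z \<le> max R s \<longrightarrow> norm ((T ^^ N) (mono_eval \<beta> f) z - G z) < min e (1 / s)"
        and 3: "\<forall>\<alpha>\<in>A - {\<beta>}. \<forall>z. norm z \<le> max R s \<longrightarrow> norm ((T ^^ N) (mono_eval \<alpha> f) z) < min e (1 / s)"
        by (elim exE conjE)
      have Te: "(T ^^ N) (mono_eval \<alpha> f) \<in> entire" for \<alpha>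
        by (intro Tn_entire mono_eval_entire) (use fe in blast)
      have "\<forall>i\<in>V. f i \<in> unif_nbhd (f0 i) R e" using 1 fe by (simp add: unif_nbhd_def)
      then have "f \<in> S" using V(3) fe by blast
      moreover have "f \<in> hitting s G A \<beta>"
        unfolding hitting_def
      proof (intro CollectI conjI exI[of _ N] ballI)
        show "f \<in> topspace entire_seq_topology" using fe by (simp add: topspace_entire_seq)
        show "(T ^^ N) (mono_eval \<beta> f) \<in> unif_nbhd G s (1 / s)" using 2 Te by (simp add: unif_nbhd_def)
        show "(T ^^ N) (mono_eval \<alpha> f) \<in> unif_nbhd (\<lambda>_. 0) s (1 / s)" if "\<alpha> \<in> A - {\<beta>}" for \<alpha>
          using 3[rule_format, OF that] Te by (simp add: unif_nbhd_def)
      qed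
      ultimately show "hitting s G A \<beta> \<inter> S \<noteq> {}" by blast
    qed
  qed
qed

text \<open>To reach \<open>g0\<close>, the \<open>\<beta>\<close>-monomial is sent close to \<open>g0 / c \<beta>\<close> while the other monomials are sent close to 0.
  Neither \<open>s\<close> nor the target in \<open>Q\<close> is fixed beforehand, so arbitrary coefficients \<open>c\<close> are covered although the
  family of conditions on \<open>f\<close> is countable.\<close>

lemma hypercyclic_combination:
  assumes fe: "\<And>i. f i \<in> entire" and keys: "finite A" "\<beta> \<in> A" "c \<beta> \<noteq> 0"
    and Q: "\<And>h R e. h \<in> entire \<Longrightarrow> 0 < e \<Longrightarrow> \<exists>g\<in>Q. \<forall>z. norm z \<le> R \<longrightarrow> norm (g z - h z) < e"
    and hit: "\<And>n G. G \<in> Q \<Longrightarrow> f \<in> hitting (real (Suc n)) G A \<beta>"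
  shows "hypercyclic_vector T (\<lambda>z. \<Sum>\<alpha>\<in>A. c \<alpha> * mono_eval \<alpha> f z)"
proof -
  let ?h = "\<lambda>z. \<Sum>\<alpha>\<in>A. c \<alpha> * mono_eval \<alpha> f z"
  have me: "mono_eval \<alpha> f \<in> entire" for \<alpha> by (rule mono_eval_entire[OF fe])
  have he: "?h \<in> entire" by (intro entire_sum entire_cmult me)
  have Tn: "(T ^^ N) ?h = (\<lambda>z. \<Sum>\<alpha>\<in>A. c \<alpha> * (T ^^ N) (mono_eval \<alpha> f) z)" for N
    by (rule Tn_sum[OF keys(1) me])
  have sub: "{(T ^^ N) ?h | N. True} \<subseteq> entire" using Tn_entire[OF he] by auto
  have "entire_topology closure_of {(T ^^ N) ?h | N. True} = topspace entire_topology"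
    unfolding dense_intersects_open
  proof (intro allI impI)
    fix W assume W: "openin entire_topology W \<and> W \<noteq> {}"
    then obtain g0 where g0: "g0 \<in> W" "g0 \<in> entire" using openin_entire_iff by blast
    have "openin entire_topology W" using W by simp
    from openin_imp_unif_nbhd[OF this g0(1)] obtain R0 e where e: "0 < e" "unif_nbhd g0 R0 e \<subseteq> W"
      by (elim exE conjE)
    define B where "B = 1 + (\<Sum>\<alpha>\<in>A. norm (c \<alpha>))"
    have B: "1 \<le> B" by (simp add: B_def sum_nonneg)
    define C where "C = norm (c \<beta>)"
    have C: "0 < C" using keys by (simp add: C_def)
    have "(\<lambda>z. inverse (c \<beta>) * g0 z) \<in> entire" by (rule entire_cmult[OF g0(2)])
    from Q[OF this, of "e / (2 * C)" R0] obtain G where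
      G: "G \<in> Q" "\<And>z. norm z \<le> R0 \<Longrightarrow> norm (G z - inverse (c \<beta>) * g0 z) < e / (2 * C)" using e C by auto
    obtain n where n: "max R0 (2 * B / e) < real n" using reals_Archimedean2 by blast
    define s where "s = real (Suc n)"
    have s: "R0 \<le> s" "2 * B / e < s" using n by (auto simp: s_def)
    have s0: "0 < s" by (simp add: s_def)
    have Bs: "B * (1 / s) < e / 2" using s s0 e by (simp add: field_simps)
    have "f \<in> hitting s G A \<beta>" using hit[OF G(1)] by (simp add: s_def)
    then obtain N where N1: "(T ^^ N) (mono_eval \<beta> f) \<in> unif_nbhd G s (1 / s)"
      and N2: "\<forall>\<alpha>\<in>A - {\<beta>}. (T ^^ N) (mono_eval \<alpha> f) \<in> unif_nbhd (\<lambda>_. 0) s (1 / s)"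
      unfolding hitting_def by (elim CollectE conjE exE)
    have "(T ^^ N) ?h \<in> unif_nbhd g0 R0 e"
      unfolding unif_nbhd_def
    proof (intro CollectI conjI allI impI)
      show "(T ^^ N) ?h \<in> entire" by (rule Tn_entire[OF he])
      fix z :: complex assume z: "norm z \<le> R0"
      then have zs: "norm z \<le> s" using s by simp
      define y where "y \<alpha> = (T ^^ N) (mono_eval \<alpha> f) z" for \<alpha>
      have y1: "norm (y \<beta> - G z) \<le> 1 / s" using N1 zs by (auto simp: unif_nbhd_def y_def less_imp_le)
      have y2: "norm (y \<alpha>) \<le> 1 / s" if "\<alpha> \<in> A - {\<beta>}" for \<alpha>
        using N2[rule_format, OF that] zs by (auto simp: unif_nbhd_def y_def less_imp_le)
      have split: "(T ^^ N) ?h z - g0 z = c \<beta> * (y \<beta> - G z) + (\<Sum>\<alpha>\<in>A - {\<beta>}. c \<alpha> * y \<alpha>)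
          + c \<beta> * (G z - inverse (c \<beta>) * g0 z)"
        unfolding Tn y_def[symmetric] using keys by (simp add: sum.remove[OF keys(1,2)] algebra_simps)
      have "norm (c \<beta> * (y \<beta> - G z)) \<le> norm (c \<beta>) * (1 / s)"
        unfolding norm_mult by (intro mult_left_mono y1) simp
      moreover have "norm (\<Sum>\<alpha>\<in>A - {\<beta>}. c \<alpha> * y \<alpha>) \<le> (\<Sum>\<alpha>\<in>A - {\<beta>}. norm (c \<alpha>) * (1 / s))"
        by (rule sum_norm_le, unfold norm_mult) (intro mult_left_mono y2 norm_ge_zero)
      moreover have "norm (c \<beta>) * (1 / s) + (\<Sum>\<alpha>\<in>A - {\<beta>}. norm (c \<alpha>) * (1 / s)) = (B - 1) * (1 / s)"
        using sum.remove[OF keys(1,2), of "\<lambda>\<alpha>. norm (c \<alpha>) * (1 / s)"]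
        by (simp add: B_def sum_distrib_right sum_divide_distrib)
      moreover have "(B - 1) * (1 / s) \<le> B * (1 / s)" using s0 by (intro mult_right_mono) auto
      moreover have "norm (c \<beta> * (G z - inverse (c \<beta>) * g0 z)) < e / 2"
      proof -
        have "C * norm (G z - inverse (c \<beta>) * g0 z) < C * (e / (2 * C))"
          using G(2)[OF z] C by (intro mult_strict_left_mono)
        then show ?thesis using C by (simp add: norm_mult C_def)
      qed
      ultimately show "norm ((T ^^ N) ?h z - g0 z) < e"
        unfolding split using Bs
          norm_triangle_ineq[of "c \<beta> * (y \<beta> - G z) + (\<Sum>\<alpha>\<in>A - {\<beta>}. c \<alpha> * y \<alpha>)" "c \<beta> * (G z - inverse (c \<beta>) * g0 z)"]
          norm_triangle_ineq[of "c \<beta> * (y \<beta> - G z)" "\<Sum>\<alpha>\<in>A - {\<beta>}. c \<alpha> * y \<alpha>"] by linarith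
    qed
    then show "{(T ^^ N) ?h | N. True} \<inter> W \<noteq> {}" using e by blast
  qed
  then show ?thesis unfolding hypercyclic_vector_def dense_in_def using he sub by simp
qed

lemma zero_not_hypercyclic: "\<not> hypercyclic_vector T (\<lambda>_. 0)"
proof -
  have "(T ^^ N) (\<lambda>_. 0) = (\<lambda>_. 0)" for N using Tn_cmult[OF entire_const, of N 0 0] by simp
  then show ?thesis using zero_orbit_not_dense by (simp add: hypercyclic_vector_def)
qed

text \<open>The leading monomial \<open>lead A\<close> is chosen for each \<open>A\<close> once and for all, independently of target and accuracy: its coefficient
  in a polynomial determines which target has to be hit. The index \<open>{}\<close> in the place of \<open>A\<close> encodes the
  conditions that make the set of entries dense.\<close>

theorem generic_hypercyclic_algebra:
  "generic_in entire_seq_topology (freely_generates_dense_hypercyclic_algebra T)"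
proof -
  obtain Q where Q: "countable Q" "Q \<subseteq> entire"
    "\<And>h R e. h \<in> entire \<Longrightarrow> 0 < e \<Longrightarrow> \<exists>g\<in>Q. \<forall>z. norm z \<le> R \<longrightarrow> norm (g z - h z) < e"
    using countable_dense_entire by blast
  define \<A> where "\<A> = {A :: (nat \<Rightarrow>\<^sub>0 nat) set. finite A \<and> A \<noteq> {} \<and> 0 \<notin> A}"
  have "\<forall>A\<in>\<A>. \<exists>\<beta>. \<beta> \<in> A \<and> (\<forall>s G. 0 < s \<longrightarrow> G \<in> entire \<longrightarrow>
    entire_seq_topology closure_of hitting s G A \<beta> = topspace entire_seq_topology)"
    using exists_dense_hitting unfolding \<A>_def Bex_def by blast
  from bchoice[OF this] obtain lead where lead: "\<And>A. A \<in> \<A> \<Longrightarrow> lead A \<in> A"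
    "\<And>A s G. A \<in> \<A> \<Longrightarrow> 0 < s \<Longrightarrow> G \<in> entire \<Longrightarrow>
       entire_seq_topology closure_of hitting s G A (lead A) = topspace entire_seq_topology" by blast
  define I where "I = (UNIV :: nat set) \<times> Q \<times> insert {} \<A>"
  define E where "E = (\<lambda>(n, G, A). if A = {} then visiting (real (Suc n)) G else hitting (real (Suc n)) G A (lead A))"
  have ne: "{} \<notin> \<A>" by (simp add: \<A>_def)
  show ?thesis
  proof (rule generic_in_INT[of I E])
    have "countable {A :: (nat \<Rightarrow>\<^sub>0 nat) set. finite A \<and> A \<subseteq> UNIV}"
      by (rule countable_Collect_finite_subset[OF countable_monomials])
    then have "countable \<A>" by (rule countable_subset[rotated]) (auto simp: \<A>_def)
    then show "countable I" using Q(1) unfolding I_def by (intro countable_SIGMA) auto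
    have "Q \<noteq> {}" using Q(3)[OF entire_const, of 1] by auto
    then show "I \<noteq> {}" by (auto simp: I_def)
    fix i assume "i \<in> I"
    then obtain n G A where i: "i = (n, G, A)" "G \<in> Q" "A \<in> insert {} \<A>" by (auto simp: I_def)
    have G: "G \<in> entire" using i Q by blast
    show "openin entire_seq_topology (E i)"
      using openin_visiting[OF G] openin_hitting[OF G] i(3) by (auto simp: i(1) E_def \<A>_def)
    show "entire_seq_topology closure_of E i = topspace entire_seq_topology"
      using dense_visiting[OF G] lead(2)[OF _ _ G] i(3) by (auto simp: i(1) E_def simp del: of_nat_Suc)
  next
    fix f assume "f \<in> (\<Inter>i\<in>I. E i)"
    then have inE: "f \<in> E (n, G, A)" if "G \<in> Q" "A \<in> insert {} \<A>" for n G A using that by (auto simp: I_def)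
    have vis: "f \<in> visiting (real (Suc n)) G" if "G \<in> Q" for n G
      using inE[OF that, of "{}" n] by (simp add: E_def)
    have hit: "f \<in> hitting (real (Suc n)) G A (lead A)" if "G \<in> Q" "A \<in> \<A>" for n G A
    proof -
      have "A \<noteq> {}" using that(2) ne by auto
      then show ?thesis using inE[OF that(1), of A n] that(2) by (simp add: E_def)
    qed
    obtain G0 where "G0 \<in> Q" using Q(3)[OF entire_const zero_less_one] by blast
    then have "f \<in> topspace entire_seq_topology" using vis[of G0 0] by (simp add: visiting_def)
    then have fe: "f i \<in> entire" for i by (simp add: topspace_entire_seq)
    have hyp: "hypercyclic_vector T (eval_cpoly P f)" if P: "P \<in> polys_without_const k" "P \<noteq> 0" for P k
    proof -
      have A: "Poly_Mapping.keys P \<in> \<A>" using P by (auto simp: \<A>_def polys_without_const_def in_keys_iff)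
      have eq: "eval_cpoly P f = (\<lambda>z. \<Sum>\<alpha>\<in>Poly_Mapping.keys P. Poly_Mapping.lookup P \<alpha> * mono_eval \<alpha> f z)"
        by (rule ext) (rule eval_cpoly_mono_eval)
      show ?thesis
        unfolding eq
      proof (rule hypercyclic_combination[OF fe _ lead(1)[OF A] _ Q(3) hit[OF _ A]])
        show "Poly_Mapping.lookup P (lead (Poly_Mapping.keys P)) \<noteq> 0" using lead(1)[OF A] by (simp add: in_keys_iff)
      qed auto
    qed
    have free: "free_generators f"
      unfolding free_generators_def using hyp zero_not_hypercyclic by metis
    have sub: "generated_algebra f \<subseteq> entire" using eval_cpoly_entire[OF fe] by (auto simp: generated_algebra_def)
    have "entire_topology closure_of generated_algebra f = topspace entire_topology"
      unfolding dense_intersects_open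
    proof (intro allI impI)
      fix W assume W: "openin entire_topology W \<and> W \<noteq> {}"
      then obtain g0 where g0: "g0 \<in> W" "g0 \<in> entire" using openin_entire_iff by blast
      have "openin entire_topology W" using W by simp
      from openin_imp_unif_nbhd[OF this g0(1)] obtain R0 e where e: "0 < e" "unif_nbhd g0 R0 e \<subseteq> W"
        by (elim exE conjE)
      obtain G where G: "G \<in> Q" "\<forall>z. norm z \<le> R0 \<longrightarrow> norm (G z - g0 z) < e / 2"
        using Q(3)[OF g0(2), of "e / 2" R0] e by auto
      obtain n where n: "max R0 (2 / e) < real n" using reals_Archimedean2 by blast
      define s where "s = real (Suc n)"
      have s: "R0 \<le> s" "2 / e < s" "0 < s" using n by (auto simp: s_def)
      have s2: "1 / s \<le> e / 2" using s e by (simp add: field_simps)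
      obtain i where i: "f i \<in> unif_nbhd G s (1 / s)" using vis[OF G(1), of n] by (auto simp: visiting_def s_def)
      have "G \<in> unif_nbhd g0 R0 (e / 2)" using G Q(2) by (auto simp: unif_nbhd_def)
      moreover have "f i \<in> unif_nbhd G R0 (e / 2)" using i unif_nbhd_mono[OF s(1) s2, of G] by blast
      ultimately have "f i \<in> unif_nbhd g0 R0 (e / 2 + e / 2)" by (rule unif_nbhd_triangle)
      then have "f i \<in> W" using e by auto
      then show "generated_algebra f \<inter> W \<noteq> {}" using generator_in_generated_algebra by blast
    qed
    then have dense: "dense_in entire_topology (generated_algebra f)" using sub by (simp add: dense_in_def)
    have "generated_algebra f \<noteq> {\<lambda>_. 0}" using dense zero_orbit_not_dense by metis
    moreover have "hypercyclic_vector T h" if h: "h \<in> generated_algebra f" "h \<noteq> (\<lambda>_. 0)" for h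
    proof -
      obtain P k where P: "h = eval_cpoly P f" "P \<in> polys_without_const k"
        using h(1) by (auto simp: generated_algebra_def)
      have "P \<noteq> 0" using h(2) P(1) eval_cpoly_zero by (metis ext)
      then show ?thesis using hyp P by blast
    qed
    ultimately have "hypercyclic_algebra T (generated_algebra f)"
      using generated_subalgebra[OF fe] by (simp add: hypercyclic_algebra_def)
    then show "freely_generates_dense_hypercyclic_algebra T f"
      using free dense by (simp add: freely_generates_dense_hypercyclic_algebra_def)
  qed
qed

end

text \<open>The convex ray exists for every symbol with \<open>|\<Phi>(0)| = 1\<close> that is not an exponential.\<close>

theorem generic_hypercyclic_algebra_unimodular:
  assumes hol: "\<Phi> holomorphic_on UNIV" and et: "exponential_type \<Phi>" and one: "norm (\<Phi> 0) = 1"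
    and not_exp: "\<not> (\<exists>a b. \<forall>z. \<Phi> z = exp (a * z + b))"
  shows "generic_in entire_seq_topology (freely_generates_dense_hypercyclic_algebra (diff_op \<Phi>))"
proof (rule exponential_type_deriv_bound[OF hol et], rule local_log[OF hol one not_exp])
  fix K R g \<rho> w w'
  assume KR: "0 < K" "0 < R" "\<And>n. norm ((deriv ^^ n) \<Phi> 0) \<le> K * R ^ n"
    and g: "0 < (\<rho>::real)" "g holomorphic_on ball 0 \<rho>" "\<And>z. z \<in> ball 0 \<rho> \<Longrightarrow> \<Phi> z = exp (g z)"
    "Re (g 0) = 0" "w \<in> ball 0 \<rho>" "deriv (deriv g) w \<noteq> 0" "w' \<in> ball 0 \<rho>" "g w' \<noteq> g 0"
  show ?thesis
  proof (rule strictly_convex_ray[OF g(2,4,5,6)], rule decay_ray[OF g(2,4,7,8)])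
    fix u r v r'
    assume "norm u = 1" "0 < r" "r \<le> \<rho>" "\<And>t. 0 < t \<Longrightarrow> t < r \<Longrightarrow> 0 < Re (g (of_real t * u))"
      "\<And>x. 0 < x \<Longrightarrow> x < r \<Longrightarrow> \<exists>s. \<forall>y. 0 \<le> y \<longrightarrow> y < r \<longrightarrow> y \<noteq> x \<longrightarrow>
        Re (g (of_real x * u)) + s * (y - x) < Re (g (of_real y * u))"
      "norm v = 1" "0 < r'" "r' \<le> \<rho>" "\<And>t. 0 < t \<Longrightarrow> t < r' \<Longrightarrow> Re (g (of_real t * v)) < 0"
    then interpret convex_ray \<Phi> K R g \<rho> u v r r'
      using hol KR g by unfold_locales
    show ?thesis by (rule generic_hypercyclic_algebra)
  qed
qed

section \<open>Symbols of subexponential growth or with zeros\<close>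

text \<open>On the disc of radius \<open>r\<close> the maximum of \<open>|exp (a z)|\<close> is attained in the direction of the conjugate of \<open>a\<close>
  and equals \<open>exp (|a| r)\<close>.\<close>

lemma exponential_not_subexponential:
  assumes \<Phi>: "\<And>z. \<Phi> z = exp (a * z + b)" and a: "a \<noteq> 0" and b: "Re b = 0"
  shows "\<not> subexponential_growth \<Phi>"
proof -
  have M: "max_modulus \<Phi> r = exp (norm a * r)" if r: "0 \<le> r" for r
    unfolding max_modulus_def
  proof (rule cSup_eq_maximum)
    define z where "z = of_real (r / norm a) * cnj a"
    have "norm z = r" using r a by (simp add: z_def norm_mult norm_divide)
    moreover have "a * cnj a = of_real (norm a) * of_real (norm a)"
      by (metis complex_norm_square of_real_mult power2_eq_square)
    then have "a * z = of_real (norm a * r)"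
      using a by (simp add: z_def mult.left_commute[of a])
    then have "norm (\<Phi> z) = exp (norm a * r)" by (simp add: \<Phi> b)
    ultimately show "exp (norm a * r) \<in> (\<lambda>z. norm (\<Phi> z)) ` cball 0 r" by force
    fix x assume "x \<in> (\<lambda>z. norm (\<Phi> z)) ` cball 0 r"
    then obtain z where z: "norm z \<le> r" "x = norm (\<Phi> z)" by auto
    have "Re (a * z) \<le> norm a * r"
      using complex_Re_le_cmod[of "a * z"] z(1) by (simp add: norm_mult) (meson mult_left_mono norm_ge_zero order_trans)
    then show "x \<le> exp (norm a * r)" using z by (simp add: \<Phi> b)
  qed
  have "((\<lambda>r. (ln (norm a) + ln r) / ln r) \<longlongrightarrow> 1) at_top" by real_asymp
  moreover have "\<forall>\<^sub>F r in at_top. (ln (norm a) + ln r) / ln r = ln (ln (max_modulus \<Phi> r)) / ln r"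
    using eventually_gt_at_top[of 0] by eventually_elim (use a in \<open>simp add: M ln_mult\<close>)
  ultimately have "((\<lambda>r. ln (ln (max_modulus \<Phi> r)) / ln r) \<longlongrightarrow> 1) at_top"
    by (rule Lim_transform_eventually)
  then have "((\<lambda>r. ereal (ln (ln (max_modulus \<Phi> r)) / ln r)) \<longlongrightarrow> ereal 1) at_top" by simp
  then have order: "growth_order \<Phi> = 1"
    unfolding growth_order_def using lim_imp_Limsup[OF trivial_limit_at_top_linorder] by (metis one_ereal_def)
  have "\<forall>\<^sub>F r in at_top. ereal (norm a) = ereal (r powr (- real_of_ereal (growth_order \<Phi>)) * ln (max_modulus \<Phi> r))"
    using eventually_gt_at_top[of 0] by eventually_elim (simp add: M order powr_minus)
  then have "((\<lambda>r. ereal (r powr (- real_of_ereal (growth_order \<Phi>)) * ln (max_modulus \<Phi> r))) \<longlongrightarrow> ereal (norm a)) at_top"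
    by (rule Lim_transform_eventually[OF tendsto_const])
  then have "growth_type \<Phi> = ereal (norm a)"
    unfolding growth_type_def by (rule lim_imp_Limsup[OF trivial_limit_at_top_linorder])
  then show ?thesis using order a by (simp add: subexponential_growth_def)
qed

theorem theorem1p8:
  fixes \<Phi> :: "complex \<Rightarrow> complex"
  assumes "\<Phi> holomorphic_on UNIV"
    and "\<not> \<Phi> constant_on UNIV"
    and "exponential_type \<Phi>"
    and "norm (\<Phi> 0) = 1"
    and "(subexponential_growth \<Phi> \<and> odd (LEAST n. n \<ge> 1 \<and> (deriv ^^ n) \<Phi> 0 \<noteq> 0))
       \<or> (\<exists>(a :: complex) (b :: complex) (p :: complex poly).
            a \<noteq> 0 \<and> Re b = 0 \<and> degree p \<ge> 1 \<and> coeff p 0 = 1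
            \<and> (\<forall>z. \<Phi> z = exp (a * z + b) * poly p z)
            \<and> (coeff p 1 * inverse a \<notin> \<real>
               \<or> (2 * coeff p 2 \<noteq> (coeff p 1)\<^sup>2 \<and> coeff p 1 + a \<noteq> 0)))
       \<or> (\<exists>(a :: complex) (b :: complex) (z :: nat \<Rightarrow> complex).
            hadamard_factorization \<Phi> a b z
            \<and> suminf (\<lambda>n. inverse ((z n)\<^sup>2)) \<noteq> 0 \<and> a \<noteq> 0 \<and> Re b = 0
            \<and> (summable (\<lambda>n. 1 / norm (z n)) \<longrightarrow> suminf (\<lambda>n. inverse (z n)) \<noteq> a))"
  shows "generic_in entire_seq_topology
           (\<lambda>f. freely_generates_dense_hypercyclic_algebra (diff_op \<Phi>) f)"
proof (rule generic_hypercyclic_algebra_unimodular[OF assms(1,3,4)], rule notI)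
  assume "\<exists>a b. \<forall>z. \<Phi> z = exp (a * z + b)"
  then obtain a b where ab: "\<And>z. \<Phi> z = exp (a * z + b)" by blast
  have "Re b = 0" using assms(4) by (simp add: ab)
  moreover have "a \<noteq> 0" using assms(2) ab by (auto simp: constant_on_def)
  ultimately have not_sub: "\<not> subexponential_growth \<Phi>" using exponential_not_subexponential[OF ab] by blast
  have no_zero: "\<Phi> z \<noteq> 0" for z by (simp add: ab)
  have "subexponential_growth \<Phi> \<or>
      (\<exists>a' b' p. degree (p :: complex poly) \<ge> 1 \<and> (\<forall>z. \<Phi> z = exp (a' * z + b') * poly p z)) \<or>
      (\<exists>a' b' z. hadamard_factorization \<Phi> a' b' z)"
    using assms(5) by (elim disjE) blast+
  then show False
  proof (elim disjE exE conjE)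
    assume "subexponential_growth \<Phi>"
    then show False using not_sub by blast
  next
    fix a' b' p assume p: "degree (p :: complex poly) \<ge> 1" "\<forall>z. \<Phi> z = exp (a' * z + b') * poly p z"
    have "coeff p (degree p) \<noteq> 0" using p(1) by auto
    then have "\<exists>i\<in>{1..degree p}. coeff p i \<noteq> 0" using p(1) by force
    then obtain z where "(\<Sum>i\<le>degree p. coeff p i * z ^ i) = 0"
      using fundamental_theorem_of_algebra[of "coeff p" "degree p"] by metis
    then have "poly p z = 0" by (simp add: poly_altdef)
    then show False using no_zero[of z] p(2) by simp
  next
    fix a' b' z assume "hadamard_factorization \<Phi> a' b' z"
    then have "\<Phi> (z 0) = 0" by (auto simp: hadamard_factorization_def zero_sequence_def)
    then show False using no_zero by blast
  qed
qed

end
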